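(* Let $(G_n)$ be a sequence of finite random graphs and let $(G_n,o_n)$ converge locally weakly to a random rooted graph $(G,o)$, where, conditionally on $G_n$, $o_n$ is chosen uniformly from $V(G_n)$. Conditionally on the graphs, let the edge weights $(w_e)_{e\in E(G_n)}$ and $(w_e)_{e\in E(G)}$ be i.i.d. nonnegative random variables with a common continuous distribution $F$. Assume that $\sup_n\mathbf{E}\frac{|E(G_n)|}{|V(G_n)|}<\infty$ and $\mathbf{E}|w_e|^p<\infty$ for some $p>1$. Further assume that, almost surely under the law of $(G,o)$, the limit graph $G$ satisfies the correlation decay assumption (for weight distribution $F$): for each $e\in E(G)$, $\varrho_r(G,e)\to0$ as $r\to\infty$. Then $$\lim_{n\to\infty}\mathbf{E}\frac{\mathsf{W}_{G_n}}{|V(G_n)|}=\frac12\,\mathbf{E}\Bigl[\sum_{v:\,v\sim o}w_{(ov)}\mathbf{1}_{\{(ov)\in\mathsf{M}_G\}}\Bigr]$$ and $$\lim_{n\to\infty}\mathbf{E}\frac{|\mathsf{M}_{G_n}|}{|V(G_n)|}=\frac12\,\mathbf{E}\Bigl[\sum_{v:\,v\sim o}\mathbf{1}_{\{(ov)\in\mathsf{M}_G\}}\Bigr],$$ where $|\mathsf{M}_{G_n}|$ is the number of edges in the matching $\mathsf{M}_{G_n}$ and $\mathbf{E}$ is taken over both the randomness of the graph and of the edge weights.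
   Context: A graph $G=(V(G),E(G))$ is undirected, with edges $(uv)$ being unordered pairs of distinct vertices. For $u,v\in V(G)$, $u\sim_G v$ (or $u\sim v$) means $(uv)\in E(G)$. **Matchings.** A matching of a graph is a set of edges no two of which share a vertex. For a finite graph $H$ with edge weights $(w_e)$, the weight of a matching $M$ is $w_M=\sum_{e\in M}w_e$, $\mathsf{M}_H$ denotes the maximum weight matching (the matching of $H$ maximizing $w_M$), almost surely unique for i.i.d. weights from a continuous distribution (one without atoms), and $\mathsf{W}_H=w_{\mathsf{M}_H}=\sum_{e\in E(H)}w_e\mathbf{1}_{\{e\in\mathsf{M}_H\}}$ is its total weight. Subgraphs inherit edge weights. **Correlation decay.** For an edge $e=(uv)$ of $G$ and $r\ge 0$, $\mathbb{B}_e^r(G)$ is the subgraph of $G$ induced by all vertices at graph distance at most $r$ from $u$ or from $v$. For a subgraph $H$ of $G$, $\partial H=\{v\in V(H): v\sim_G u \text{ for some } u\in V(G)\setminus V(H)\}$. For $A\subseteq V(H)$, $H\setminus A$ is the induced subgraph of $H$ on $V(H)\setminus A$. For a locally finite connected (non-random) graph $G$ with i.i.d. weights of law $F$, $$\varrho_r(G,e)=\mathbf{E}\sup_{A\subseteq \partial \mathbb{B}_e^r(G)}\bigl|\mathbf{1}_{\{e\in \mathsf{M}_{\mathbb{B}_e^r(G)}\}}-\mathbf{1}_{\{e\in \mathsf{M}_{\mathbb{B}_e^r(G)\setminus A}\}}\bigr|,$$ the expectation here being over the edge weights. **MWM on an infinite graph.** If $G$ is an infinite locally finite connected graph with $\varrho_r(G,e)\to0$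 for every $e\in E(G)$, then for any sequence $(H_n)$ of finite subgraphs increasing to $G$ and any $e\in E(G)$, $\lim_n\mathbf{1}_{\{e\in\mathsf{M}_{H_n}\}}$ exists almost surely and is almost surely independent of the choice of $(H_n)$; $\mathsf{M}_G$ is the set of edges $e$ for which this limit is $1$ (almost surely a matching). If $G$ is finite, $\mathsf{M}_G$ is the usual maximum weight matching. **Local weak convergence.** A rooted graph $(G,o)$ is a locally finite graph with a vertex $o$; $\mathbb{B}_o^r(G)$ is the subgraph induced by the vertices at distance at most $r$ from $o$. Let $\mathcal{G}^*$ be the space of isomorphism classes of rooted connected graphs (a possibly disconnected rooted graph is identified with the component of its root), with the metric $d_{\mathrm{loc}}((G_1,o_1),(G_2,o_2))=1/(R+1)$, where $R$ is the supremum of $r\ge0$ such that $(\mathbb{B}_{o_1}^r(G_1),o_1)$ and $(\mathbb{B}_{o_2}^r(G_2),o_2)$ are isomorphic as rooted graphs. $(G_n,o_n)$ converges locally weakly to $(G,o)$ if $\mathbf{E}h(G_n,o_n)\to\mathbf{E}h(G,o)$ for every bounded continuous $h:\mathcal{G}^*\to\mathbb{R}$. *)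

theory Defs
  imports "HOL-Probability.Probability"
begin

section \<open>Graphs\<close>

text \<open>Edges are unordered pairs of distinct vertices, encoded as two-element sets. Vertex and edge
  sets may be infinite.\<close>

datatype 'a graph = Graph (verts: "'a set") (edges: "'a set set")

definition wf_graph :: "'a graph \<Rightarrow> bool" where
  "wf_graph G \<longleftrightarrow> (\<forall>e\<in>edges G. \<exists>u\<in>verts G. \<exists>v\<in>verts G. u \<noteq> v \<and> e = {u, v})"

definition adj :: "'a graph \<Rightarrow> 'a \<Rightarrow> 'a \<Rightarrow> bool" where
  "adj G u v \<longleftrightarrow> {u, v} \<in> edges G"

definition neighbours :: "'a graph \<Rightarrow> 'a \<Rightarrow> 'a set" where
  "neighbours G u = {v. adj G u v}"

definition locally_finite :: "'a graph \<Rightarrow> bool" where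
  "locally_finite G \<longleftrightarrow> (\<forall>v\<in>verts G. finite (neighbours G v))"

definition gdist :: "'a graph \<Rightarrow> 'a \<Rightarrow> 'a \<Rightarrow> enat" where
  "gdist G u v = Inf {enat k | k. (u, v) \<in> {(x, y). adj G x y} ^^ k}"

definition graph_connected :: "'a graph \<Rightarrow> bool" where
  "graph_connected G \<longleftrightarrow> (\<forall>u\<in>verts G. \<forall>v\<in>verts G. gdist G u v < \<infinity>)"

definition subgraph :: "'a graph \<Rightarrow> 'a graph \<Rightarrow> bool" where
  "subgraph H G \<longleftrightarrow> wf_graph H \<and> verts H \<subseteq> verts G \<and> edges H \<subseteq> edges G"

definition induced :: "'a graph \<Rightarrow> 'a set \<Rightarrow> 'a graph" where
  "induced G S = Graph (verts G \<inter> S) {e \<in> edges G. e \<subseteq> S}"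

text \<open>With \<open>S = {v}\<close> this is the ball around the vertex \<open>v\<close>, with \<open>S = e\<close> the ball around the
  edge \<open>e\<close>.\<close>

definition ball_graph :: "'a graph \<Rightarrow> 'a set \<Rightarrow> nat \<Rightarrow> 'a graph" where
  "ball_graph G S r = induced G {v. \<exists>u\<in>S. gdist G u v \<le> enat r}"

definition component :: "'a graph \<Rightarrow> 'a \<Rightarrow> 'a graph" where
  "component G v = induced G {u. gdist G v u < \<infinity>}"

definition boundary :: "'a graph \<Rightarrow> 'a graph \<Rightarrow> 'a set" where
  "boundary G H = {v \<in> verts H. \<exists>u \<in> verts G - verts H. adj G v u}"

definition del_verts :: "'a graph \<Rightarrow> 'a set \<Rightarrow> 'a graph" where
  "del_verts H A = induced H (verts H - A)"

text \<open>A sequence of finite (not necessarily induced) subgraphs increasing to \<open>G\<close>.\<close>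

definition exhaustion :: "(nat \<Rightarrow> 'a graph) \<Rightarrow> 'a graph \<Rightarrow> bool" where
  "exhaustion H G \<longleftrightarrow>
     (\<forall>n. finite (verts (H n)) \<and> subgraph (H n) (H (Suc n)) \<and> subgraph (H n) G) \<and>
     (\<Union>n. verts (H n)) = verts G \<and> (\<Union>n. edges (H n)) = edges G"


lemma gdist_le_iff: "gdist G u v \<le> enat r \<longleftrightarrow> (\<exists>k\<le>r. (u, v) \<in> {(x, y). adj G x y} ^^ k)"
proof
  assume "gdist G u v \<le> enat r"
  then have "gdist G u v < enat (Suc r)"
    by (meson enat_ord_simps(2) le_less_trans lessI)
  then show "\<exists>k\<le>r. (u, v) \<in> {(x, y). adj G x y} ^^ k"
    unfolding gdist_def Inf_less_iff by (auto simp: less_Suc_eq_le)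
next
  assume "\<exists>k\<le>r. (u, v) \<in> {(x, y). adj G x y} ^^ k"
  then obtain k where "k \<le> r" "(u, v) \<in> {(x, y). adj G x y} ^^ k"
    by blast
  then have "gdist G u v \<le> enat k"
    unfolding gdist_def by (intro Inf_lower) blast
  then show "gdist G u v \<le> enat r"
    using \<open>k \<le> r\<close> by (meson enat_ord_simps(1) order_trans)
qed

lemma gdist_self: "gdist G u u = 0"
  using gdist_le_iff[of G u u 0] by (simp add: enat_0)


section \<open>Maximum weight matchings\<close>

definition matching :: "'a graph \<Rightarrow> 'a set set \<Rightarrow> bool" where
  "matching G M \<longleftrightarrow> M \<subseteq> edges G \<and> pairwise disjnt M"

text \<open>The maximizer is unique only almost surely; on the null set of ties, \<open>arg_max\<close> picks one that
  depends only on the finite set of maximizers, so \<open>mwm G\<close> is a measurable function of the weights.\<close>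

definition mwm :: "'a graph \<Rightarrow> ('a set \<Rightarrow> real) \<Rightarrow> 'a set set" where
  "mwm G w = (ARG_MAX (\<lambda>M. \<Sum>e\<in>M. w e) M. matching G M)"

definition mwm_weight :: "'a graph \<Rightarrow> ('a set \<Rightarrow> real) \<Rightarrow> real" where
  "mwm_weight G w = (\<Sum>e\<in>mwm G w. w e)"

text \<open>The matching of a possibly infinite graph \<open>G\<close>, computed along the sequence \<open>H\<close> of finite
  subgraphs; \<open>H\<close> is irrelevant if \<open>G\<close> is finite.\<close>

definition mwm_along :: "(nat \<Rightarrow> 'a graph) \<Rightarrow> 'a graph \<Rightarrow> ('a set \<Rightarrow> real) \<Rightarrow> 'a set set" where
  "mwm_along H G w =
     (if finite (verts G) then mwm G w
      else {e \<in> edges G. (\<lambda>n. of_bool (e \<in> mwm (H n) w) :: real) \<longlonglongrightarrow> 1})"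


section \<open>Random weights and correlation decay\<close>

text \<open>The law of i.i.d. edge weights \<open>(w e)\<close>, \<open>e \<in> edges G\<close>, with common law \<open>F\<close>. Subgraphs inherit
  weights because their edges are edges of \<open>G\<close>.\<close>

definition edge_weights :: "real measure \<Rightarrow> 'a graph \<Rightarrow> ('a set \<Rightarrow> real) measure" where
  "edge_weights F G = PiM (edges G) (\<lambda>_. F)"

definition corr :: "real measure \<Rightarrow> 'a graph \<Rightarrow> 'a set \<Rightarrow> nat \<Rightarrow> real" where
  "corr F G e r =
     (\<integral>w. (SUP A \<in> Pow (boundary G (ball_graph G e r)).
             \<bar>of_bool (e \<in> mwm (ball_graph G e r) w)
              - of_bool (e \<in> mwm (del_verts (ball_graph G e r) A) w)\<bar>) \<partial>edge_weights F G)"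

definition correlation_decay :: "real measure \<Rightarrow> 'a graph \<Rightarrow> bool" where
  "correlation_decay F G \<longleftrightarrow> (\<forall>e\<in>edges G. (\<lambda>r. corr F G e r) \<longlonglongrightarrow> 0)"


section \<open>The space of rooted graphs\<close>

definition rooted_iso :: "'a graph \<times> 'a \<Rightarrow> 'a graph \<times> 'a \<Rightarrow> bool" where
  "rooted_iso x y \<longleftrightarrow>
     (\<exists>f. bij_betw f (verts (fst x)) (verts (fst y)) \<and> f (snd x) = snd y \<and>
          (\<forall>u\<in>verts (fst x). \<forall>v\<in>verts (fst x). adj (fst x) u v \<longleftrightarrow> adj (fst y) (f u) (f v)))"

definition rooted_graph :: "'a graph \<times> 'a \<Rightarrow> bool" where
  "rooted_graph x \<longleftrightarrow> wf_graph (fst x) \<and> locally_finite (fst x) \<and> graph_connected (fst x) \<and>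
     snd x \<in> verts (fst x)"

definition rooted_ball :: "'a graph \<times> 'a \<Rightarrow> nat \<Rightarrow> 'a graph \<times> 'a" where
  "rooted_ball x r = (ball_graph (fst x) {snd x} r, snd x)"

text \<open>A connected locally finite graph is countable, hence isomorphic to a graph whose vertices are
  natural numbers. So the following type consists of all isomorphism classes of rooted connected
  locally finite graphs.\<close>

definition rooted_eq :: "nat graph \<times> nat \<Rightarrow> nat graph \<times> nat \<Rightarrow> bool" where
  "rooted_eq x y \<longleftrightarrow> rooted_graph x \<and> rooted_graph y \<and> rooted_iso x y"

lemma rooted_iso_refl: "rooted_iso x x"
  unfolding rooted_iso_def by (rule exI[of _ id]) auto

lemma rooted_iso_sym:
  assumes "snd x \<in> verts (fst x)" "rooted_iso x y"
  shows "rooted_iso y x"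
proof -
  obtain f where f: "bij_betw f (verts (fst x)) (verts (fst y))" "f (snd x) = snd y"
    "\<And>u v. u \<in> verts (fst x) \<Longrightarrow> v \<in> verts (fst x) \<Longrightarrow> adj (fst x) u v \<longleftrightarrow> adj (fst y) (f u) (f v)"
    using assms(2) unfolding rooted_iso_def by blast
  let ?g = "inv_into (verts (fst x)) f"
  have "bij_betw ?g (verts (fst y)) (verts (fst x))"
    using f(1) by (rule bij_betw_inv_into)
  moreover have "?g (snd y) = snd x"
    using bij_betw_inv_into_left[OF f(1) assms(1)] f(2) by simp
  moreover have "adj (fst y) u v \<longleftrightarrow> adj (fst x) (?g u) (?g v)"
    if "u \<in> verts (fst y)" "v \<in> verts (fst y)" for u v
    using that f(3)[of "?g u" "?g v"] bij_betw_inv_into_right[OF f(1)]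
      bij_betwE[OF bij_betw_inv_into[OF f(1)]] by auto
  ultimately show ?thesis unfolding rooted_iso_def by blast
qed

lemma rooted_iso_trans:
  assumes "rooted_iso x y" "rooted_iso y z"
  shows "rooted_iso x z"
proof -
  obtain f where f: "bij_betw f (verts (fst x)) (verts (fst y))" "f (snd x) = snd y"
    "\<And>u v. u \<in> verts (fst x) \<Longrightarrow> v \<in> verts (fst x) \<Longrightarrow> adj (fst x) u v \<longleftrightarrow> adj (fst y) (f u) (f v)"
    using assms(1) unfolding rooted_iso_def by blast
  obtain g where g: "bij_betw g (verts (fst y)) (verts (fst z))" "g (snd y) = snd z"
    "\<And>u v. u \<in> verts (fst y) \<Longrightarrow> v \<in> verts (fst y) \<Longrightarrow> adj (fst y) u v \<longleftrightarrow> adj (fst z) (g u) (g v)"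
    using assms(2) unfolding rooted_iso_def by blast
  show ?thesis unfolding rooted_iso_def
    using bij_betw_trans[OF f(1) g(1)] f g bij_betwE[OF f(1)]
    by (intro exI[of _ "g \<circ> f"]) auto
qed

lemma part_equivp_rooted_eq: "part_equivp rooted_eq"
proof (rule part_equivpI)
  have "rooted_graph (Graph {0::nat} {}, 0)"
    unfolding rooted_graph_def wf_graph_def locally_finite_def graph_connected_def
      neighbours_def adj_def
    by (simp add: gdist_self)
  then show "\<exists>x. rooted_eq x x"
    unfolding rooted_eq_def using rooted_iso_refl by blast
  show "symp rooted_eq"
    unfolding rooted_eq_def symp_def using rooted_iso_sym by (auto simp: rooted_graph_def)
  show "transp rooted_eq"
    unfolding rooted_eq_def transp_def using rooted_iso_trans by blast
qed

quotient_type rgraph = "nat graph \<times> nat" / partial: rooted_eq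
  by (rule part_equivp_rooted_eq)

lemma rooted_graph_rep: "rooted_graph (rep_rgraph g)"
  using Quotient3_rep_reflp[OF Quotient3_rgraph, of g] by (simp add: rooted_eq_def)

lemma rep_eqI:
  assumes "rooted_iso (rep_rgraph g) (rep_rgraph h)"
  shows "g = h"
  using assms rooted_graph_rep Quotient3_rel_rep[OF Quotient3_rgraph, of g h]
  by (simp add: rooted_eq_def)

text \<open>An arbitrary representative \<open>(G, o)\<close> of an isomorphism class.\<close>

definition graph_of :: "rgraph \<Rightarrow> nat graph" where
  "graph_of g = fst (rep_rgraph g)"

definition root_of :: "rgraph \<Rightarrow> nat" where
  "root_of g = snd (rep_rgraph g)"


subsection \<open>The local metric\<close>

definition same_ball :: "rgraph \<Rightarrow> rgraph \<Rightarrow> nat \<Rightarrow> bool" where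
  "same_ball g h r \<longleftrightarrow> rooted_iso (rooted_ball (rep_rgraph g) r) (rooted_ball (rep_rgraph h) r)"

lemma verts_rooted_ball:
  "verts (fst (rooted_ball x r)) = {v \<in> verts (fst x). gdist (fst x) (snd x) v \<le> enat r}"
  by (auto simp: rooted_ball_def ball_graph_def induced_def)

lemma snd_rooted_ball [simp]: "snd (rooted_ball x r) = snd x"
  by (simp add: rooted_ball_def)

lemma adj_rooted_ball:
  assumes "u \<in> verts (fst (rooted_ball x r))" "v \<in> verts (fst (rooted_ball x r))"
  shows "adj (fst (rooted_ball x r)) u v \<longleftrightarrow> adj (fst x) u v"
  using assms by (auto simp: rooted_ball_def ball_graph_def induced_def adj_def)

lemma adj_verts: "wf_graph G \<Longrightarrow> adj G u v \<Longrightarrow> u \<in> verts G \<and> v \<in> verts G"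
  unfolding wf_graph_def adj_def by (metis doubleton_eq_iff)

lemma rooted_ball_mono:
  "k \<le> r \<Longrightarrow> verts (fst (rooted_ball x k)) \<subseteq> verts (fst (rooted_ball x r))"
  unfolding verts_rooted_ball by (auto intro: order_trans)

lemma root_in_ball: "rooted_graph x \<Longrightarrow> snd x \<in> verts (fst (rooted_ball x r))"
  unfolding verts_rooted_ball rooted_graph_def by (simp add: gdist_self)

definition ball_iso :: "('a \<Rightarrow> 'b) \<Rightarrow> 'a graph \<times> 'a \<Rightarrow> 'b graph \<times> 'b \<Rightarrow> nat \<Rightarrow> bool" where
  "ball_iso f x y r \<longleftrightarrow>
     bij_betw f (verts (fst (rooted_ball x r))) (verts (fst (rooted_ball y r))) \<and> f (snd x) = snd y \<and>
     (\<forall>u\<in>verts (fst (rooted_ball x r)). \<forall>v\<in>verts (fst (rooted_ball x r)).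
        adj (fst x) u v \<longleftrightarrow> adj (fst y) (f u) (f v))"

lemma rooted_iso_ball_iff:
  "rooted_iso (rooted_ball x r) (rooted_ball y r) \<longleftrightarrow> (\<exists>f. ball_iso f x y r)"
  unfolding rooted_iso_def ball_iso_def snd_rooted_ball
  by (intro ex_cong1 conj_cong refl ball_cong) (simp add: adj_rooted_ball bij_betwE)

lemma relpow_imp_ball:
  assumes "rooted_graph x" "(snd x, v) \<in> {(a, b). adj (fst x) a b} ^^ k" "k \<le> r"
  shows "v \<in> verts (fst (rooted_ball x r))"
proof -
  have "v \<in> verts (fst x)"
    using assms(1,2) adj_verts[of "fst x"] by (cases k) (auto simp: rooted_graph_def)
  then show ?thesis
    using assms(2,3) unfolding verts_rooted_ball gdist_le_iff by blast
qed

lemma ball_iso_relpow: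
  assumes "rooted_graph x" "rooted_graph y" "ball_iso f x y r"
  shows "k \<le> r \<Longrightarrow> (snd x, v) \<in> {(a, b). adj (fst x) a b} ^^ k \<Longrightarrow>
    (snd y, f v) \<in> {(a, b). adj (fst y) a b} ^^ k"
proof (induction k arbitrary: v)
  case 0
  then show ?case using assms(3) by (simp add: ball_iso_def)
next
  case (Suc k)
  then obtain u where u: "(snd x, u) \<in> {(a, b). adj (fst x) a b} ^^ k" "adj (fst x) u v"
    by auto
  have "u \<in> verts (fst (rooted_ball x r))" "v \<in> verts (fst (rooted_ball x r))"
    using relpow_imp_ball[OF assms(1) u(1)] relpow_imp_ball[OF assms(1) Suc.prems(2)] Suc.prems(1)
    by simp_all
  then have "adj (fst y) (f u) (f v)"
    using assms(3) u(2) by (auto simp: ball_iso_def)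
  then show ?case
    using Suc.IH[OF _ u(1)] Suc.prems(1) by auto
qed

lemma ball_iso_image:
  assumes "rooted_graph x" "rooted_graph y" "ball_iso f x y r" "k \<le> r"
    "v \<in> verts (fst (rooted_ball x k))"
  shows "f v \<in> verts (fst (rooted_ball y k))"
proof -
  obtain j where "j \<le> k" "(snd x, v) \<in> {(a, b). adj (fst x) a b} ^^ j"
    using assms(5) unfolding verts_rooted_ball gdist_le_iff by blast
  then show ?thesis
    using relpow_imp_ball[OF assms(2)] ball_iso_relpow[OF assms(1,2,3)] assms(4)
    by (meson order_trans)
qed

lemma ball_iso_inv:
  assumes "rooted_graph x" "ball_iso f x y r"
  shows "ball_iso (inv_into (verts (fst (rooted_ball x r))) f) y x r"
proof -
  let ?X = "verts (fst (rooted_ball x r))" and ?Y = "verts (fst (rooted_ball y r))"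
  let ?g = "inv_into ?X f"
  have f: "bij_betw f ?X ?Y" "f (snd x) = snd y"
    "\<And>u v. u \<in> ?X \<Longrightarrow> v \<in> ?X \<Longrightarrow> adj (fst x) u v \<longleftrightarrow> adj (fst y) (f u) (f v)"
    using assms(2) by (auto simp: ball_iso_def)
  have g: "bij_betw ?g ?Y ?X"
    using f(1) by (rule bij_betw_inv_into)
  moreover have "?g (snd y) = snd x"
    using bij_betw_inv_into_left[OF f(1) root_in_ball[OF assms(1)]] f(2) by simp
  moreover have "adj (fst y) u v \<longleftrightarrow> adj (fst x) (?g u) (?g v)" if "u \<in> ?Y" "v \<in> ?Y" for u v
    using that f(3)[of "?g u" "?g v"] bij_betw_inv_into_right[OF f(1)] bij_betwE[OF g] by auto
  ultimately show ?thesis unfolding ball_iso_def by blast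
qed

lemma ball_iso_mono:
  assumes "rooted_graph x" "rooted_graph y" "ball_iso f x y r" "k \<le> r"
  shows "ball_iso f x y k"
proof -
  let ?X = "\<lambda>k. verts (fst (rooted_ball x k))" and ?Y = "\<lambda>k. verts (fst (rooted_ball y k))"
  let ?g = "inv_into (?X r) f"
  have f: "bij_betw f (?X r) (?Y r)" "f (snd x) = snd y"
    "\<And>u v. u \<in> ?X r \<Longrightarrow> v \<in> ?X r \<Longrightarrow> adj (fst x) u v \<longleftrightarrow> adj (fst y) (f u) (f v)"
    using assms(3) by (auto simp: ball_iso_def)
  note sub = rooted_ball_mono[OF assms(4), of x] rooted_ball_mono[OF assms(4), of y]
  have "bij_betw f (?X k) (?Y k)"
    unfolding bij_betw_def
  proof
    show "inj_on f (?X k)"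
      using f(1) sub(1) by (meson bij_betw_imp_inj_on inj_on_subset)
    show "f ` ?X k = ?Y k"
    proof
      show "f ` ?X k \<subseteq> ?Y k"
        using ball_iso_image[OF assms] by blast
      show "?Y k \<subseteq> f ` ?X k"
      proof
        fix v assume v: "v \<in> ?Y k"
        then have "?g v \<in> ?X k"
          by (rule ball_iso_image[OF assms(2,1) ball_iso_inv[OF assms(1,3)] assms(4)])
        moreover have "f (?g v) = v"
          using bij_betw_inv_into_right[OF f(1)] v sub(2) by blast
        ultimately show "v \<in> f ` ?X k" by force
      qed
    qed
  qed
  then show ?thesis
    using f(2,3) sub(1) unfolding ball_iso_def by blast
qed

lemma finite_rooted_ball:
  assumes "rooted_graph x"
  shows "finite (verts (fst (rooted_ball x r)))"
proof (induction r)
  case 0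
  have "verts (fst (rooted_ball x 0)) \<subseteq> {snd x}"
    unfolding verts_rooted_ball gdist_le_iff by auto
  then show ?case by (rule finite_subset) simp
next
  case (Suc r)
  let ?B = "verts (fst (rooted_ball x r))"
  have "verts (fst (rooted_ball x (Suc r))) \<subseteq> ?B \<union> (\<Union>u\<in>?B. neighbours (fst x) u)"
  proof
    fix v assume v: "v \<in> verts (fst (rooted_ball x (Suc r)))"
    then obtain k where k: "k \<le> Suc r" "(snd x, v) \<in> {(a, b). adj (fst x) a b} ^^ k"
      unfolding verts_rooted_ball gdist_le_iff by blast
    show "v \<in> ?B \<union> (\<Union>u\<in>?B. neighbours (fst x) u)"
    proof (cases "k \<le> r")
      case True
      then show ?thesis using relpow_imp_ball[OF assms k(2)] by blast
    next
      case False
      then have "k = Suc r" using k(1) by simp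
      then obtain u where "(snd x, u) \<in> {(a, b). adj (fst x) a b} ^^ r" "adj (fst x) u v"
        using k(2) by auto
      then show ?thesis
        using relpow_imp_ball[OF assms] by (auto simp: neighbours_def)
    qed
  qed
  moreover have "finite (neighbours (fst x) u)" if "u \<in> ?B" for u
    using that assms unfolding verts_rooted_ball rooted_graph_def locally_finite_def by blast
  ultimately show ?case using Suc by (meson finite_UN finite_UnI finite_subset)
qed

lemma in_rooted_ball:
  assumes "rooted_graph x" "v \<in> verts (fst x)"
  shows "\<exists>r. v \<in> verts (fst (rooted_ball x r))"
proof -
  have "gdist (fst x) (snd x) v < \<infinity>"
    using assms by (auto simp: rooted_graph_def graph_connected_def)
  then obtain r where "gdist (fst x) (snd x) v = enat r" by (cases "gdist (fst x) (snd x) v") auto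
  then show ?thesis using assms(2) unfolding verts_rooted_ball by auto
qed

lemma rooted_iso_if_balls:
  assumes x: "rooted_graph x" and y: "rooted_graph y" and iso: "\<And>r. \<exists>f. ball_iso f x y r"
  shows "rooted_iso x y"
proof -
  let ?X = "\<lambda>k. verts (fst (rooted_ball x k))" and ?Y = "\<lambda>k. verts (fst (rooted_ball y k))"
  obtain f where f: "\<And>r. ball_iso (f r) x y r"
    using iso by metis
  have step: "\<exists>r0\<in>T. infinite {r \<in> T. k \<le> r \<and> (\<forall>v\<in>?X k. f r v = f r0 v)}"
    if "infinite T" for k T
  proof -
    define T' where "T' = T \<inter> {k..}"
    have T': "infinite T'"
    proof
      assume "finite T'"
      then have "finite (T' \<union> {..<k})" by simp
      moreover have "T \<subseteq> T' \<union> {..<k}" by (auto simp: T'_def)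
      ultimately show False using that finite_subset by blast
    qed
    let ?F = "\<lambda>r. restrict (f r) (?X k)"
    have "?F ` T' \<subseteq> PiE (?X k) (\<lambda>_. ?Y k)"
      using ball_iso_image[OF x y f] by (auto simp: T'_def)
    moreover have "finite (PiE (?X k) (\<lambda>_. ?Y k))"
      using finite_rooted_ball[OF x] finite_rooted_ball[OF y] by (intro finite_PiE) auto
    ultimately have "finite (?F ` T')" by (rule finite_subset)
    from pigeonhole_infinite[OF T' this] obtain r0
      where r0: "r0 \<in> T'" "infinite {r \<in> T'. ?F r = ?F r0}" by blast
    have "{r \<in> T'. ?F r = ?F r0} \<subseteq> {r \<in> T. k \<le> r \<and> (\<forall>v\<in>?X k. f r v = f r0 v)}"
      by (auto simp: T'_def) (metis restrict_apply')
    then have "infinite {r \<in> T. k \<le> r \<and> (\<forall>v\<in>?X k. f r v = f r0 v)}"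
      using r0(2) finite_subset by blast
    then show ?thesis using r0(1) by (auto simp: T'_def)
  qed
  define P where "P k g \<longleftrightarrow> infinite {r. k \<le> r \<and> (\<forall>v\<in>?X k. f r v = g v)}" for k g
  have "\<exists>g. \<forall>k. P k (g k) \<and> (\<forall>v\<in>?X k. g (Suc k) v = g k v)"
  proof (rule dependent_nat_choice)
    show "\<exists>g. P 0 g"
      using step[of UNIV 0] unfolding P_def by auto
  next
    fix g k assume "P k g"
    from step[OF this[unfolded P_def], of "Suc k"] obtain r0
      where r0: "\<forall>v\<in>?X k. f r0 v = g v"
        and inf: "infinite {r \<in> {r. k \<le> r \<and> (\<forall>v\<in>?X k. f r v = g v)}.
                   Suc k \<le> r \<and> (\<forall>v\<in>?X (Suc k). f r v = f r0 v)}" by blast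
    have "P (Suc k) (f r0)"
      unfolding P_def using inf by (rule infinite_super[rotated]) auto
    then show "\<exists>g'. P (Suc k) g' \<and> (\<forall>v\<in>?X k. g' v = g v)"
      using r0 by blast
  qed
  then obtain g where P: "\<And>k. P k (g k)" and Suc: "\<And>k v. v \<in> ?X k \<Longrightarrow> g (Suc k) v = g k v"
    by blast
  have stable: "g (k + j) v = g k v" if "v \<in> ?X k" for k j v
  proof (induction j)
    case (Suc j)
    have "v \<in> ?X (k + j)" using that rooted_ball_mono[of k "k + j" x] by auto
    then show ?case using \<open>\<And>k v. v \<in> ?X k \<Longrightarrow> g (Suc k) v = g k v\<close> Suc.IH by simp
  qed simp
  have g_iso: "ball_iso (g k) x y k" for k
  proof -
    obtain r where r: "k \<le> r" "\<forall>v\<in>?X k. f r v = g k v"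
      using P[of k] unfolding P_def using not_finite_existsD by blast
    have "ball_iso (f r) x y k"
      by (rule ball_iso_mono[OF x y f r(1)])
    then show ?thesis
      using r(2) root_in_ball[OF x, of k] unfolding ball_iso_def
      by (auto cong: bij_betw_cong)
  qed
  define G where "G v = g (LEAST k. v \<in> ?X k) v" for v
  have G: "G v = g k v" if "v \<in> ?X k" for k v
  proof -
    have "v \<in> ?X (LEAST k. v \<in> ?X k)" using that by (rule LeastI)
    moreover have "(LEAST k. v \<in> ?X k) \<le> k" using that by (rule Least_le)
    ultimately show ?thesis
      unfolding G_def using stable[of v "LEAST k. v \<in> ?X k" "k - (LEAST k. v \<in> ?X k)"] by simp
  qed
  have common: "\<exists>k. u \<in> ?X k \<and> v \<in> ?X k"
    if uv: "u \<in> verts (fst x)" "v \<in> verts (fst x)" for u v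
  proof -
    obtain i j where ij: "u \<in> ?X i" "v \<in> ?X j"
      using in_rooted_ball[OF x uv(1)] in_rooted_ball[OF x uv(2)] by blast
    then have "u \<in> ?X (max i j)" "v \<in> ?X (max i j)"
      using rooted_ball_mono[of i "max i j" x] rooted_ball_mono[of j "max i j" x] by auto
    then show ?thesis by blast
  qed
  have "inj_on G (verts (fst x))"
  proof (rule inj_onI)
    fix u v assume uv: "u \<in> verts (fst x)" "v \<in> verts (fst x)" "G u = G v"
    then obtain k where k: "u \<in> ?X k" "v \<in> ?X k" using common by blast
    then have "g k u = g k v" using uv(3) G by simp
    then show "u = v"
      using g_iso[of k] k unfolding ball_iso_def bij_betw_def inj_on_def by blast
  qed
  moreover have "G ` verts (fst x) \<subseteq> verts (fst y)"
  proof
    fix z assume "z \<in> G ` verts (fst x)"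
    then obtain v where v: "v \<in> verts (fst x)" "z = G v" by blast
    then obtain k where k: "v \<in> ?X k" using common by blast
    then have "g k v \<in> ?Y k" using ball_iso_image[OF x y g_iso] by blast
    then show "z \<in> verts (fst y)" using v(2) G[OF k] by (simp add: verts_rooted_ball)
  qed
  moreover have "verts (fst y) \<subseteq> G ` verts (fst x)"
  proof
    fix z assume "z \<in> verts (fst y)"
    then obtain k where "z \<in> ?Y k" using in_rooted_ball[OF y] by blast
    then have "z \<in> g k ` ?X k" using g_iso[of k] unfolding ball_iso_def bij_betw_def by blast
    then obtain v where v: "v \<in> ?X k" "z = g k v" by blast
    then have "z = G v" "v \<in> verts (fst x)" using G[OF v(1)] by (simp_all add: verts_rooted_ball)
    then show "z \<in> G ` verts (fst x)" by blast
  qed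
  moreover have "G (snd x) = snd y"
    using G[OF root_in_ball[OF x], of 0] g_iso[of 0] by (simp add: ball_iso_def)
  moreover have "adj (fst x) u v \<longleftrightarrow> adj (fst y) (G u) (G v)"
    if uv: "u \<in> verts (fst x)" "v \<in> verts (fst x)" for u v
  proof -
    obtain k where "u \<in> ?X k" "v \<in> ?X k" using common uv by blast
    then show ?thesis using g_iso[of k] G by (auto simp: ball_iso_def)
  qed
  ultimately show ?thesis
    unfolding rooted_iso_def bij_betw_def by (intro exI[of _ G] conjI ballI subset_antisym)
qed

lemma same_ball_iff: "same_ball g h r \<longleftrightarrow> (\<exists>f. ball_iso f (rep_rgraph g) (rep_rgraph h) r)"
  unfolding same_ball_def by (rule rooted_iso_ball_iff)

lemma same_ball_mono:
  assumes "same_ball g h r" "k \<le> r"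
  shows "same_ball g h k"
proof -
  obtain f where "ball_iso f (rep_rgraph g) (rep_rgraph h) r"
    using assms(1) unfolding same_ball_iff by (rule exE)
  then have "ball_iso f (rep_rgraph g) (rep_rgraph h) k"
    by (rule ball_iso_mono[OF rooted_graph_rep rooted_graph_rep _ assms(2)])
  then show ?thesis unfolding same_ball_iff by (intro exI[where x = f])
qed

lemma same_ball_sym:
  assumes "same_ball g h r"
  shows "same_ball h g r"
  unfolding same_ball_def
proof (rule rooted_iso_sym)
  show "snd (rooted_ball (rep_rgraph g) r) \<in> verts (fst (rooted_ball (rep_rgraph g) r))"
    using root_in_ball[OF rooted_graph_rep] by simp
  show "rooted_iso (rooted_ball (rep_rgraph g) r) (rooted_ball (rep_rgraph h) r)"
    using assms by (simp only: same_ball_def)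
qed

lemma same_ball_trans: "same_ball g h r \<Longrightarrow> same_ball h k r \<Longrightarrow> same_ball g k r"
  unfolding same_ball_def by (rule rooted_iso_trans)

lemma verts_rooted_ball_0:
  assumes "rooted_graph x"
  shows "verts (fst (rooted_ball x 0)) = {snd x}"
  using assms unfolding verts_rooted_ball gdist_le_iff by (auto simp: rooted_graph_def)

lemma not_adj_self: "wf_graph G \<Longrightarrow> \<not> adj G u u"
  by (auto simp: wf_graph_def adj_def)

lemma same_ball_0: "same_ball g h 0"
proof -
  have "wf_graph (fst (rep_rgraph g))" "wf_graph (fst (rep_rgraph h))"
    using rooted_graph_rep unfolding rooted_graph_def by blast+
  then have "ball_iso (\<lambda>_. snd (rep_rgraph h)) (rep_rgraph g) (rep_rgraph h) 0"
    unfolding ball_iso_def verts_rooted_ball_0[OF rooted_graph_rep]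
    by (simp add: not_adj_self bij_betw_def)
  then show ?thesis unfolding same_ball_iff
    by (intro exI[where x = "\<lambda>_. snd (rep_rgraph h)"])
qed

lemma same_ball_all:
  assumes "\<And>r. same_ball g h r"
  shows "g = h"
proof (rule rep_eqI, rule rooted_iso_if_balls)
  show "\<exists>f. ball_iso f (rep_rgraph g) (rep_rgraph h) r" for r
    using assms unfolding same_ball_iff .
qed (rule rooted_graph_rep)+

instantiation rgraph :: metric_space
begin

text \<open>The distance is \<open>1 / (R + 1)\<close>, where \<open>R\<close> is the supremum of the radii for which the balls around
  the roots are isomorphic. The first case is \<open>R = \<infinity>\<close>; otherwise the supremum is over a finite
  nonempty set of natural numbers.\<close>

definition dist_rgraph :: "rgraph \<Rightarrow> rgraph \<Rightarrow> real" where
  "dist_rgraph g h =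
     (if \<forall>r. same_ball g h r then 0 else 1 / (real (Sup {r. same_ball g h r}) + 1))"

definition uniformity_rgraph :: "(rgraph \<times> rgraph) filter" where
  "uniformity_rgraph = (INF e\<in>{0<..}. principal {(x, y). dist x y < e})"

definition open_rgraph :: "rgraph set \<Rightarrow> bool" where
  "open_rgraph U \<longleftrightarrow> (\<forall>x\<in>U. \<forall>\<^sub>F (x', y) in uniformity. x' = x \<longrightarrow> y \<in> U)"

lemma dist_rgraph_cases:
  fixes g h :: rgraph
  obtains "g = h" "dist g h = 0"
  | R where "g \<noteq> h" "dist g h = 1 / (real R + 1)" "\<And>r. same_ball g h r \<longleftrightarrow> r \<le> R"
proof (cases "\<forall>r. same_ball g h r")
  case True
  then have "g = h" by (intro same_ball_all) (rule spec)
  moreover have "dist g h = 0" unfolding dist_rgraph_def using True by (rule if_P)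
  ultimately show thesis by (rule that(1))
next
  case False
  let ?A = "{r. same_ball g h r}"
  obtain q where q: "\<not> same_ball g h q" using False by blast
  have "r \<le> q" if "same_ball g h r" for r
    using same_ball_mono[OF that, of q] q by linarith
  then have "?A \<subseteq> {..q}" by auto
  then have fin: "finite ?A" by (rule finite_subset) simp
  have ne: "?A \<noteq> {}" using same_ball_0 by blast
  have S: "Sup ?A = Max ?A" using fin ne by (rule cSup_eq_Max)
  have iff: "same_ball g h r \<longleftrightarrow> r \<le> Sup ?A" for r
  proof
    assume "same_ball g h r"
    then show "r \<le> Sup ?A" unfolding S by (intro Max_ge[OF fin]) (rule CollectI)
  next
    assume r: "r \<le> Sup ?A"
    have "Sup ?A \<in> ?A" unfolding S by (rule Max_in[OF fin ne])
    then have "same_ball g h (Sup ?A)" by (rule CollectD)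
    then show "same_ball g h r" using r by (rule same_ball_mono)
  qed
  have "g \<noteq> h"
  proof
    assume "g = h"
    then have "same_ball g h q" unfolding same_ball_def by (simp only: rooted_iso_refl)
    with q show False by (rule notE)
  qed
  moreover have "dist g h = 1 / (real (Sup ?A) + 1)"
    unfolding dist_rgraph_def using False by (rule if_not_P)
  ultimately show thesis using iff by (rule that(2))
qed

lemma dist_rgraph_nonneg: "0 \<le> dist (g :: rgraph) h"
  by (rule dist_rgraph_cases[of g h]) simp_all

instance
proof
  show "uniformity = (INF e\<in>{0<..}. principal {(x, y :: rgraph). dist x y < e})"
    by (rule uniformity_rgraph_def)
  show "open U \<longleftrightarrow> (\<forall>x\<in>U. \<forall>\<^sub>F (x', y) in uniformity. x' = x \<longrightarrow> y \<in> U)" for U :: "rgraph set"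
    by (rule open_rgraph_def)
  show "dist x y = 0 \<longleftrightarrow> x = y" for x y :: rgraph
    by (rule dist_rgraph_cases[of x y]) simp_all
  show "dist x y \<le> dist x z + dist y z" for x y z :: rgraph
  proof (rule dist_rgraph_cases[of x y])
    assume "dist x y = 0"
    then show ?thesis using dist_rgraph_nonneg[of x z] dist_rgraph_nonneg[of y z] by linarith
  next
    fix R assume R: "dist x y = 1 / (real R + 1)" "\<And>r. same_ball x y r \<longleftrightarrow> r \<le> R"
    have far: "dist x y \<le> dist a b" if "\<not> same_ball a b (Suc R)" for a b :: rgraph
    proof (rule dist_rgraph_cases[of a b])
      assume "a = b"
      then have "same_ball a b (Suc R)" unfolding same_ball_def by (simp only: rooted_iso_refl)
      with that show ?thesis by (rule notE)
    next
      fix R' assume R': "dist a b = 1 / (real R' + 1)" "\<And>r. same_ball a b r \<longleftrightarrow> r \<le> R'"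
      have "R' \<le> R" using that unfolding R'(2) by linarith
      then show ?thesis unfolding R(1) R'(1) by (intro divide_left_mono) simp_all
    qed
    have "\<not> same_ball x y (Suc R)" unfolding R(2) by simp
    then have "\<not> same_ball x z (Suc R) \<or> \<not> same_ball y z (Suc R)"
      using same_ball_trans same_ball_sym by blast
    then show ?thesis
    proof
      assume "\<not> same_ball x z (Suc R)"
      from far[OF this] show ?thesis using dist_rgraph_nonneg[of y z] by linarith
    next
      assume "\<not> same_ball y z (Suc R)"
      from far[OF this] show ?thesis using dist_rgraph_nonneg[of x z] by linarith
    qed
  qed
qed

end


section \<open>Local weak convergence\<close>

text \<open>The component of \<open>v\<close> in \<open>G\<close>, rooted at \<open>v\<close>, up to isomorphism.\<close>

definition rooted_class :: "nat graph \<Rightarrow> nat \<Rightarrow> rgraph" where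
  "rooted_class G v = abs_rgraph (component G v, v)"

text \<open>There are only countably many finite graphs with vertices in \<open>nat\<close>, so the law of a finite
  random graph is a \<open>pmf\<close>. The following is the law of \<open>(G, o)\<close> for a uniformly chosen root.\<close>

definition uniform_rooting :: "nat graph pmf \<Rightarrow> rgraph pmf" where
  "uniform_rooting P = bind_pmf P (\<lambda>G. map_pmf (rooted_class G) (pmf_of_set (verts G)))"

definition local_weak_conv :: "(nat \<Rightarrow> nat graph pmf) \<Rightarrow> rgraph measure \<Rightarrow> bool" where
  "local_weak_conv P \<mu> \<longleftrightarrow>
     (\<forall>h :: rgraph \<Rightarrow> real. continuous_on UNIV h \<longrightarrow> bounded (range h) \<longrightarrow>
        (\<lambda>n. \<integral>g. h g \<partial>measure_pmf (uniform_rooting (P n))) \<longlonglongrightarrow> (\<integral>g. h g \<partial>\<mu>))"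

end

theory Submission
  imports Defs
begin

text \<open>For a finite graph the total weight of the matching is half the sum over all vertices of the
  weight of the matching edge at that vertex, so the left hand sides are, up to the factor 1/2,
  expectations over a uniform root. The restriction of a maximum weight matching to a ball is the
  maximum weight matching of the ball without those boundary vertices that are matched to the
  outside. Hence replacing the matching of the whole graph by that of the ball around an edge
  \<open>e\<close> of radius \<open>r\<close> costs at most \<open>corr F G e r\<close>, for the finite graphs as well as for the
  limit graph. After the replacement, and after cutting off large root degrees, all quantities
  depend only on a ball around the root and pass to the limit by local weak convergence; the
  errors vanish as first \<open>r\<close> and then the cut-off tends to infinity. This settles bounded functions of the weights. The
  weights themselves are clipped at level \<open>k\<close>, at a cost of at most \<open>E (w - k)\<^sup>+\<close> times the edge density.\<close>

text \<open>Three obstacles shape the proof. Ties: \<open>mwm\<close> breaks them by an arbitrary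
  choice that no isomorphism needs to respect, so quantities on different graphs are compared only
  for \<open>generic\<close> weights, an event of probability one, and the comparison ends in equal
  expectations instead of equal functions. Representatives: \<open>graph_of\<close> is an arbitrary
  choice from an isomorphism class and no measurability of it is ever invoked; measurable functions
  on \<open>rgraph\<close> arise as functions of a finite ball, which are continuous, or as limits
  of these, and the quantity of interest on the limit graph equals such a limit almost surely.
  Unbounded degrees: the root lies on at most one matching edge, so for a function of the weights
  with values in \<open>[0, L]\<close> the contribution of the root is at most \<open>L\<close>
  whatever its degree. Hence cutting off the degree at \<open>K\<close> costs at most
  \<open>L\<close> times the probability that the degree exceeds \<open>K\<close>.\<close>

section \<open>Optimal matchings, their uniqueness, and their restriction to a ball\<close>

definition optimal :: "'a graph \<Rightarrow> ('a set \<Rightarrow> real) \<Rightarrow> 'a set set \<Rightarrow> bool" where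
  "optimal G w M \<longleftrightarrow> matching G M \<and> (\<forall>M'. matching G M' \<longrightarrow> sum w M' \<le> sum w M)"

lemma finite_matchings: "finite (edges G) \<Longrightarrow> finite {M. matching G M}"
  by (rule finite_subset[of _ "Pow (edges G)"]) (auto simp: matching_def)

text \<open>Shows that \<open>mwm\<close> depends on the weights only through the set of optimal
  matchings. Measurability rests on this, since the choice operator itself is opaque.\<close>

lemma mwm_conv_optimal: "mwm G w = (SOME M. optimal G w M)"
  unfolding mwm_def arg_max_def is_arg_max_def optimal_def
  by (rule arg_cong[where f = Eps]) (auto simp: not_less)

lemma optimal_mwm:
  assumes "finite (edges G)"
  shows "optimal G w (mwm G w)"
proof -
  let ?S = "{M. matching G M}"
  have "?S \<noteq> {}" by (auto simp: matching_def intro: exI[of _ "{}"])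
  moreover have "finite ?S" by (rule finite_matchings[OF assms])
  ultimately have "Max (sum w ` ?S) \<in> sum w ` ?S" "\<forall>M'\<in>?S. sum w M' \<le> Max (sum w ` ?S)"
    by auto
  then obtain M where "M \<in> ?S" "\<forall>M'\<in>?S. sum w M' \<le> sum w M" by auto
  then have "optimal G w M" by (auto simp: optimal_def)
  then show ?thesis unfolding mwm_conv_optimal by (rule someI)
qed

lemma matching_mwm: "finite (edges G) \<Longrightarrow> matching G (mwm G w)"
  using optimal_mwm by (auto simp: optimal_def)

lemma mwm_subset: "finite (edges G) \<Longrightarrow> mwm G w \<subseteq> edges G"
  using matching_mwm by (auto simp: matching_def)

text \<open>More than uniqueness of the maximizer in one graph: the property passes to smaller edge
  sets, so a single event covers all finite subgraphs, balls and balls with deleted vertices at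
  once.\<close>

definition generic :: "'a set set \<Rightarrow> ('a set \<Rightarrow> real) \<Rightarrow> bool" where
  "generic E w \<longleftrightarrow> inj_on (sum w) {A. finite A \<and> A \<subseteq> E}"

lemma generic_mono: "generic E w \<Longrightarrow> E' \<subseteq> E \<Longrightarrow> generic E' w"
  unfolding generic_def by (erule inj_on_subset) auto

lemma optimal_generic:
  assumes "generic (edges G) w" "finite (edges G)" "optimal G w M"
  shows "M = mwm G w"
proof -
  note o = optimal_mwm[OF assms(2), of w]
  have "sum w M = sum w (mwm G w)"
    using o assms(3) by (auto simp: optimal_def intro: antisym)
  moreover have "finite M" "M \<subseteq> edges G" "finite (mwm G w)" "mwm G w \<subseteq> edges G"
    using o assms(2,3) by (auto simp: optimal_def matching_def intro: finite_subset)
  ultimately show ?thesis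
    using assms(1) unfolding generic_def inj_on_def by blast
qed

lemma edges_del_verts: "edges (del_verts G A) = {e \<in> edges G. e \<subseteq> verts G - A}"
  by (simp add: del_verts_def induced_def)

lemma verts_del_verts: "verts (del_verts G A) = verts G - A"
  by (auto simp: del_verts_def induced_def)

text \<open>An exchange argument: a heavier matching of \<open>B\<close> without the vertices matched to the outside could
  be combined with the edges that leave or avoid \<open>B\<close>.\<close>

lemma mwm_cut:
  assumes fin: "finite (edges G)" and gen: "generic (edges G) w"
    and B: "edges B = {e \<in> edges G. e \<subseteq> verts B}"
    and A: "A = {v \<in> verts B. \<exists>e\<in>mwm G w. v \<in> e \<and> \<not> e \<subseteq> verts B}"
  shows "mwm (del_verts B A) w = {e \<in> mwm G w. e \<subseteq> verts B}"
proof -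
  let ?M = "mwm G w" and ?N = "{e \<in> mwm G w. e \<subseteq> verts B}"
  have opt: "?M \<subseteq> edges G" "pairwise disjnt ?M" "\<And>M'. matching G M' \<Longrightarrow> sum w M' \<le> sum w ?M"
    using optimal_mwm[OF fin, of w] by (auto simp: optimal_def matching_def)
  have finM: "finite ?M" using opt(1) fin by (rule finite_subset)
  have E: "edges (del_verts B A) \<subseteq> edges G" by (auto simp: edges_del_verts B)
  \<comment> \<open>An edge inside \<open>B\<close> that meets \<open>A\<close> would share a vertex
    with a matching edge leaving \<open>B\<close>.\<close>
  have disjA: "e \<inter> A = {}" if "e \<in> ?N" for e
  proof (rule ccontr)
    assume "e \<inter> A \<noteq> {}"
    then obtain v e' where "v \<in> e" "e' \<in> ?M" "v \<in> e'" "\<not> e' \<subseteq> verts B" by (auto simp: A)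
    moreover have "e \<noteq> e'" "e \<in> ?M" using that calculation by auto
    ultimately show False using opt(2) by (auto simp: pairwise_def disjnt_def)
  qed
  have N: "matching (del_verts B A) ?N"
    unfolding matching_def edges_del_verts B
  proof
    show "?N \<subseteq> {e \<in> {e \<in> edges G. e \<subseteq> verts B}. e \<subseteq> verts B - A}"
      using disjA opt(1) by auto
    show "pairwise disjnt ?N"
      by (rule pairwise_subset[OF opt(2)]) auto
  qed
  have "sum w M' \<le> sum w ?N" if M': "matching (del_verts B A) M'" for M'
  proof -
    have sub: "M' \<subseteq> edges G" "\<And>e. e \<in> M' \<Longrightarrow> e \<subseteq> verts B - A" "pairwise disjnt M'"
      using M' unfolding matching_def edges_del_verts B by auto
    \<comment> \<open>An edge of the matching that leaves \<open>B\<close> has its vertices in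
      \<open>verts B\<close> only within \<open>A\<close>, and \<open>M'\<close> lives on
      \<open>verts B - A\<close>.\<close>
    have cross: "disjnt e e'" if "e \<in> ?M - ?N" "e' \<in> M'" for e e'
      using that sub(2)[of e'] by (auto simp: A disjnt_def)
    have "pairwise disjnt ((?M - ?N) \<union> M')"
    proof (rule pairwiseI)
      fix e e' assume e: "e \<in> (?M - ?N) \<union> M'" "e' \<in> (?M - ?N) \<union> M'" "e \<noteq> e'"
      consider "e \<in> ?M - ?N" "e' \<in> ?M - ?N" | "e \<in> ?M - ?N" "e' \<in> M'" |
        "e \<in> M'" "e' \<in> ?M - ?N" | "e \<in> M'" "e' \<in> M'"
        using e(1,2) by blast
      then show "disjnt e e'"
      proof cases
        case 1 then show ?thesis using opt(2) e(3) by (auto simp: pairwise_def)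
      next
        case 2 then show ?thesis by (rule cross)
      next
        case 3 then show ?thesis using cross disjnt_sym by metis
      next
        case 4 then show ?thesis using sub(3) e(3) by (auto simp: pairwise_def)
      qed
    qed
    then have "matching G ((?M - ?N) \<union> M')"
      using opt(1) sub(1) by (auto simp: matching_def)
    then have "sum w ((?M - ?N) \<union> M') \<le> sum w ?M" by (rule opt(3))
    moreover have "(?M - ?N) \<inter> M' = {}"
      using sub(2) by auto
    moreover have "finite M'" using sub(1) fin by (rule finite_subset)
    ultimately have "sum w (?M - ?N) + sum w M' \<le> sum w ?M"
      using finM by (simp add: sum.union_disjoint)
    moreover have "sum w ?M = sum w (?M - ?N) + sum w ?N"
      using finM by (intro sum.subset_diff) auto
    ultimately show ?thesis by simp
  qed
  then have "optimal (del_verts B A) w ?N" using N by (simp add: optimal_def)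
  then show ?thesis
    using optimal_generic[of "del_verts B A" w ?N] generic_mono[OF gen E] finite_subset[OF E fin] by simp
qed

text \<open>A sequence of zeros and ones tends to 1 exactly if it is eventually 1. This form gives
  both disjointness and measurability, because "eventually" is a countable combination of
  events.\<close>

lemma mwm_along_infinite_iff:
  assumes "infinite (verts G)"
  shows "e \<in> mwm_along H G w \<longleftrightarrow> e \<in> edges G \<and> (\<forall>\<^sub>F n in sequentially. e \<in> mwm (H n) w)"
proof -
  have "(\<lambda>n. of_bool (e \<in> mwm (H n) w) :: real) \<longlonglongrightarrow> 1 \<longleftrightarrow> (\<forall>\<^sub>F n in sequentially. e \<in> mwm (H n) w)"
  proof
    assume "(\<lambda>n. of_bool (e \<in> mwm (H n) w) :: real) \<longlonglongrightarrow> 1"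
    then have "\<forall>\<^sub>F n in sequentially. of_bool (e \<in> mwm (H n) w) > (1/2 :: real)"
      by (rule order_tendstoD) simp
    then show "\<forall>\<^sub>F n in sequentially. e \<in> mwm (H n) w"
      by (rule eventually_mono) (auto split: if_splits simp: of_bool_def)
  next
    assume "\<forall>\<^sub>F n in sequentially. e \<in> mwm (H n) w"
    then show "(\<lambda>n. of_bool (e \<in> mwm (H n) w) :: real) \<longlonglongrightarrow> 1"
      by (intro tendsto_eventually) (auto elim: eventually_mono)
  qed
  then show ?thesis using assms by (simp add: mwm_along_def)
qed

text \<open>Two edges of the limit set lie together in the matching of some single
  \<open>H n\<close>. Neither convergence for the other edges nor genericity enters.\<close>

lemma mwm_along_disjoint:
  assumes "finite (verts G) \<Longrightarrow> finite (edges G)"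
    and "infinite (verts G) \<Longrightarrow> (\<And>n. finite (edges (H n)))"
  shows "pairwise disjnt (mwm_along H G w)"
proof (cases "finite (verts G)")
  case True
  then show ?thesis
    using matching_mwm[OF assms(1), of w] by (simp add: mwm_along_def matching_def)
next
  case False
  show ?thesis
  proof (rule pairwiseI)
    fix e e' assume "e \<in> mwm_along H G w" "e' \<in> mwm_along H G w" "e \<noteq> e'"
    then have "\<forall>\<^sub>F n in sequentially. e \<in> mwm (H n) w \<and> e' \<in> mwm (H n) w"
      by (simp add: mwm_along_infinite_iff[OF False] eventually_conj)
    then obtain n where "e \<in> mwm (H n) w" "e' \<in> mwm (H n) w"
      using eventually_happens' sequentially_bot by blast
    then show "disjnt e e'"
      using matching_mwm[OF assms(2)[OF False, of n], of w] \<open>e \<noteq> e'\<close>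
      by (auto simp: matching_def pairwise_def)
  qed
qed

section \<open>Random weights\<close>

locale weight_law = prob_space F for F :: "real measure" +
  assumes sets_F: "sets F = sets borel"
    and no_atom: "emeasure F {x} = 0"
begin

abbreviation iid :: "'a set \<Rightarrow> ('a \<Rightarrow> real) measure" where
  "iid E \<equiv> PiM E (\<lambda>_. F)"

lemma prob_space_iid: "prob_space (iid E)"
  by (intro prob_space_PiM prob_space_axioms)

lemma measurable_weight [measurable]: "e \<in> E \<Longrightarrow> (\<lambda>w. w e) \<in> borel_measurable (iid E)"
  using measurable_component_singleton[of e E "\<lambda>_. F"] measurable_cong_sets[OF refl sets_F] by blast

lemma measurable_weight_sum [measurable]: "A \<subseteq> E \<Longrightarrow> (\<lambda>w. sum w A) \<in> borel_measurable (iid E)"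
  by (intro borel_measurable_sum) auto

lemma distr_iid_reindex:
  assumes "inj_on J K" "J \<in> K \<rightarrow> E"
  shows "distr (iid E) (iid K) (\<lambda>w. \<lambda>e\<in>K. w (J e)) = iid K"
  using distr_PiM_reindex[of E "\<lambda>_. F" J K] assms prob_space_axioms by simp

lemma measurable_reindex:
  assumes "J \<in> K \<rightarrow> E"
  shows "(\<lambda>w. \<lambda>e\<in>K. w (J e)) \<in> measurable (iid E) (iid K)"
  using assms by (intro measurable_restrict measurable_component_singleton) auto

text \<open>Fix all weights except that of \<open>a\<close>, which occurs in only one of the two
  sums: equality then forces the weight of \<open>a\<close> to be one particular number, an event of
  probability 0 because \<open>F\<close> has no atoms. Fubini on the finite product over
  \<open>A\<close> and \<open>B\<close> finishes the argument there.\<close>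

lemma AE_sum_neq_aux:
  assumes fin: "finite A" "finite B" and a: "a \<in> A" "a \<notin> B" and E: "A \<subseteq> E" "B \<subseteq> E"
  shows "AE w in iid E. sum w A \<noteq> sum w B"
proof -
  interpret product_sigma_finite "\<lambda>_. F"
    by standard
  let ?I = "(A \<union> B) - {a}"
  have I: "A \<union> B = insert a ?I" using a by auto
  have "AE w in iid (A \<union> B). sum w A \<noteq> sum w B"
  proof (rule AE_I')
    let ?N = "{w \<in> space (iid (A \<union> B)). sum w A = sum w B}"
    have N: "?N \<in> sets (iid (A \<union> B))" by measurable
    have "emeasure (iid (A \<union> B)) ?N = (\<integral>\<^sup>+w. indicator ?N w \<partial>iid (A \<union> B))"
      using N by simp
    also have "\<dots> = (\<integral>\<^sup>+x. (\<integral>\<^sup>+y. indicator ?N (x(a := y)) \<partial>F) \<partial>iid ?I)"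
    proof -
      have "finite ?I" "a \<notin> ?I" using fin by auto
      note product_nn_integral_insert[OF this, folded I]
      moreover have "indicator ?N \<in> borel_measurable (iid (A \<union> B))"
        using N by (rule borel_measurable_indicator)
      ultimately show ?thesis by blast
    qed
    also have "\<dots> = (\<integral>\<^sup>+x. 0 \<partial>iid ?I)"
    proof (intro nn_integral_cong)
      fix x :: "'a \<Rightarrow> real"
      \<comment> \<open>The only value of the weight of \<open>a\<close> for which the two sums
        agree, given the other weights.\<close>
      let ?c = "sum x B - sum x (A - {a})"
      have "(\<integral>\<^sup>+y. indicator ?N (x(a := y)) \<partial>F) \<le> (\<integral>\<^sup>+y. indicator {?c} y \<partial>F)"
      proof (intro nn_integral_mono)
        fix y
        have "sum (x(a := y)) A = y + sum x (A - {a})"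
          using fin a by (subst sum.remove[of A a]) (auto intro: sum.cong)
        moreover have "sum (x(a := y)) B = sum x B"
          using a by (intro sum.cong) auto
        ultimately show "(indicator ?N (x(a := y)) :: ennreal) \<le> indicator {?c} y"
          by (auto simp: indicator_def)
      qed
      also have "\<dots> = 0" using no_atom[of ?c] sets_F by simp
      finally show "(\<integral>\<^sup>+y. indicator ?N (x(a := y)) \<partial>F) = 0" by simp
    qed
    finally show "?N \<in> null_sets (iid (A \<union> B))" using N by (simp add: null_sets_def)
  qed auto
  \<comment> \<open>The marginal on finitely many coordinates is again a product, so the null set is
    pulled back to the possibly infinite product over \<open>E\<close>.\<close>
  moreover have "distr (iid E) (iid (A \<union> B)) (\<lambda>w. \<lambda>e\<in>A \<union> B. w e) = iid (A \<union> B)"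
    using E by (intro distr_iid_reindex) auto
  ultimately have "AE w in distr (iid E) (iid (A \<union> B)) (\<lambda>w. \<lambda>e\<in>A \<union> B. w e). sum w A \<noteq> sum w B"
    by (simp only:)
  then have "AE w in iid E. sum (restrict w (A \<union> B)) A \<noteq> sum (restrict w (A \<union> B)) B"
  proof (subst (asm) AE_distr_iff)
    show "(\<lambda>w. \<lambda>e\<in>A \<union> B. w e) \<in> measurable (iid E) (iid (A \<union> B))"
      using E by (intro measurable_reindex) auto
    show "{w \<in> space (iid (A \<union> B)). sum w A \<noteq> sum w B} \<in> sets (iid (A \<union> B))"
      by (intro borel_measurable_neq measurable_weight_sum) auto
  qed
  moreover have "sum (restrict w (A \<union> B)) A = sum w A" "sum (restrict w (A \<union> B)) B = sum w B" for w :: "'a \<Rightarrow> real"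
    by (auto intro!: sum.cong)
  ultimately show ?thesis by simp
qed

lemma AE_sum_neq:
  assumes "finite A" "finite B" "A \<noteq> B" "A \<subseteq> E" "B \<subseteq> E"
  shows "AE w in iid E. sum w A \<noteq> sum w B"
proof -
  consider a where "a \<in> A" "a \<notin> B" | a where "a \<in> B" "a \<notin> A" using assms(3) by blast
  then show ?thesis
  proof cases
    case 1
    show ?thesis by (rule AE_sum_neq_aux[OF assms(1,2) 1 assms(4,5)])
  next
    case 2
    have "AE w in iid E. sum w B \<noteq> sum w A" by (rule AE_sum_neq_aux[OF assms(2,1) 2 assms(5,4)])
    then show ?thesis by (rule AE_mp) (auto intro!: AE_I2)
  qed
qed

text \<open>A countable set has only countably many finite subsets, so countably many null events
  are excluded.\<close>

lemma AE_generic: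
  assumes "countable E"
  shows "AE w in iid E. generic E w"
proof -
  let ?F = "{A. finite A \<and> A \<subseteq> E}"
  have c: "countable ?F" using countable_Collect_finite_subset[OF assms] by simp
  have "AE w in iid E. \<forall>A\<in>?F. \<forall>B\<in>?F. A \<noteq> B \<longrightarrow> sum w A \<noteq> sum w B"
    unfolding AE_ball_countable[OF c]
  proof (intro ballI)
    fix A B assume "A \<in> ?F" "B \<in> ?F"
    then show "AE w in iid E. A \<noteq> B \<longrightarrow> sum w A \<noteq> sum w B"
      using AE_sum_neq[of A B E] by (cases "A = B") auto
  qed
  then show ?thesis
    by (rule AE_mp) (auto intro!: AE_I2 simp: generic_def inj_on_def)
qed

section \<open>Measurability of the maximum weight matching\<close>

lemma measurable_optimal:
  assumes "finite (edges G)" "edges G \<subseteq> E"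
  shows "Measurable.pred (iid E) (\<lambda>w. optimal G w M)"
proof (cases "matching G M")
  case True
  have meas: "(\<lambda>w. sum w N) \<in> borel_measurable (iid E)" if "matching G N" for N
    using that assms(2) by (intro measurable_weight_sum) (auto simp: matching_def)
  have "Measurable.pred (iid E) (\<lambda>w. \<forall>M'\<in>{M'. matching G M'}. sum w M' \<le> sum w M)"
  proof (intro pred_intros_finite)
    fix M' assume "M' \<in> {M'. matching G M'}"
    then show "Measurable.pred (iid E) (\<lambda>w. sum w M' \<le> sum w M)"
      unfolding pred_def using True by (intro borel_measurable_le meas) simp_all
  qed (rule finite_matchings[OF assms(1)])
  then show ?thesis using True by (simp add: optimal_def)
qed (simp add: optimal_def)

text \<open>Ties are included, so the arbitrary choice has to be dealt with: a finite graph has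
  finitely many possible sets \<open>T\<close> of optimal matchings, and the event is the finite
  union, over those \<open>T\<close> whose chosen element satisfies \<open>R\<close>, of the events
  that \<open>T\<close> is the set of optimal matchings.\<close>

lemma measurable_mwm:
  assumes "finite (edges G)" "edges G \<subseteq> E"
  shows "Measurable.pred (iid E) (\<lambda>w. R (mwm G w))"
proof -
  let ?P = "Pow {M. matching G M}"
  have fin: "finite ?P" using finite_matchings[OF assms(1)] by simp
  have eq: "R (mwm G w) \<longleftrightarrow> (\<exists>T\<in>{T\<in>?P. R (SOME M. M \<in> T)}. \<forall>M\<in>{M. matching G M}. M \<in> T \<longleftrightarrow> optimal G w M)"
    (is "_ = ?R") for w
  proof
    assume R: "R (mwm G w)"
    show ?R
      by (rule bexI[of _ "{M. optimal G w M}"]) (use R in \<open>auto simp: mwm_conv_optimal optimal_def\<close>)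
  next
    assume ?R
    then obtain T where T: "T \<in> ?P" "R (SOME M. M \<in> T)" "\<forall>M\<in>{M. matching G M}. M \<in> T \<longleftrightarrow> optimal G w M"
      by blast
    then have "T = {M. optimal G w M}" by (auto simp: optimal_def)
    then show "R (mwm G w)" using T(2) by (simp add: mwm_conv_optimal)
  qed
  show ?thesis
    unfolding eq
  proof (intro pred_intros_finite pred_intros_logic measurable_optimal assms)
    show "finite {T \<in> ?P. R (SOME M. M \<in> T)}" using fin by simp
  qed (simp_all add: finite_matchings[OF assms(1)])
qed

end

section \<open>Balls and local isomorphisms\<close>

text \<open>The vertex sets of balls in recursive form, so that statements about balls follow by
  induction on the radius; \<open>nball_relpow\<close> ties this to distances.\<close>

primrec nball :: "'a graph \<Rightarrow> 'a set \<Rightarrow> nat \<Rightarrow> 'a set" where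
  "nball G S 0 = S"
| "nball G S (Suc r) = nball G S r \<union> (\<Union>u\<in>nball G S r. neighbours G u)"

lemma nball_mono: "k \<le> r \<Longrightarrow> nball G S k \<subseteq> nball G S r"
  by (rule lift_Suc_mono_le[of "nball G S"]) auto

lemma nball_relpow: "nball G S r = {v. \<exists>u\<in>S. \<exists>k\<le>r. (u, v) \<in> {(x, y). adj G x y} ^^ k}"
proof (induction r)
  case (Suc r)
  let ?R = "{(x, y). adj G x y}"
  show ?case
  proof (intro subset_antisym subsetI)
    fix v assume "v \<in> nball G S (Suc r)"
    then consider "v \<in> nball G S r" | u where "u \<in> nball G S r" "adj G u v"
      by (auto simp: neighbours_def)
    then show "v \<in> {v. \<exists>u\<in>S. \<exists>k\<le>Suc r. (u, v) \<in> ?R ^^ k}"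
    proof cases
      case 1
      then show ?thesis unfolding Suc.IH by (auto intro: le_SucI)
    next
      case 2
      then obtain s k where "s \<in> S" "k \<le> r" "(s, u) \<in> ?R ^^ k" unfolding Suc.IH by auto
      moreover have "(s, v) \<in> ?R ^^ Suc k" using calculation(3) 2(2) by auto
      ultimately show ?thesis by (intro CollectI bexI[of _ s] exI[of _ "Suc k"]) auto
    qed
  next
    fix v assume "v \<in> {v. \<exists>u\<in>S. \<exists>k\<le>Suc r. (u, v) \<in> ?R ^^ k}"
    then obtain s k where s: "s \<in> S" "k \<le> Suc r" "(s, v) \<in> ?R ^^ k" by blast
    show "v \<in> nball G S (Suc r)"
    proof (cases "k \<le> r")
      case True
      then have "v \<in> nball G S r" using s unfolding Suc.IH by blast
      then show ?thesis by simp
    next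
      case False
      then have "k = Suc r" using s(2) by simp
      then obtain u where u: "(s, u) \<in> ?R ^^ r" "adj G u v" using s(3) by auto
      then have "u \<in> nball G S r" using s(1) unfolding Suc.IH by blast
      then show ?thesis using u(2) by (auto simp: neighbours_def)
    qed
  qed
qed auto

lemma ball_graph_nball: "ball_graph G S r = induced G (nball G S r)"
  unfolding ball_graph_def nball_relpow gdist_le_iff ..

lemma neighbours_verts: "wf_graph G \<Longrightarrow> neighbours G u \<subseteq> verts G"
  by (auto simp: neighbours_def dest: adj_verts)

lemma nball_verts: "wf_graph G \<Longrightarrow> S \<subseteq> verts G \<Longrightarrow> nball G S r \<subseteq> verts G"
  by (induction r) (auto dest: subsetD[OF neighbours_verts])

lemma finite_nball:
  assumes "wf_graph G" "locally_finite G" "S \<subseteq> verts G" "finite S"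
  shows "finite (nball G S r)"
proof (induction r)
  case (Suc r)
  then show ?case using assms nball_verts[OF assms(1,3), of r] by (auto simp: locally_finite_def)
qed (simp add: assms)

lemma verts_ball_graph: "wf_graph G \<Longrightarrow> S \<subseteq> verts G \<Longrightarrow> verts (ball_graph G S r) = nball G S r"
  using nball_verts[of G S r] by (auto simp: ball_graph_nball induced_def)

lemma edges_ball_graph: "edges (ball_graph G S r) = {e \<in> edges G. e \<subseteq> nball G S r}"
  by (simp add: ball_graph_nball induced_def)

text \<open>An outside neighbour of a ball vertex has distance \<open>Suc r\<close> from
  \<open>S\<close>. Hence the boundary is visible in the next larger ball, which is why a local
  isomorphism must reach one step beyond \<open>r\<close>.\<close>

lemma boundary_ball_graph:
  assumes "wf_graph G" "S \<subseteq> verts G"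
  shows "boundary G (ball_graph G S r) = {v \<in> nball G S r. \<exists>u\<in>nball G S (Suc r) - nball G S r. adj G v u}"
  using nball_verts[OF assms, of "Suc r"]
  by (auto simp: boundary_def verts_ball_graph assms neighbours_def dest: adj_verts[OF assms(1)])

lemma edge_subset_verts: "wf_graph G \<Longrightarrow> e \<in> edges G \<Longrightarrow> e \<subseteq> verts G"
  by (auto simp: wf_graph_def)

lemma finite_edge: "wf_graph G \<Longrightarrow> e \<in> edges G \<Longrightarrow> finite e"
  by (auto simp: wf_graph_def)

lemma finite_edges: "wf_graph G \<Longrightarrow> finite (verts G) \<Longrightarrow> finite (edges G)"
  by (rule finite_subset[of _ "Pow (verts G)"]) (auto dest: edge_subset_verts)

lemma wf_induced: "wf_graph G \<Longrightarrow> wf_graph (induced G S)"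
  unfolding wf_graph_def
proof
  fix e assume "\<forall>e\<in>edges G. \<exists>u\<in>verts G. \<exists>v\<in>verts G. u \<noteq> v \<and> e = {u, v}" "e \<in> edges (induced G S)"
  moreover from this obtain u v where "u \<in> verts G" "v \<in> verts G" "u \<noteq> v" "e = {u, v}" "e \<subseteq> S"
    by (auto simp: induced_def)
  ultimately show "\<exists>u\<in>verts (induced G S). \<exists>v\<in>verts (induced G S). u \<noteq> v \<and> e = {u, v}"
    by (auto simp: induced_def)
qed

lemma wf_ball_graph: "wf_graph G \<Longrightarrow> wf_graph (ball_graph G S r)"
  by (simp add: ball_graph_nball wf_induced)

lemma wf_del_verts: "wf_graph G \<Longrightarrow> wf_graph (del_verts G A)"
  by (simp add: del_verts_def wf_induced)

lemma del_verts_empty: "wf_graph B \<Longrightarrow> del_verts B {} = B"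
  by (cases B) (auto simp: del_verts_def induced_def wf_graph_def)

section \<open>Transport of matchings along injective maps\<close>

definition gmap :: "('a \<Rightarrow> 'b) \<Rightarrow> 'a graph \<Rightarrow> 'b graph" where
  "gmap \<phi> G = Graph (\<phi> ` verts G) ((`) \<phi> ` edges G)"

lemma inj_on_image_edges:
  assumes "wf_graph G" "inj_on \<phi> (verts G)"
  shows "inj_on ((`) \<phi>) (edges G)"
  using inj_on_image_Pow[OF assms(2)] by (rule inj_on_subset) (use edge_subset_verts[OF assms(1)] in auto)

lemma disjnt_image_iff:
  "inj_on \<phi> V \<Longrightarrow> A \<subseteq> V \<Longrightarrow> B \<subseteq> V \<Longrightarrow> disjnt (\<phi> ` A) (\<phi> ` B) \<longleftrightarrow> disjnt A B"
  unfolding disjnt_def using inj_on_image_Int[of \<phi> V A B] by auto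

lemma matching_gmap:
  assumes "wf_graph G" "inj_on \<phi> (verts G)" "M \<subseteq> edges G"
  shows "matching (gmap \<phi> G) ((`) \<phi> ` M) \<longleftrightarrow> matching G M"
proof -
  have sub: "e \<subseteq> verts G" if "e \<in> M" for e using that assms edge_subset_verts by blast
  have "pairwise disjnt ((`) \<phi> ` M) \<longleftrightarrow> pairwise disjnt M"
    unfolding pairwise_image pairwise_def
    using sub disjnt_image_iff[OF assms(2)] inj_on_image_edges[OF assms(1,2)] assms(3)
    by (auto simp: inj_on_eq_iff subset_eq)
  then show ?thesis using assms(3) by (auto simp: matching_def gmap_def)
qed

lemma optimal_gmap:
  assumes G: "wf_graph G" "inj_on \<phi> (verts G)"
    and w: "\<And>e. e \<in> edges G \<Longrightarrow> w e = w' (\<phi> ` e)"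
    and opt: "optimal G w M"
  shows "optimal (gmap \<phi> G) w' ((`) \<phi> ` M)"
proof -
  have sum: "sum w' ((`) \<phi> ` N) = sum w N" if "N \<subseteq> edges G" for N
    unfolding sum.reindex[OF inj_on_subset[OF inj_on_image_edges[OF G] that]] comp_def
    using that w by (intro sum.cong) (auto simp: subset_eq)
  have M: "matching G M" "M \<subseteq> edges G" using opt by (auto simp: optimal_def matching_def)
  have "sum w' N' \<le> sum w' ((`) \<phi> ` M)" if N': "matching (gmap \<phi> G) N'" for N'
  proof -
    have "N' \<subseteq> (`) \<phi> ` edges G" using N' by (simp add: matching_def gmap_def)
    then obtain N where N: "N \<subseteq> edges G" "N' = (`) \<phi> ` N" by (rule subset_imageE)
    then have "matching G N" using N' matching_gmap[OF G N(1)] by simp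
    then show ?thesis using opt by (simp add: N sum M optimal_def)
  qed
  then show ?thesis using matching_gmap[OF G M(2)] M(1) by (simp add: optimal_def)
qed

text \<open>Optimality is transported by any injective map, but the tie-breaking choice is not;
  uniqueness for generic weights identifies the image.\<close>

lemma mwm_gmap:
  assumes "wf_graph G" "inj_on \<phi> (verts G)" "finite (edges G)"
    and "\<And>e. e \<in> edges G \<Longrightarrow> w e = w' (\<phi> ` e)" "generic (edges (gmap \<phi> G)) w'"
  shows "mwm (gmap \<phi> G) w' = (`) \<phi> ` mwm G w"
proof -
  have "optimal (gmap \<phi> G) w' ((`) \<phi> ` mwm G w)"
    by (intro optimal_gmap[where w = w] assms optimal_mwm)
  moreover have "finite (edges (gmap \<phi> G))" using assms(3) by (simp add: gmap_def)
  ultimately show ?thesis using optimal_generic[OF assms(5)] by simp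
qed

lemma del_verts_gmap:
  assumes "wf_graph G" "inj_on \<phi> (verts G)" "A \<subseteq> verts G"
  shows "del_verts (gmap \<phi> G) (\<phi> ` A) = gmap \<phi> (del_verts G A)"
proof -
  have d: "\<phi> ` verts G - \<phi> ` A = \<phi> ` (verts G - A)"
    using inj_on_image_set_diff[OF assms(2), of "verts G" A] assms(3) by auto
  have "\<phi> ` e \<subseteq> \<phi> ` (verts G - A) \<longleftrightarrow> e \<subseteq> verts G - A" if "e \<in> edges G" for e
    using inj_on_image_subset_iff[OF assms(2), of e "verts G - A"] edge_subset_verts[OF assms(1) that]
    by blast
  then show ?thesis
    unfolding del_verts_def induced_def gmap_def by (auto simp: d)
qed

section \<open>Maps that preserve a ball together with its boundary\<close>

text \<open>Weaker than an isomorphism of balls of radius \<open>Suc r\<close>: edges joining two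
  vertices at distance exactly \<open>Suc r\<close> are left free. What is fixed suffices for the
  ball of radius \<open>r\<close> and its boundary. \<open>S\<close> is the root vertex in some uses
  and an edge in others.\<close>

definition local_iso :: "('a \<Rightarrow> 'b) \<Rightarrow> 'a graph \<Rightarrow> 'a set \<Rightarrow> 'b graph \<Rightarrow> 'b set \<Rightarrow> nat \<Rightarrow> bool" where
  "local_iso \<phi> G S G' S' r \<longleftrightarrow> inj_on \<phi> (nball G S (Suc r)) \<and> \<phi> ` S = S' \<and>
     (\<forall>u\<in>nball G S r. neighbours G' (\<phi> u) = \<phi> ` neighbours G u)"

context
  fixes \<phi> :: "'a \<Rightarrow> 'b" and G S G' S' r
  assumes iso: "local_iso \<phi> G S G' S' r" and wf: "wf_graph G" "wf_graph G'"
    and S: "S \<subseteq> verts G" and S': "S' \<subseteq> verts G'"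
begin

lemma local_iso_inj: "inj_on \<phi> (nball G S (Suc r))"
  using iso by (simp add: local_iso_def)

lemma local_iso_neighbours: "u \<in> nball G S r \<Longrightarrow> neighbours G' (\<phi> u) = \<phi> ` neighbours G u"
  using iso by (simp add: local_iso_def)

lemma local_iso_nball: "k \<le> Suc r \<Longrightarrow> nball G' S' k = \<phi> ` nball G S k"
proof (induction k)
  case 0
  then show ?case using iso by (simp add: local_iso_def)
next
  case (Suc k)
  have "neighbours G' (\<phi> u) = \<phi> ` neighbours G u" if "u \<in> nball G S k" for u
    using that nball_mono[of k r G S] Suc.prems by (intro local_iso_neighbours) auto
  then show ?case using Suc by (simp add: image_Un image_UN)
qed

lemma local_iso_adj:
  assumes "u \<in> nball G S r" "v \<in> nball G S (Suc r)"
  shows "adj G' (\<phi> u) (\<phi> v) \<longleftrightarrow> adj G u v"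
proof -
  have "neighbours G u \<subseteq> nball G S (Suc r)" using assms(1) by auto
  then have "\<phi> v \<in> \<phi> ` neighbours G u \<longleftrightarrow> v \<in> neighbours G u"
    using local_iso_inj assms(2) by (auto simp: inj_on_image_mem_iff)
  then have "\<phi> v \<in> neighbours G' (\<phi> u) \<longleftrightarrow> v \<in> neighbours G u"
    by (simp only: local_iso_neighbours[OF assms(1)])
  then show ?thesis by (simp only: neighbours_def mem_Collect_eq)
qed

lemma local_iso_ball_graph: "ball_graph G' S' r = gmap \<phi> (ball_graph G S r)"
proof (rule graph.expand, intro conjI)
  show "verts (ball_graph G' S' r) = verts (gmap \<phi> (ball_graph G S r))"
    by (simp add: gmap_def verts_ball_graph wf S S' local_iso_nball)
  note N = local_iso_nball[OF le_SucI[OF order_refl]]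
  note adj = local_iso_adj[OF _ subsetD[OF nball_mono[OF le_SucI[OF order_refl]]], unfolded adj_def]
  have "edges (ball_graph G' S' r) = (`) \<phi> ` edges (ball_graph G S r)"
  proof (intro subset_antisym subsetI)
    fix e assume "e \<in> edges (ball_graph G' S' r)"
    then have e: "e \<in> edges G'" "e \<subseteq> \<phi> ` nball G S r" by (auto simp: edges_ball_graph N)
    then obtain u v where uv: "u \<in> nball G S r" "v \<in> nball G S r" "e = \<phi> ` {u, v}"
      using wf(2) by (fastforce simp: wf_graph_def)
    then have "{u, v} \<in> edges G" using e(1) adj[of u v] by simp
    with uv(1,2) show "e \<in> (`) \<phi> ` edges (ball_graph G S r)"
      unfolding uv(3) by (intro imageI) (simp add: edges_ball_graph)
  next
    fix e assume "e \<in> (`) \<phi> ` edges (ball_graph G S r)"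
    then obtain e0 where e0: "e0 \<in> edges G" "e0 \<subseteq> nball G S r" "e = \<phi> ` e0"
      by (auto simp: edges_ball_graph)
    then obtain u v where uv: "u \<in> nball G S r" "v \<in> nball G S r" "e0 = {u, v}"
      using wf(1) by (fastforce simp: wf_graph_def)
    then show "e \<in> edges (ball_graph G' S' r)"
      using e0 adj[of u v] by (auto simp: edges_ball_graph N)
  qed
  then show "edges (ball_graph G' S' r) = edges (gmap \<phi> (ball_graph G S r))"
    by (simp add: gmap_def)
qed

text \<open>Adjacency between the ball and the next sphere is preserved in both directions, and
  injectivity on the larger ball keeps the sphere outside the image of the ball.\<close>

lemma local_iso_boundary:
  "boundary G' (ball_graph G' S' r) = \<phi> ` boundary G (ball_graph G S r)"
proof -
  let ?N = "nball G S r" and ?N1 = "nball G S (Suc r)"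
  have N: "nball G' S' r = \<phi> ` ?N" "nball G' S' (Suc r) = \<phi> ` ?N1"
    by (simp_all only: local_iso_nball[OF le_SucI] local_iso_nball order_refl)
  have "nball G S r \<subseteq> ?N1" by (rule nball_mono) simp
  then have "\<phi> ` (?N1 - ?N) = \<phi> ` ?N1 - \<phi> ` ?N"
    using inj_on_image_set_diff[OF local_iso_inj, of ?N1 ?N] by auto
  then show ?thesis
    unfolding boundary_ball_graph[OF wf(1) S] boundary_ball_graph[OF wf(2) S'] N
    using local_iso_adj by (auto simp del: nball.simps simp flip: \<open>\<phi> ` (?N1 - ?N) = \<phi> ` ?N1 - \<phi> ` ?N\<close>)
qed

end

section \<open>Local functionals of an edge\<close>

text \<open>The integrand of \<open>corr\<close>, named so that comparisons can be made for fixed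
  weights before integrating.\<close>

definition sensitivity :: "'a graph \<Rightarrow> 'a set \<Rightarrow> nat \<Rightarrow> ('a set \<Rightarrow> real) \<Rightarrow> real" where
  "sensitivity G e r w = (SUP A \<in> Pow (boundary G (ball_graph G e r)).
     \<bar>of_bool (e \<in> mwm (ball_graph G e r) w)
      - of_bool (e \<in> mwm (del_verts (ball_graph G e r) A) w)\<bar>)"

lemma corr_sensitivity: "corr F G e r = (\<integral>w. sensitivity G e r w \<partial>edge_weights F G)"
  by (simp add: corr_def sensitivity_def)

lemma abs_of_bool_diff_le_1: "\<bar>of_bool P - of_bool Q :: real\<bar> \<le> 1"
  by (cases P; cases Q) auto

lemma bdd_above_sensitivity:
  "bdd_above ((\<lambda>A. \<bar>of_bool (P A) - of_bool (Q A) :: real\<bar>) ` X)"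
  using abs_of_bool_diff_le_1 by (intro bdd_aboveI2) blast

lemma sensitivity_ge:
  assumes "A \<subseteq> boundary G (ball_graph G e r)"
  shows "\<bar>of_bool (e \<in> mwm (ball_graph G e r) w)
      - of_bool (e \<in> mwm (del_verts (ball_graph G e r) A) w)\<bar> \<le> sensitivity G e r w"
  unfolding sensitivity_def by (rule cSUP_upper[OF _ bdd_above_sensitivity]) (use assms in simp)

lemma sensitivity_nonneg: "0 \<le> sensitivity G e r w"
  using order_trans[OF abs_ge_zero sensitivity_ge[of "{}"]] by simp

lemma sensitivity_le_1: "sensitivity G e r w \<le> 1"
  unfolding sensitivity_def by (rule cSUP_least) (auto intro: abs_of_bool_diff_le_1)

lemma edge_subset_nball: "e \<subseteq> nball G e r"
  using nball_mono[of 0 r G e] by simp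

text \<open>By \<open>mwm_cut\<close>, \<open>e\<close> has the same status in \<open>H\<close> as
  in the ball without the set \<open>A\<close> below, and \<open>A\<close> is one of the sets in the
  supremum. \<open>H\<close> may be any finite graph whose edges lie between those of the ball and
  those of \<open>G\<close>, so the estimate serves finite graphs and the members of an exhaustion
  alike.\<close>

lemma mwm_ball_approx:
  assumes G: "wf_graph G" "e \<in> edges G" and H: "finite (edges H)" "edges H \<subseteq> edges G"
    and sub: "edges (ball_graph G e r) \<subseteq> edges H" and gen: "generic (edges G) w"
  shows "\<bar>of_bool (e \<in> mwm H w) - of_bool (e \<in> mwm (ball_graph G e r) w)\<bar> \<le> sensitivity G e r w"
proof -
  let ?B = "ball_graph G e r"
  define A where "A = {v \<in> verts ?B. \<exists>e'\<in>mwm H w. v \<in> e' \<and> \<not> e' \<subseteq> verts ?B}"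
  have V: "verts ?B = nball G e r"
    by (rule verts_ball_graph[OF G(1) edge_subset_verts[OF G]])
  have "edges ?B = {e' \<in> edges H. e' \<subseteq> verts ?B}"
    using sub H(2) unfolding V by (auto simp: edges_ball_graph)
  then have "mwm (del_verts ?B A) w = {e' \<in> mwm H w. e' \<subseteq> verts ?B}"
    by (rule mwm_cut[OF H(1) generic_mono[OF gen H(2)] _ A_def])
  then have "e \<in> mwm (del_verts ?B A) w \<longleftrightarrow> e \<in> mwm H w"
    using edge_subset_nball[of e G r] unfolding V by simp
  moreover have "A \<subseteq> boundary G ?B"
  proof
    fix v assume "v \<in> A"
    then obtain e' where e': "v \<in> verts ?B" "e' \<in> mwm H w" "v \<in> e'" "\<not> e' \<subseteq> verts ?B"
      by (auto simp: A_def)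
    have "e' \<in> edges G" using e'(2) mwm_subset[OF H(1)] H(2) by blast
    then obtain a b where "e' = {a, b}" "a \<in> verts G" "b \<in> verts G"
      using G(1) by (auto simp: wf_graph_def)
    then show "v \<in> boundary G ?B"
      using e' \<open>e' \<in> edges G\<close> by (auto simp: boundary_def adj_def insert_commute)
  qed
  ultimately show ?thesis
    using sensitivity_ge[of A G e r w] by (simp add: abs_minus_commute)
qed

lemma exhaustion_eventually_subset:
  assumes H: "exhaustion H G" and "finite E" "E \<subseteq> edges G"
  shows "\<forall>\<^sub>F n in sequentially. E \<subseteq> edges (H n)"
proof -
  have mono: "edges (H m) \<subseteq> edges (H n)" if "m \<le> n" for m n
    using that by (rule lift_Suc_mono_le[of "\<lambda>n. edges (H n)", rotated])
      (use H in \<open>auto simp: exhaustion_def subgraph_def\<close>)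
  have "\<forall>\<^sub>F n in sequentially. e \<in> edges (H n)" if "e \<in> E" for e
  proof -
    have "e \<in> (\<Union>n. edges (H n))" using that assms(3) H by (auto simp: exhaustion_def)
    then obtain N where "e \<in> edges (H N)" by blast
    then show ?thesis using mono unfolding eventually_sequentially by blast
  qed
  then have "\<forall>\<^sub>F n in sequentially. \<forall>e\<in>E. e \<in> edges (H n)"
    using assms(2) by (simp add: eventually_ball_finite)
  then show ?thesis by (simp add: subset_iff Ball_def)
qed

lemma exhaustion_finite_edges: "exhaustion H G \<Longrightarrow> finite (edges (H n))"
  by (rule finite_edges) (auto simp: exhaustion_def subgraph_def)

lemma exhaustion_edges: "exhaustion H G \<Longrightarrow> edges (H n) \<subseteq> edges G"
  by (auto simp: exhaustion_def subgraph_def)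

lemma finite_edges_ball_graph:
  assumes "wf_graph G" "locally_finite G" "e \<in> edges G"
  shows "finite (edges (ball_graph G e r))"
  using finite_nball[OF assms(1,2) edge_subset_verts[OF assms(1,3)] finite_edge[OF assms(1,3)], of r]
    finite_edges[OF wf_ball_graph[OF assms(1)]] verts_ball_graph[OF assms(1) edge_subset_verts[OF assms(1,3)]]
  by metis

lemma finite_boundary_ball_graph:
  assumes "wf_graph G" "locally_finite G" "e \<in> edges G"
  shows "finite (boundary G (ball_graph G e r))"
  using finite_nball[OF assms(1,2) edge_subset_verts[OF assms(1,3)] finite_edge[OF assms(1,3)], of r]
  by (simp add: boundary_def verts_ball_graph[OF assms(1) edge_subset_verts[OF assms(1,3)]])

text \<open>The bound for \<open>H n\<close> holds as soon as \<open>H n\<close> contains the edges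
  of the ball and does not depend on \<open>n\<close>, so it survives the passage to the
  limit.\<close>

lemma mwm_along_approx:
  assumes G: "wf_graph G" "locally_finite G" "e \<in> edges G"
    and H: "infinite (verts G) \<Longrightarrow> exhaustion H G" and gen: "generic (edges G) w"
  shows "\<bar>of_bool (e \<in> mwm_along H G w) - of_bool (e \<in> mwm (ball_graph G e r) w)\<bar> \<le> sensitivity G e r w"
proof (cases "finite (verts G)")
  case True
  then show ?thesis
    using mwm_ball_approx[OF G(1,3) finite_edges[OF G(1) True] order_refl _ gen, of r]
    by (simp add: mwm_along_def edges_ball_graph)
next
  case inf: False
  let ?B = "ball_graph G e r"
  note ex = H[OF inf]
  have "\<forall>\<^sub>F n in sequentially. edges ?B \<subseteq> edges (H n)"
    by (rule exhaustion_eventually_subset[OF ex finite_edges_ball_graph[OF G]])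
      (auto simp: edges_ball_graph)
  then have ev: "\<forall>\<^sub>F n in sequentially. \<bar>of_bool (e \<in> mwm (H n) w) - of_bool (e \<in> mwm ?B w)\<bar> \<le> sensitivity G e r w"
    by (rule eventually_mono) (intro mwm_ball_approx G exhaustion_finite_edges[OF ex] exhaustion_edges[OF ex] gen)
  \<comment> \<open>If the sensitivity is below 1, the indicators along \<open>H\<close> are eventually constant, so that the
    existence of their limit need not be assumed.\<close>
  show ?thesis
  proof (cases "sensitivity G e r w < 1")
    case True
    have "\<forall>\<^sub>F n in sequentially. e \<in> mwm (H n) w \<longleftrightarrow> e \<in> mwm ?B w"
      using ev by (rule eventually_mono) (use True in \<open>auto simp: of_bool_def split: if_splits\<close>)
    then have "(\<forall>\<^sub>F n in sequentially. e \<in> mwm (H n) w) \<longleftrightarrow> e \<in> mwm ?B w"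
      using eventually_cong[of _ sequentially "\<lambda>n. e \<in> mwm (H n) w" "\<lambda>_. e \<in> mwm ?B w"] by simp
    then have "e \<in> mwm_along H G w \<longleftrightarrow> e \<in> mwm ?B w"
      using G(3) by (simp add: mwm_along_infinite_iff[OF inf])
    then show ?thesis using sensitivity_nonneg by simp
  next
    case False
    then show ?thesis using abs_of_bool_diff_le_1 by (meson not_less order_trans)
  qed
qed

section \<open>Invariance of edge functionals under local isomorphisms\<close>

context
  fixes \<phi> :: "'a \<Rightarrow> 'b" and G e G' e' r
  assumes iso: "local_iso \<phi> G e G' e' r" and wf: "wf_graph G" "wf_graph G'"
    and lf: "locally_finite G"
    and e: "e \<in> edges G" and e': "e' \<in> edges G'"
begin

lemma local_iso_inj_on_ball: "inj_on \<phi> (verts (ball_graph G e r))"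
  unfolding verts_ball_graph[OF wf(1) edge_subset_verts[OF wf(1) e]]
  by (rule inj_on_subset[OF local_iso_inj[OF iso wf edge_subset_verts[OF wf(1) e] edge_subset_verts[OF wf(2) e']]])
    simp

lemma local_iso_ball_edges: "edges (ball_graph G' e' r) = (`) \<phi> ` edges (ball_graph G e r)"
  unfolding local_iso_ball_graph[OF iso wf edge_subset_verts[OF wf(1) e] edge_subset_verts[OF wf(2) e']]
  by (simp add: gmap_def)

text \<open>Genericity is required on the target side because in the application \<open>w'\<close>
  is the random weight function, while \<open>w\<close> is its pull-back, which is meaningful on the
  edges of the ball only.\<close>

lemma local_iso_mwm_del_verts:
  assumes gen: "generic (edges G') w'" and A: "A \<subseteq> verts (ball_graph G e r)"
    and w: "\<And>a. a \<in> edges (ball_graph G e r) \<Longrightarrow> w a = w' (\<phi> ` a)"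
  shows "e' \<in> mwm (del_verts (ball_graph G' e' r) (\<phi> ` A)) w' \<longleftrightarrow> e \<in> mwm (del_verts (ball_graph G e r) A) w"
proof -
  let ?B = "ball_graph G e r" and ?D = "del_verts (ball_graph G e r) A"
  have wfB: "wf_graph ?B" "wf_graph ?D" using wf(1) by (simp_all add: wf_ball_graph wf_del_verts)
  have D: "edges ?D \<subseteq> edges ?B" "verts ?D \<subseteq> verts ?B"
    by (auto simp: edges_del_verts verts_del_verts)
  have fin: "finite (edges ?D)"
    using D(1) finite_edges_ball_graph[OF wf(1) lf e] by (rule finite_subset)
  have inj: "inj_on \<phi> (verts ?D)" using local_iso_inj_on_ball D(2) by (rule inj_on_subset)
  have eq: "del_verts (ball_graph G' e' r) (\<phi> ` A) = gmap \<phi> ?D"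
    unfolding local_iso_ball_graph[OF iso wf edge_subset_verts[OF wf(1) e] edge_subset_verts[OF wf(2) e']]
    by (rule del_verts_gmap[OF wfB(1) local_iso_inj_on_ball A])
  have "edges (gmap \<phi> ?D) \<subseteq> edges (ball_graph G' e' r)"
    using D(1) by (auto simp: gmap_def local_iso_ball_edges)
  also have "\<dots> \<subseteq> edges G'" by (auto simp: edges_ball_graph)
  finally have "generic (edges (gmap \<phi> ?D)) w'" by (rule generic_mono[OF gen])
  then have "mwm (gmap \<phi> ?D) w' = (`) \<phi> ` mwm ?D w"
    using D(1) by (intro mwm_gmap wfB inj fin w) auto
  moreover have "e' = \<phi> ` e" using iso by (simp add: local_iso_def)
  moreover have "\<phi> ` e \<in> (`) \<phi> ` mwm ?D w \<longleftrightarrow> e \<in> mwm ?D w"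
  proof -
    have "inj_on ((`) \<phi>) (edges ?B)"
      by (rule inj_on_image_edges[OF wfB(1) local_iso_inj_on_ball])
    moreover have "e \<in> edges ?B" using e edge_subset_nball[of e G r] by (simp add: edges_ball_graph)
    moreover have "mwm ?D w \<subseteq> edges ?B" using mwm_subset[OF fin, of w] D(1) by blast
    ultimately show ?thesis by (rule inj_on_image_mem_iff)
  qed
  ultimately show ?thesis unfolding eq by simp
qed

lemma local_iso_mwm:
  assumes gen: "generic (edges G') w'"
    and w: "\<And>a. a \<in> edges (ball_graph G e r) \<Longrightarrow> w a = w' (\<phi> ` a)"
  shows "e' \<in> mwm (ball_graph G' e' r) w' \<longleftrightarrow> e \<in> mwm (ball_graph G e r) w"
  using local_iso_mwm_del_verts[OF gen _ w, of "{}"] wf by (simp add: del_verts_empty wf_ball_graph)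

text \<open>The subsets of the image boundary are the images of the subsets of the boundary, so both
  suprema run over the same values.\<close>

lemma local_iso_sensitivity:
  assumes gen: "generic (edges G') w'"
    and w: "\<And>a. a \<in> edges (ball_graph G e r) \<Longrightarrow> w a = w' (\<phi> ` a)"
  shows "sensitivity G' e' r w' = sensitivity G e r w"
proof -
  have "boundary G (ball_graph G e r) \<subseteq> verts (ball_graph G e r)" by (auto simp: boundary_def)
  then show ?thesis
    unfolding sensitivity_def
      local_iso_boundary[OF iso wf edge_subset_verts[OF wf(1) e] edge_subset_verts[OF wf(2) e']]
      image_Pow_surj[OF refl, symmetric] image_image
    by (intro SUP_cong refl) (simp add: local_iso_mwm[OF gen w] local_iso_mwm_del_verts[OF gen _ w])
qed

end

section \<open>Expectations over the edge weights\<close>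

text \<open>The local substitute for the contribution of an edge. In the end \<open>f\<close> is the
  constant 1, for the number of edges, or a bounded truncation of the identity, for the
  weight.\<close>

definition ball_value :: "real measure \<Rightarrow> (real \<Rightarrow> real) \<Rightarrow> 'a graph \<Rightarrow> 'a set \<Rightarrow> nat \<Rightarrow> real" where
  "ball_value F f G e r =
     (\<integral>w. f (w e) * of_bool (e \<in> mwm (ball_graph G e r) w) \<partial>edge_weights F G)"

lemma countable_edges: "wf_graph (G :: 'a :: countable graph) \<Longrightarrow> countable (edges G)"
  by (rule countable_subset[OF _ countable_Collect_finite]) (auto dest: finite_edge)

context weight_law
begin

lemma measurable_mwm_ball:
  assumes "wf_graph G" "locally_finite G" "e \<in> edges G" "edges (ball_graph G e r) \<subseteq> E"
  shows "Measurable.pred (iid E) (\<lambda>w. e \<in> mwm (ball_graph G e r) w)"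
  by (rule measurable_mwm[OF finite_edges_ball_graph[OF assms(1-3)] assms(4)])

lemma measurable_sensitivity:
  assumes "wf_graph G" "locally_finite G" "e \<in> edges G" "edges (ball_graph G e r) \<subseteq> E"
  shows "sensitivity G e r \<in> borel_measurable (iid E)"
proof -
  have del: "Measurable.pred (iid E) (\<lambda>w. e \<in> mwm (del_verts (ball_graph G e r) A) w)" for A
  proof -
    have "edges (del_verts (ball_graph G e r) A) \<subseteq> edges (ball_graph G e r)"
      by (auto simp: edges_del_verts)
    then show ?thesis
      using finite_edges_ball_graph[OF assms(1-3), of r] assms(4)
      by (intro measurable_mwm) (auto intro: finite_subset)
  qed
  note [measurable] = measurable_mwm_ball[OF assms] del
  show ?thesis
    unfolding sensitivity_def
  proof (rule borel_measurable_cSUP)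
    show "countable (Pow (boundary G (ball_graph G e r)))"
      using finite_boundary_ball_graph[OF assms(1-3)] by (simp add: countable_finite)
  qed (measurable, rule bdd_above_sensitivity)
qed

text \<open>Almost sure equality is what is available in the application, since the identification
  of matchings fails on ties.\<close>

lemma integral_iid_transfer:
  fixes g :: "('a \<Rightarrow> real) \<Rightarrow> real"
  assumes J: "inj_on J K" "J \<in> K \<rightarrow> E"
    and meas: "f \<in> borel_measurable (iid K)" "g \<in> borel_measurable (iid E)"
    and eq: "AE w in iid E. g w = f (\<lambda>e\<in>K. w (J e))"
  shows "(\<integral>w. g w \<partial>iid E) = (\<integral>w. f w \<partial>iid K)"
proof -
  note re = measurable_reindex[OF J(2)]
  have "(\<integral>w. g w \<partial>iid E) = (\<integral>w. f (\<lambda>e\<in>K. w (J e)) \<partial>iid E)"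
    by (rule integral_cong_AE[OF meas(2) measurable_compose[OF re meas(1)] eq])
  also have "\<dots> = (\<integral>w. f w \<partial>distr (iid E) (iid K) (\<lambda>w. \<lambda>e\<in>K. w (J e)))"
    by (rule integral_distr[OF re meas(1), symmetric])
  also have "\<dots> = (\<integral>w. f w \<partial>iid K)"
    by (simp only: distr_iid_reindex[OF J])
  finally show ?thesis .
qed

lemma measurable_weight_of_bool:
  fixes f :: "real \<Rightarrow> real"
  assumes "f \<in> borel_measurable borel" "e \<in> E" "Measurable.pred (iid E) P"
  shows "(\<lambda>w. f (w e) * of_bool (P w)) \<in> borel_measurable (iid E)"
  using assms by measurable

text \<open>Both expectations involve only the finitely many weights in the ball, and
  \<open>\<phi>\<close> carries the edges of one ball injectively to those of the other. So the
  integral over all weights of \<open>G'\<close> becomes an integral over independent weights on the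
  edges of the ball in \<open>G\<close>.\<close>

lemma local_iso_integrals:
  fixes G :: "'a graph" and G' :: "'b :: countable graph"
  assumes iso: "local_iso \<phi> G e G' e' r" and wf: "wf_graph G" "wf_graph G'"
    and lf: "locally_finite G" "locally_finite G'"
    and e: "e \<in> edges G" and e': "e' \<in> edges G'" and f: "f \<in> borel_measurable borel"
  shows "corr F G' e' r = (\<integral>w. sensitivity G e r w \<partial>iid (edges (ball_graph G e r)))"
    and "ball_value F f G' e' r =
      (\<integral>w. f (w e) * of_bool (e \<in> mwm (ball_graph G e r) w) \<partial>iid (edges (ball_graph G e r)))"
proof -
  let ?K = "edges (ball_graph G e r)"
  have eK: "e \<in> ?K" using e edge_subset_nball[of e G r] by (simp add: edges_ball_graph)
  have J: "inj_on ((`) \<phi>) ?K" "(`) \<phi> \<in> ?K \<rightarrow> edges G'"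
  proof -
    show "inj_on ((`) \<phi>) ?K"
      using inj_on_image_edges[OF wf_ball_graph[OF wf(1)] local_iso_inj_on_ball[OF iso wf lf(1) e e']] .
    show "(`) \<phi> \<in> ?K \<rightarrow> edges G'"
      using local_iso_ball_edges[OF iso wf lf(1) e e'] edges_ball_graph[of G' e' r] by auto
  qed
  have gen: "AE w in iid (edges G'). generic (edges G') w"
    by (rule AE_generic[OF countable_edges[OF wf(2)]])
  have sub: "edges (ball_graph G' e' r) \<subseteq> edges G'" by (auto simp: edges_ball_graph)
  show "corr F G' e' r = (\<integral>w. sensitivity G e r w \<partial>iid ?K)"
    unfolding corr_sensitivity edge_weights_def
  proof (rule integral_iid_transfer[OF J])
    show "AE w in iid (edges G'). sensitivity G' e' r w = sensitivity G e r (\<lambda>a\<in>?K. w (\<phi> ` a))"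
      using gen by (rule AE_mp) (auto intro!: AE_I2 local_iso_sensitivity[OF iso wf lf(1) e e'])
  qed (intro measurable_sensitivity wf lf e e' sub order_refl)+
  show "ball_value F f G' e' r = (\<integral>w. f (w e) * of_bool (e \<in> mwm (ball_graph G e r) w) \<partial>iid ?K)"
    unfolding ball_value_def edge_weights_def
  proof (rule integral_iid_transfer[OF J])
    have e'_eq: "\<phi> ` e = e'" using iso by (simp add: local_iso_def)
    show "AE w in iid (edges G'). f (w e') * of_bool (e' \<in> mwm (ball_graph G' e' r) w) =
        f ((\<lambda>a\<in>?K. w (\<phi> ` a)) e) * of_bool (e \<in> mwm (ball_graph G e r) (\<lambda>a\<in>?K. w (\<phi> ` a)))"
    proof (rule AE_mp[OF gen], intro AE_I2 impI)
      fix w assume "generic (edges G') w"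
      then have "e' \<in> mwm (ball_graph G' e' r) w \<longleftrightarrow> e \<in> mwm (ball_graph G e r) (\<lambda>a\<in>?K. w (\<phi> ` a))"
        by (rule local_iso_mwm[OF iso wf lf(1) e e']) simp
      then show "f (w e') * of_bool (e' \<in> mwm (ball_graph G' e' r) w) =
        f ((\<lambda>a\<in>?K. w (\<phi> ` a)) e) * of_bool (e \<in> mwm (ball_graph G e r) (\<lambda>a\<in>?K. w (\<phi> ` a)))"
        using eK by (simp add: e'_eq)
    qed
    show "(\<lambda>w. f (w e) * of_bool (e \<in> mwm (ball_graph G e r) w)) \<in> borel_measurable (iid ?K)"
      by (intro measurable_weight_of_bool f eK measurable_mwm_ball wf lf e order_refl)
    show "(\<lambda>w. f (w e') * of_bool (e' \<in> mwm (ball_graph G' e' r) w)) \<in> borel_measurable (iid (edges G'))"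
      by (intro measurable_weight_of_bool f e' measurable_mwm_ball wf lf sub)
  qed
qed

text \<open>Used twice, once for \<open>\<phi>\<close> and once for the identity of
  \<open>G\<close>, the preceding lemma gives the same integral over the weights of the ball for
  both graphs.\<close>

lemma local_iso_eq:
  fixes G :: "'a :: countable graph" and G' :: "'b :: countable graph"
  assumes "local_iso \<phi> G e G' e' r" "wf_graph G" "wf_graph G'"
    "locally_finite G" "locally_finite G'"
    "e \<in> edges G" "e' \<in> edges G'" "f \<in> borel_measurable borel"
  shows "corr F G' e' r = corr F G e r" "ball_value F f G' e' r = ball_value F f G e r"
proof -
  have id: "local_iso id G e G e r" by (simp add: local_iso_def)
  note 1 = local_iso_integrals[OF assms]
  note 2 = local_iso_integrals[OF id assms(2,2,4,4,6,6,8)]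
  show "corr F G' e' r = corr F G e r" "ball_value F f G' e' r = ball_value F f G e r"
    using 1 2 by simp_all
qed

text \<open>The factor \<open>f (w e)\<close> is common to both integrands, so their difference is
  at most \<open>L\<close> times the sensitivity wherever the weights are generic. \<open>P\<close>
  stands for membership of \<open>e\<close> in a matching of the whole graph.\<close>

lemma integral_approx:
  fixes G :: "'a :: countable graph"
  assumes G: "wf_graph G" "locally_finite G" "e \<in> edges G"
    and f: "f \<in> borel_measurable borel" "\<And>x. 0 \<le> f x" "\<And>x. f x \<le> L"
    and P: "Measurable.pred (iid (edges G)) P"
    and approx: "\<And>w. generic (edges G) w \<Longrightarrow>
      \<bar>of_bool (P w) - of_bool (e \<in> mwm (ball_graph G e r) w)\<bar> \<le> sensitivity G e r w"
  shows "\<bar>(\<integral>w. f (w e) * of_bool (P w) \<partial>edge_weights F G) - ball_value F f G e r\<bar> \<le> L * corr F G e r"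
proof -
  let ?M = "iid (edges G)"
  interpret M: prob_space ?M by (rule prob_space_iid)
  have sub: "edges (ball_graph G e r) \<subseteq> edges G" by (auto simp: edges_ball_graph)
  note meas = measurable_weight_of_bool[OF f(1) G(3) P]
    measurable_weight_of_bool[OF f(1) G(3) measurable_mwm_ball[OF G sub]]
  have L: "0 \<le> L" using f(2,3)[of 0] by simp
  have fb: "\<bar>f x * of_bool Q\<bar> \<le> L" for x Q using f(2,3)[of x] L by (cases Q) auto
  have int: "integrable ?M (\<lambda>w. f (w e) * of_bool (P w))"
    "integrable ?M (\<lambda>w. f (w e) * of_bool (e \<in> mwm (ball_graph G e r) w))"
    by (rule M.integrable_const_bound[where B = L, OF _ meas(1)], simp add: fb)
      (rule M.integrable_const_bound[where B = L, OF _ meas(2)], simp add: fb)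
  have ints: "integrable ?M (sensitivity G e r)"
    by (rule M.integrable_const_bound[where B = 1, OF _ measurable_sensitivity[OF G sub]])
      (simp add: sensitivity_nonneg sensitivity_le_1)
  have "\<bar>(\<integral>w. f (w e) * of_bool (P w) \<partial>?M) - ball_value F f G e r\<bar> =
      \<bar>\<integral>w. f (w e) * of_bool (P w) - f (w e) * of_bool (e \<in> mwm (ball_graph G e r) w) \<partial>?M\<bar>"
    unfolding ball_value_def edge_weights_def using int by simp
  also have "\<dots> \<le> (\<integral>w. \<bar>f (w e) * of_bool (P w) - f (w e) * of_bool (e \<in> mwm (ball_graph G e r) w)\<bar> \<partial>?M)"
    by (rule integral_abs_bound)
  also have "\<dots> \<le> (\<integral>w. L * sensitivity G e r w \<partial>?M)"
  proof (rule integral_mono_AE)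
    show "AE w in ?M. \<bar>f (w e) * of_bool (P w) - f (w e) * of_bool (e \<in> mwm (ball_graph G e r) w)\<bar>
        \<le> L * sensitivity G e r w"
    proof (rule AE_mp[OF AE_generic[OF countable_edges[OF G(1)]]], intro AE_I2 impI)
      fix w assume "generic (edges G) w"
      have "\<bar>f (w e) * of_bool (P w) - f (w e) * of_bool (e \<in> mwm (ball_graph G e r) w)\<bar>
          = f (w e) * \<bar>of_bool (P w) - of_bool (e \<in> mwm (ball_graph G e r) w)\<bar>"
        using f(2)[of "w e"] by (simp add: abs_mult flip: right_diff_distrib)
      also have "\<dots> \<le> L * sensitivity G e r w"
        by (intro mult_mono f approx L \<open>generic (edges G) w\<close>) auto
      finally show "\<bar>f (w e) * of_bool (P w) - f (w e) * of_bool (e \<in> mwm (ball_graph G e r) w)\<bar>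
        \<le> L * sensitivity G e r w" .
    qed
  qed (intro integrable_abs Bochner_Integration.integrable_diff integrable_mult_right int ints)+
  also have "\<dots> = L * corr F G e r" by (simp add: corr_sensitivity edge_weights_def)
  finally show ?thesis by (simp add: edge_weights_def)
qed

lemma measurable_mwm_along:
  assumes G: "wf_graph G" and H: "infinite (verts G) \<Longrightarrow> exhaustion H G"
  shows "Measurable.pred (iid (edges G)) (\<lambda>w. e \<in> mwm_along H G w)"
proof (cases "finite (verts G)")
  case True
  then show ?thesis
    using measurable_mwm[OF finite_edges[OF G True] order_refl, of "\<lambda>M. e \<in> M"]
    by (simp add: mwm_along_def)
next
  case False
  have [measurable]: "Measurable.pred (iid (edges G)) (\<lambda>w. e \<in> mwm (H n) w)" for n
    by (rule measurable_mwm[OF exhaustion_finite_edges[OF H[OF False]] exhaustion_edges[OF H[OF False]]])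
  show ?thesis
    unfolding mwm_along_infinite_iff[OF False] eventually_sequentially by measurable
qed

end

section \<open>Local functionals of the root\<close>

definition root_degree :: "'a graph \<Rightarrow> 'a \<Rightarrow> nat" where
  "root_degree G v = card (neighbours G v)"

definition root_value :: "real measure \<Rightarrow> (real \<Rightarrow> real) \<Rightarrow> nat \<Rightarrow> 'a graph \<Rightarrow> 'a \<Rightarrow> real" where
  "root_value F f r G v = (\<Sum>u\<in>neighbours G v. ball_value F f G {v, u} r)"

definition root_corr :: "real measure \<Rightarrow> nat \<Rightarrow> 'a graph \<Rightarrow> 'a \<Rightarrow> real" where
  "root_corr F r G v = (\<Sum>u\<in>neighbours G v. corr F G {v, u} r)"

lemma nball_neighbour_subset:
  assumes "u \<in> neighbours G v"
  shows "nball G {v, u} k \<subseteq> nball G {v} (Suc k)"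
proof (induction k)
  case (Suc k)
  then show ?case by (auto simp del: nball.simps simp: nball.simps(2)[of _ _ k] nball.simps(2)[of _ _ "Suc k"])
qed (use assms in auto)

text \<open>The ball around an edge at \<open>v\<close> lies in the ball around \<open>v\<close> of
  radius one larger; this accounts for the loss of one in the radius.\<close>

lemma local_iso_root_edge:
  assumes iso: "local_iso \<phi> G {v} G' {v'} (Suc r)" and u: "u \<in> neighbours G v"
  shows "local_iso \<phi> G {v, u} G' {v', \<phi> u} r"
  using iso nball_neighbour_subset[OF u, of r] nball_neighbour_subset[OF u, of "Suc r"]
  unfolding local_iso_def by (auto intro: inj_on_subset simp del: nball.simps)

lemma nball_self: "v \<in> nball G {v} k"
  using nball_mono[of 0 k G "{v}"] by auto

lemma (in weight_law) local_iso_root: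
  fixes G :: "'a :: countable graph" and G' :: "'b :: countable graph"
  assumes iso: "local_iso \<phi> G {v} G' {v'} (Suc r)"
    and wf: "wf_graph G" "wf_graph G'" and lf: "locally_finite G" "locally_finite G'"
    and f: "f \<in> borel_measurable borel"
  shows "root_degree G' v' = root_degree G v" "root_corr F r G' v' = root_corr F r G v"
    "root_value F f r G' v' = root_value F f r G v"
proof -
  have v': "\<phi> v = v'" using iso by (simp add: local_iso_def)
  have N: "neighbours G' v' = \<phi> ` neighbours G v"
    using iso nball_self[of v G "Suc r"] unfolding local_iso_def v'[symmetric] by blast
  have "neighbours G v \<subseteq> nball G {v} (Suc (Suc r))"
    using nball_self[of v G "Suc r"] by auto
  then have inj: "inj_on \<phi> (neighbours G v)"
    using iso unfolding local_iso_def by (meson inj_on_subset)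
  show "root_degree G' v' = root_degree G v"
    using inj by (simp add: root_degree_def N card_image)
  have E: "{v, u} \<in> edges G" "{v', \<phi> u} \<in> edges G'" if "u \<in> neighbours G v" for u
    using that N by (auto simp: neighbours_def adj_def)
  note eq = local_iso_eq[OF local_iso_root_edge[OF iso] wf lf E f]
  show "root_corr F r G' v' = root_corr F r G v"
    unfolding root_corr_def N sum.reindex[OF inj] comp_def by (intro sum.cong refl eq(1))
  show "root_value F f r G' v' = root_value F f r G v"
    unfolding root_value_def N sum.reindex[OF inj] comp_def by (intro sum.cong refl eq(2))
qed

section \<open>From isomorphisms of rooted graphs and balls to local isomorphisms\<close>

text \<open>The ball of radius \<open>Suc r\<close> contains all neighbours of a vertex only if that
  vertex has distance at most \<open>r\<close> from the root. This is a second loss of one in the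
  radius.\<close>

lemma ball_iso_local_iso:
  assumes x: "rooted_graph x" and y: "rooted_graph y" and iso: "ball_iso \<phi> x y (Suc r)"
  shows "local_iso \<phi> (fst x) {snd x} (fst y) {snd y} r"
proof -
  have wf: "wf_graph (fst x)" "wf_graph (fst y)" "{snd x} \<subseteq> verts (fst x)" "{snd y} \<subseteq> verts (fst y)"
    using x y by (auto simp: rooted_graph_def)
  have X: "verts (fst (rooted_ball x k)) = nball (fst x) {snd x} k"
    and Y: "verts (fst (rooted_ball y k)) = nball (fst y) {snd y} k" for k
    by (simp_all only: rooted_ball_def fst_conv verts_ball_graph[OF wf(1,3)] verts_ball_graph[OF wf(2,4)])
  have bij: "bij_betw \<phi> (nball (fst x) {snd x} (Suc r)) (nball (fst y) {snd y} (Suc r))"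
    and root: "\<phi> (snd x) = snd y"
    and adj: "\<And>u v. u \<in> nball (fst x) {snd x} (Suc r) \<Longrightarrow> v \<in> nball (fst x) {snd x} (Suc r) \<Longrightarrow>
      adj (fst x) u v \<longleftrightarrow> adj (fst y) (\<phi> u) (\<phi> v)"
    using iso unfolding ball_iso_def X Y by blast+
  have "neighbours (fst y) (\<phi> u) = \<phi> ` neighbours (fst x) u" if u: "u \<in> nball (fst x) {snd x} r" for u
  proof (intro subset_antisym subsetI)
    have u': "u \<in> nball (fst x) {snd x} (Suc r)" using u by simp
    fix z
    {
      assume "z \<in> neighbours (fst y) (\<phi> u)"
      moreover have "\<phi> u \<in> nball (fst y) {snd y} r"
        using ball_iso_image[OF x y iso, of r u] u by (simp add: X Y)
      ultimately have "z \<in> nball (fst y) {snd y} (Suc r)" by auto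
      then obtain t where "t \<in> nball (fst x) {snd x} (Suc r)" "z = \<phi> t"
        using bij unfolding bij_betw_def by blast
      then show "z \<in> \<phi> ` neighbours (fst x) u"
        using adj[OF u'] \<open>z \<in> neighbours (fst y) (\<phi> u)\<close> by (auto simp: neighbours_def simp del: nball.simps)
    next
      assume "z \<in> \<phi> ` neighbours (fst x) u"
      then obtain t where t: "t \<in> neighbours (fst x) u" "z = \<phi> t" by blast
      then have "t \<in> nball (fst x) {snd x} (Suc r)" using u by auto
      then show "z \<in> neighbours (fst y) (\<phi> u)"
        using adj[OF u'] t by (auto simp: neighbours_def simp del: nball.simps)
    }
  qed
  then show ?thesis
    using bij root unfolding local_iso_def bij_betw_def by simp
qed

lemma rooted_iso_local_iso:
  assumes x: "rooted_graph x" and y: "rooted_graph y" and iso: "rooted_iso x y"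
  obtains \<phi> where "\<And>r. local_iso \<phi> (fst x) {snd x} (fst y) {snd y} r"
proof -
  obtain \<phi> where bij: "bij_betw \<phi> (verts (fst x)) (verts (fst y))" and root: "\<phi> (snd x) = snd y"
    and adj: "\<And>u v. u \<in> verts (fst x) \<Longrightarrow> v \<in> verts (fst x) \<Longrightarrow> adj (fst x) u v \<longleftrightarrow> adj (fst y) (\<phi> u) (\<phi> v)"
    using iso unfolding rooted_iso_def by blast
  have wf: "wf_graph (fst x)" "wf_graph (fst y)" "{snd x} \<subseteq> verts (fst x)"
    using x y by (auto simp: rooted_graph_def)
  have "neighbours (fst y) (\<phi> u) = \<phi> ` neighbours (fst x) u" if u: "u \<in> verts (fst x)" for u
  proof (intro subset_antisym subsetI)
    fix z
    {
      assume z: "z \<in> neighbours (fst y) (\<phi> u)"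
      then have "z \<in> verts (fst y)" using neighbours_verts[OF wf(2)] by blast
      then obtain t where "t \<in> verts (fst x)" "z = \<phi> t" using bij unfolding bij_betw_def by blast
      then show "z \<in> \<phi> ` neighbours (fst x) u"
        using adj[OF u] z by (auto simp: neighbours_def)
    next
      assume "z \<in> \<phi> ` neighbours (fst x) u"
      then show "z \<in> neighbours (fst y) (\<phi> u)"
        using adj[OF u] adj_verts[OF wf(1)] by (auto simp: neighbours_def)
    }
  qed
  then have "local_iso \<phi> (fst x) {snd x} (fst y) {snd y} r" for r
    using bij root nball_verts[OF wf(1,3), of r] nball_verts[OF wf(1,3), of "Suc r"]
    unfolding local_iso_def bij_betw_def by (auto intro: inj_on_subset simp del: nball.simps)
  then show thesis by (rule that)
qed

section \<open>Components and their classes\<close>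

lemma gdist_finite_iff: "gdist G u v < \<infinity> \<longleftrightarrow> (u, v) \<in> {(x, y). adj G x y}\<^sup>*"
proof -
  have "gdist G u v < \<infinity> \<longleftrightarrow> (\<exists>r. gdist G u v \<le> enat r)"
    by (cases "gdist G u v") auto
  then show ?thesis unfolding gdist_le_iff rtrancl_power by auto
qed

lemma sym_adj: "sym {(x, y). adj G x y}"
  by (auto simp: sym_def adj_def insert_commute)

lemma adj_component:
  assumes "gdist G v x < \<infinity>"
  shows "adj (component G v) x y \<longleftrightarrow> adj G x y"
proof -
  have "gdist G v y < \<infinity>" if "adj G x y"
    using assms that unfolding gdist_finite_iff by (auto intro: rtrancl_into_rtrancl)
  then show ?thesis using assms by (auto simp: component_def induced_def adj_def)
qed

lemma rtrancl_component:
  assumes "(v, u) \<in> {(x, y). adj G x y}\<^sup>*"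
  shows "(v, u) \<in> {(x, y). adj (component G v) x y}\<^sup>*"
  using assms
proof (induction rule: rtrancl_induct)
  case (step y z)
  have "gdist G v y < \<infinity>" unfolding gdist_finite_iff by (rule step.hyps(1))
  then have "adj (component G v) y z" using step.hyps(2) by (simp add: adj_component)
  then show ?case using step.IH by (auto intro: rtrancl_into_rtrancl)
qed simp

lemma verts_component: "verts (component G v) = {u \<in> verts G. gdist G v u < \<infinity>}"
  by (auto simp: component_def induced_def)

lemma rooted_graph_component:
  assumes "wf_graph G" "locally_finite G" "v \<in> verts G"
  shows "rooted_graph (component G v, v)"
proof -
  let ?C = "component G v"
  have wf: "wf_graph ?C" using assms(1) by (simp add: component_def wf_induced)
  have "neighbours ?C u \<subseteq> neighbours G u" for u
    by (auto simp: neighbours_def adj_def component_def induced_def)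
  then have lf: "locally_finite ?C"
    using assms(2) finite_subset unfolding locally_finite_def verts_component by blast
  have "gdist ?C a b < \<infinity>" if ab: "a \<in> verts ?C" "b \<in> verts ?C" for a b
  proof -
    have "(v, a) \<in> {(x, y). adj ?C x y}\<^sup>*" "(v, b) \<in> {(x, y). adj ?C x y}\<^sup>*"
      using ab unfolding verts_component gdist_finite_iff by (auto intro: rtrancl_component)
    moreover have "sym ({(x, y). adj ?C x y}\<^sup>*)" by (intro sym_rtrancl sym_adj)
    ultimately show ?thesis unfolding gdist_finite_iff by (meson rtrancl_trans symD)
  qed
  then show ?thesis
    using wf lf assms(3) unfolding rooted_graph_def graph_connected_def
    by (simp add: verts_component gdist_self del: enat_ord_simps)
qed

text \<open>A component contains all neighbours of its vertices, so the inclusion is a local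
  isomorphism of every radius.\<close>

lemma local_iso_component:
  assumes "wf_graph G" "locally_finite G" "v \<in> verts G"
  shows "local_iso id (component G v) {v} G {v} r"
proof -
  have "wf_graph (component G v)" "{v} \<subseteq> verts (component G v)"
    using rooted_graph_component[OF assms] by (auto simp: rooted_graph_def)
  then have "nball (component G v) {v} r \<subseteq> verts (component G v)" by (rule nball_verts)
  then show ?thesis
    by (auto simp: local_iso_def neighbours_def verts_component adj_component)
qed

lemma rooted_graph_of: "rooted_graph (graph_of g, root_of g)"
  using rooted_graph_rep[of g] by (simp add: graph_of_def root_of_def)

lemma wf_graph_of: "wf_graph (graph_of g)"
  and locally_finite_graph_of: "locally_finite (graph_of g)"
  and graph_connected_graph_of: "graph_connected (graph_of g)"
  and root_of_verts: "root_of g \<in> verts (graph_of g)"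
  using rooted_graph_of[of g] by (simp_all add: rooted_graph_def)

text \<open>The representative of the class need not be the component itself, but it is isomorphic
  to it, and one map works for all radii.\<close>

lemma rooted_class_local_iso:
  assumes "wf_graph G" "locally_finite G" "v \<in> verts G"
  obtains \<phi> where "\<And>r. local_iso \<phi> (graph_of (rooted_class G v)) {root_of (rooted_class G v)} (component G v) {v} r"
proof -
  let ?x = "(component G v, v)"
  have "rooted_graph ?x" by (rule rooted_graph_component[OF assms])
  then have "rooted_eq ?x ?x" by (simp add: rooted_eq_def rooted_iso_refl)
  then have "rooted_eq (rep_rgraph (rooted_class G v)) ?x"
    unfolding rooted_class_def by (rule Quotient3_rep_abs[OF Quotient3_rgraph])
  then have "rooted_iso (rep_rgraph (rooted_class G v)) ?x" by (simp add: rooted_eq_def)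
  then show thesis
    using rooted_iso_local_iso[OF rooted_graph_rep \<open>rooted_graph ?x\<close>] that
    by (metis fst_conv graph_of_def root_of_def snd_conv)
qed

text \<open>Classes at distance below \<open>1 / (real R + 1)\<close> share the ball of radius
  \<open>R\<close>, so a function of that ball is locally constant. This yields both the test
  functions for the weak convergence and, through continuity, measurability.\<close>

lemma continuous_on_same_ball:
  fixes h :: "rgraph \<Rightarrow> real"
  assumes "\<And>g g'. same_ball g g' R \<Longrightarrow> h g = h g'"
  shows "continuous_on UNIV h"
  unfolding continuous_on_iff
proof (intro ballI allI impI)
  fix g :: rgraph and \<epsilon> :: real assume "0 < \<epsilon>"
  show "\<exists>d>0. \<forall>g'\<in>UNIV. dist g' g < d \<longrightarrow> dist (h g') (h g) < \<epsilon>"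
  proof (intro exI[of _ "1 / (real R + 1)"] conjI ballI impI)
    fix g' assume d: "dist g' g < 1 / (real R + 1)"
    have "h g' = h g"
    proof (rule dist_rgraph_cases[of g' g])
      fix R' assume R': "dist g' g = 1 / (real R' + 1)" "\<And>r. same_ball g' g r \<longleftrightarrow> r \<le> R'"
      have "\<not> R' < R"
      proof
        assume "R' < R"
        then have "1 / (real R + 1) \<le> dist g' g" unfolding R'(1) by (intro divide_left_mono) auto
        then show False using d by simp
      qed
      then have "same_ball g' g R" using R'(2) by simp
      then show ?thesis by (rule assms)
    qed simp
    then show "dist (h g') (h g) < \<epsilon>" using \<open>0 < \<epsilon>\<close> by simp
  qed simp
qed

context weight_law
begin

text \<open>Two local isomorphisms are chained: from the chosen representative to the component, and
  from the component to \<open>G\<close>.\<close>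

lemma rooted_class_eq:
  fixes G :: "nat graph"
  assumes G: "wf_graph G" "locally_finite G" "v \<in> verts G" and f: "f \<in> borel_measurable borel"
  defines "c \<equiv> rooted_class G v"
  shows "root_degree (graph_of c) (root_of c) = root_degree G v"
    "root_corr F r (graph_of c) (root_of c) = root_corr F r G v"
    "root_value F f r (graph_of c) (root_of c) = root_value F f r G v"
proof -
  have C: "wf_graph (component G v)" "locally_finite (component G v)"
    using rooted_graph_component[OF G] by (simp_all add: rooted_graph_def)
  obtain \<phi> where \<phi>: "local_iso \<phi> (graph_of c) {root_of c} (component G v) {v} (Suc r)"
    unfolding c_def by (rule rooted_class_local_iso[OF G]) blast
  note 1 = local_iso_root[OF \<phi> wf_graph_of C(1) locally_finite_graph_of C(2) f]
  note 2 = local_iso_root[OF local_iso_component[OF G, of "Suc r"] C(1) G(1) C(2) G(2) f]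
  show "root_degree (graph_of c) (root_of c) = root_degree G v"
    "root_corr F r (graph_of c) (root_of c) = root_corr F r G v"
    "root_value F f r (graph_of c) (root_of c) = root_value F f r G v"
    by (simp_all only: 1[symmetric] 2)
qed

text \<open>Radius \<open>r\<close> around the edges at the root needs radius \<open>r + 2\<close>
  around the root: one step for passing from the root to an edge, one for seeing full
  neighbourhoods, including the boundary.\<close>

lemma same_ball_root:
  assumes "same_ball g g' (Suc (Suc r))" and f: "f \<in> borel_measurable borel"
  shows "root_degree (graph_of g) (root_of g) = root_degree (graph_of g') (root_of g')"
    "root_corr F r (graph_of g) (root_of g) = root_corr F r (graph_of g') (root_of g')"
    "root_value F f r (graph_of g) (root_of g) = root_value F f r (graph_of g') (root_of g')"
proof -
  obtain \<phi> where "ball_iso \<phi> (rep_rgraph g) (rep_rgraph g') (Suc (Suc r))"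
    using assms(1) unfolding same_ball_iff by blast
  from ball_iso_local_iso[OF rooted_graph_rep rooted_graph_rep this]
  have "local_iso \<phi> (graph_of g) {root_of g} (graph_of g') {root_of g'} (Suc r)"
    by (simp add: graph_of_def root_of_def)
  from local_iso_root[OF this wf_graph_of wf_graph_of locally_finite_graph_of locally_finite_graph_of f]
  show "root_degree (graph_of g) (root_of g) = root_degree (graph_of g') (root_of g')"
    "root_corr F r (graph_of g) (root_of g) = root_corr F r (graph_of g') (root_of g')"
    "root_value F f r (graph_of g) (root_of g) = root_value F f r (graph_of g') (root_of g')"
    by simp_all
qed

end

section \<open>The matching seen from a single vertex\<close>

text \<open>Two matching edges at \<open>v\<close> would share \<open>v\<close>, so at most one
  summand is nonzero and the bound does not involve the degree.\<close>

lemma sum_matched_bounds: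
  assumes M: "pairwise disjnt M" and fin: "finite (neighbours G v)"
    and f: "\<And>x. 0 \<le> f x" "\<And>x. f x \<le> (L :: real)"
  shows "0 \<le> (\<Sum>u\<in>neighbours G v. f (w {v, u}) * of_bool ({v, u} \<in> M))"
    "(\<Sum>u\<in>neighbours G v. f (w {v, u}) * of_bool ({v, u} \<in> M)) \<le> L"
proof -
  show "0 \<le> (\<Sum>u\<in>neighbours G v. f (w {v, u}) * of_bool ({v, u} \<in> M))"
    by (intro sum_nonneg mult_nonneg_nonneg f) simp
  show "(\<Sum>u\<in>neighbours G v. f (w {v, u}) * of_bool ({v, u} \<in> M)) \<le> L"
  proof (cases "\<exists>u\<in>neighbours G v. {v, u} \<in> M")
    case True
    then obtain u where u: "u \<in> neighbours G v" "{v, u} \<in> M" by blast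
    have "{v, u'} \<notin> M" if "u' \<noteq> u" for u'
    proof
      assume "{v, u'} \<in> M"
      moreover have "{v, u'} \<noteq> {v, u}" using that by (auto simp: doubleton_eq_iff)
      ultimately have "disjnt {v, u'} {v, u}" using u(2) by (intro pairwiseD[OF M])
      then show False by (simp add: disjnt_def)
    qed
    then have "(\<Sum>u'\<in>neighbours G v. f (w {v, u'}) * of_bool ({v, u'} \<in> M))
        = (\<Sum>u'\<in>{u}. f (w {v, u'}) * of_bool ({v, u'} \<in> M))"
      using u(1) fin by (intro sum.mono_neutral_right) auto
    also have "\<dots> \<le> L" using f by (simp add: u(2))
    finally show ?thesis .
  next
    case False
    then have "(\<Sum>u\<in>neighbours G v. f (w {v, u}) * of_bool ({v, u} \<in> M)) = 0"
      by (intro sum.neutral) auto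
    then show ?thesis using f[of undefined] by simp
  qed
qed

lemma sum_over_half_edges:
  fixes h :: "'a set \<Rightarrow> real"
  assumes wf: "wf_graph G" and fin: "finite (verts G)"
  shows "(\<Sum>v\<in>verts G. \<Sum>u\<in>neighbours G v. h {v, u}) = 2 * (\<Sum>e\<in>edges G. h e)"
proof -
  have inc: "(\<Sum>u\<in>neighbours G v. h {v, u}) = (\<Sum>e | e \<in> edges G \<and> v \<in> e. h e)" for v
  proof (rule sum.reindex_bij_betw)
    show "bij_betw (\<lambda>u. {v, u}) (neighbours G v) {e \<in> edges G. v \<in> e}"
      unfolding bij_betw_def
    proof
      show "inj_on (\<lambda>u. {v, u}) (neighbours G v)" by (auto simp: inj_on_def doubleton_eq_iff)
      show "(\<lambda>u. {v, u}) ` neighbours G v = {e \<in> edges G. v \<in> e}"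
      proof (intro subset_antisym subsetI)
        fix e assume e: "e \<in> {e \<in> edges G. v \<in> e}"
        then obtain a b where ab: "e = {a, b}" using wf unfolding wf_graph_def by blast
        then have "e = {v, a} \<or> e = {v, b}" using e by auto
        then show "e \<in> (\<lambda>u. {v, u}) ` neighbours G v"
          using e by (auto simp: neighbours_def adj_def)
      qed (auto simp: neighbours_def adj_def)
    qed
  qed
  have two: "card {v \<in> verts G. v \<in> e} = 2" if e: "e \<in> edges G" for e
  proof -
    obtain a b where ab: "e = {a, b}" "a \<noteq> b" "a \<in> verts G" "b \<in> verts G"
      using wf[unfolded wf_graph_def, rule_format, OF e] by blast
    then have "{v \<in> verts G. v \<in> e} = {a, b}" by auto
    then show ?thesis using ab(2) by simp
  qed
  have "(\<Sum>v\<in>verts G. \<Sum>u\<in>neighbours G v. h {v, u}) = (\<Sum>e\<in>edges G. \<Sum>v | v \<in> verts G \<and> v \<in> e. h e)"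
    unfolding inc by (rule sum.swap_restrict[OF fin finite_edges[OF wf fin]])
  also have "\<dots> = (\<Sum>e\<in>edges G. 2 * h e)"
    by (intro sum.cong refl) (simp add: two)
  finally show ?thesis by (simp add: sum_distrib_left)
qed

text \<open>A sum of integrals, so that it can be compared edge by edge with
  \<open>root_value\<close>. The bound by \<open>L\<close> needs the integral of the sum instead,
  which is the same by \<open>matched_value_integral\<close>.\<close>

definition matched_value ::
    "real measure \<Rightarrow> (real \<Rightarrow> real) \<Rightarrow> (nat \<Rightarrow> 'a graph) \<Rightarrow> 'a graph \<Rightarrow> 'a \<Rightarrow> real" where
  "matched_value F f H G v =
     (\<Sum>u\<in>neighbours G v. \<integral>w. f (w {v, u}) * of_bool ({v, u} \<in> mwm_along H G w) \<partial>edge_weights F G)"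

lemma locally_finite_finite: "wf_graph G \<Longrightarrow> finite (verts G) \<Longrightarrow> locally_finite G"
  by (simp add: locally_finite_def finite_subset[OF neighbours_verts])

lemma edge_of_neighbour: "u \<in> neighbours G v \<Longrightarrow> {v, u} \<in> edges G"
  by (simp add: neighbours_def adj_def)

context weight_law
begin

lemma integrable_matched:
  fixes f :: "real \<Rightarrow> real"
  assumes G: "wf_graph G" and e: "e \<in> edges G" and H: "infinite (verts G) \<Longrightarrow> exhaustion H G"
    and f: "f \<in> borel_measurable borel" "\<And>x. 0 \<le> f x" "\<And>x. f x \<le> L"
  shows "integrable (iid (edges G)) (\<lambda>w. f (w e) * of_bool (e \<in> mwm_along H G w))"
proof -
  interpret M: prob_space "iid (edges G)" by (rule prob_space_iid)
  have "\<bar>f x * of_bool Q\<bar> \<le> L" for x Q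
    using f(2,3)[of x] order_trans[OF f(2,3)] by (cases Q) auto
  then show ?thesis
    by (intro M.integrable_const_bound[where B = L] measurable_weight_of_bool
        measurable_mwm_along G H f e) auto
qed

lemma ball_value_bounds:
  assumes G: "wf_graph G" "locally_finite G"
    and f: "f \<in> borel_measurable borel" "\<And>x. 0 \<le> f x" "\<And>x. f x \<le> (L :: real)"
    and e: "e \<in> edges G"
  shows "0 \<le> ball_value F f G e r" "ball_value F f G e r \<le> L"
proof -
  interpret M: prob_space "iid (edges G)" by (rule prob_space_iid)
  have b: "0 \<le> f x * of_bool Q" "f x * of_bool Q \<le> L" for x Q
    using f(2,3)[of x] order_trans[OF f(2,3)] by (cases Q; auto)+
  have "integrable (iid (edges G)) (\<lambda>w. f (w e) * of_bool (e \<in> mwm (ball_graph G e r) w))"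
    using b by (intro M.integrable_const_bound[where B = L] measurable_weight_of_bool
        measurable_mwm_ball G f e) (auto simp: edges_ball_graph)
  then show "ball_value F f G e r \<le> L"
    unfolding ball_value_def edge_weights_def by (intro M.integral_le_const AE_I2 b)
  show "0 \<le> ball_value F f G e r"
    unfolding ball_value_def edge_weights_def by (intro integral_nonneg_AE AE_I2 b)
qed

lemma corr_bounds:
  assumes G: "wf_graph G" "locally_finite G" and e: "e \<in> edges G"
  shows "0 \<le> corr F G e r" "corr F G e r \<le> 1"
proof -
  interpret M: prob_space "iid (edges G)" by (rule prob_space_iid)
  have "integrable (iid (edges G)) (sensitivity G e r)"
    by (rule M.integrable_const_bound[where B = 1, OF _ measurable_sensitivity[OF G e]])
      (simp_all add: sensitivity_nonneg sensitivity_le_1 edges_ball_graph)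
  then show "corr F G e r \<le> 1"
    unfolding corr_sensitivity edge_weights_def by (intro M.integral_le_const AE_I2 sensitivity_le_1)
  show "0 \<le> corr F G e r"
    unfolding corr_sensitivity by (intro integral_nonneg_AE AE_I2 sensitivity_nonneg)
qed

lemma root_value_bounds:
  assumes G: "wf_graph G" "locally_finite G"
    and f: "f \<in> borel_measurable borel" "\<And>x. 0 \<le> f x" "\<And>x. f x \<le> (L :: real)"
  shows "0 \<le> root_value F f r G v" "root_value F f r G v \<le> real (root_degree G v) * L"
  unfolding root_value_def root_degree_def
  by (intro sum_nonneg ball_value_bounds[OF G f] edge_of_neighbour, assumption)
    (intro sum_bounded_above ball_value_bounds[OF G f] edge_of_neighbour, assumption)

lemma root_corr_bounds:
  assumes G: "wf_graph G" "locally_finite G"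
  shows "0 \<le> root_corr F r G v" "root_corr F r G v \<le> real (root_degree G v)"
  unfolding root_corr_def root_degree_def
  using sum_bounded_above[of "neighbours G v" "\<lambda>u. corr F G {v, u} r" 1]
  by (auto intro!: sum_nonneg corr_bounds[OF G] edge_of_neighbour)

context
  fixes G :: "'a :: countable graph" and H and f :: "real \<Rightarrow> real" and L
  assumes G: "wf_graph G" "locally_finite G"
    and H: "infinite (verts G) \<Longrightarrow> exhaustion H G"
    and f: "f \<in> borel_measurable borel" "\<And>x. 0 \<le> f x" "\<And>x. f x \<le> (L :: real)"
begin

lemma matched_sum_bounds:
  assumes "finite (neighbours G v)"
  shows "0 \<le> (\<Sum>u\<in>neighbours G v. f (w {v, u}) * of_bool ({v, u} \<in> mwm_along H G w))"
    "(\<Sum>u\<in>neighbours G v. f (w {v, u}) * of_bool ({v, u} \<in> mwm_along H G w)) \<le> L"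
proof -
  have "pairwise disjnt (mwm_along H G w)"
    by (rule mwm_along_disjoint) (auto intro: finite_edges G exhaustion_finite_edges[OF H])
  note sum_matched_bounds[OF this assms, of f L w, OF f(2,3)]
  then show "0 \<le> (\<Sum>u\<in>neighbours G v. f (w {v, u}) * of_bool ({v, u} \<in> mwm_along H G w))"
    "(\<Sum>u\<in>neighbours G v. f (w {v, u}) * of_bool ({v, u} \<in> mwm_along H G w)) \<le> L"
    by simp_all
qed

lemma matched_value_integral:
  "matched_value F f H G v =
    (\<integral>w. (\<Sum>u\<in>neighbours G v. f (w {v, u}) * of_bool ({v, u} \<in> mwm_along H G w)) \<partial>edge_weights F G)"
  unfolding matched_value_def edge_weights_def
  by (intro Bochner_Integration.integral_sum[symmetric] integrable_matched[where L = L] G(1) H f)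
    (simp add: neighbours_def adj_def)

lemma integrable_matched_sum:
  "integrable (edge_weights F G)
    (\<lambda>w. \<Sum>u\<in>neighbours G v. f (w {v, u}) * of_bool ({v, u} \<in> mwm_along H G w))"
  unfolding edge_weights_def
  by (intro Bochner_Integration.integrable_sum integrable_matched[where L = L] G(1) H f)
    (simp add: neighbours_def adj_def)

lemma nn_integral_matched_sum:
  assumes "finite (neighbours G v)"
  shows "(\<integral>\<^sup>+w. ennreal (\<Sum>u\<in>neighbours G v. f (w {v, u}) * of_bool ({v, u} \<in> mwm_along H G w)) \<partial>edge_weights F G)
    = ennreal (matched_value F f H G v)"
  unfolding matched_value_integral
  by (rule nn_integral_eq_integral[OF integrable_matched_sum AE_I2]) (rule matched_sum_bounds[OF assms])

lemma matched_value_bounds: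
  assumes "finite (neighbours G v)"
  shows "0 \<le> matched_value F f H G v" "matched_value F f H G v \<le> L"
proof -
  interpret M: prob_space "edge_weights F G" unfolding edge_weights_def by (rule prob_space_iid)
  show "0 \<le> matched_value F f H G v"
    unfolding matched_value_integral by (intro integral_nonneg_AE AE_I2 matched_sum_bounds assms)
  show "matched_value F f H G v \<le> L"
    unfolding matched_value_integral
    by (intro M.integral_le_const integrable_matched_sum AE_I2 matched_sum_bounds assms)
qed

lemma matched_value_approx:
  "\<bar>matched_value F f H G v - root_value F f r G v\<bar> \<le> L * root_corr F r G v"
proof -
  have "\<bar>matched_value F f H G v - root_value F f r G v\<bar> \<le>
    (\<Sum>u\<in>neighbours G v. \<bar>(\<integral>w. f (w {v, u}) * of_bool ({v, u} \<in> mwm_along H G w) \<partial>edge_weights F G)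
      - ball_value F f G {v, u} r\<bar>)"
    unfolding matched_value_def root_value_def sum_subtractf[symmetric] by (rule sum_abs)
  also have "\<dots> \<le> (\<Sum>u\<in>neighbours G v. L * corr F G {v, u} r)"
    by (intro sum_mono integral_approx G edge_of_neighbour f measurable_mwm_along H mwm_along_approx)
  finally show ?thesis by (simp add: root_corr_def sum_distrib_left)
qed

text \<open>On a finite graph \<open>mwm_along\<close> is \<open>mwm\<close>, and each matching edge
  is seen from both its ends. The values are nonnegative and integrable, so Bochner integrals, for
  which sums and integrals are exchanged, convert back to the extended ones.\<close>

lemma nn_integral_mwm_sum:
  assumes fin: "finite (verts G)"
  shows "(\<integral>\<^sup>+w. ennreal ((\<Sum>e\<in>mwm G w. f (w e)) / real (card (verts G))) \<partial>edge_weights F G)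
    = 1 / 2 * ennreal ((\<Sum>v\<in>verts G. matched_value F f H G v) / real (card (verts G)))"
proof -
  let ?S = "\<lambda>v w. \<Sum>u\<in>neighbours G v. f (w {v, u}) * of_bool ({v, u} \<in> mwm_along H G w)"
  let ?c = "real (card (verts G))"
  have E: "finite (edges G)" by (rule finite_edges[OF G(1) fin])
  have finN: "finite (neighbours G v)" for v
    using neighbours_verts[OF G(1)] fin by (rule finite_subset)
  have eq: "(\<Sum>e\<in>mwm G w. f (w e)) = (\<Sum>v\<in>verts G. ?S v w) / 2" for w
  proof -
    have "(\<Sum>e\<in>mwm G w. f (w e)) = (\<Sum>e\<in>edges G. f (w e) * of_bool (e \<in> mwm G w))"
      using mwm_subset[OF E, of w] E by (intro sum.mono_neutral_cong_left) auto
    then show ?thesis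
      using sum_over_half_edges[OF G(1) fin, of "\<lambda>e. f (w e) * of_bool (e \<in> mwm G w)"] fin
      by (simp add: mwm_along_def)
  qed
  have "(\<integral>\<^sup>+w. ennreal ((\<Sum>v\<in>verts G. ?S v w) / 2 / ?c) \<partial>edge_weights F G)
      = ennreal (\<integral>w. (\<Sum>v\<in>verts G. ?S v w) / 2 / ?c \<partial>edge_weights F G)"
    by (intro nn_integral_eq_integral AE_I2 divide_nonneg_nonneg sum_nonneg matched_sum_bounds finN
        integrable_divide Bochner_Integration.integrable_sum integrable_matched_sum) auto
  also have "(\<integral>w. (\<Sum>v\<in>verts G. ?S v w) / 2 / ?c \<partial>edge_weights F G)
      = (\<Sum>v\<in>verts G. matched_value F f H G v) / 2 / ?c"
    by (simp add: matched_value_integral integrable_matched_sum Bochner_Integration.integral_sum)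
  also have "ennreal \<dots> = 1 / 2 * ennreal ((\<Sum>v\<in>verts G. matched_value F f H G v) / ?c)"
  proof -
    have "0 \<le> (\<Sum>v\<in>verts G. matched_value F f H G v) / ?c"
      by (intro divide_nonneg_nonneg sum_nonneg matched_value_bounds finN) simp
    then have "ennreal (1/2 * ((\<Sum>v\<in>verts G. matched_value F f H G v) / ?c))
      = ennreal (1/2) * ennreal ((\<Sum>v\<in>verts G. matched_value F f H G v) / ?c)"
      by (intro ennreal_mult) auto
    then show ?thesis by (simp add: divide_ennreal_def flip: ennreal_numeral inverse_ennreal)
  qed
  finally show ?thesis unfolding eq .
qed

end

end

section \<open>Two criteria for interchanging limits\<close>

text \<open>\<open>b\<close> and \<open>d\<close> may depend on the tolerance: they will be
  expectations of functions of a finite ball, whose limits are supplied by weak convergence. Three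
  errors are added: \<open>u\<close> to \<open>b\<close>, \<open>b\<close> to \<open>b'\<close>, and
  \<open>b'\<close> to \<open>a\<close>.\<close>

lemma tendsto_by_approx:
  fixes u :: "nat \<Rightarrow> real"
  assumes "\<And>\<epsilon>. \<epsilon> > 0 \<Longrightarrow> \<exists>b d b' d'. (\<forall>n. \<bar>u n - b n\<bar> \<le> d n) \<and> b \<longlonglongrightarrow> b' \<and> d \<longlonglongrightarrow> d' \<and> d' < \<epsilon> \<and> \<bar>b' - a\<bar> < \<epsilon>"
  shows "u \<longlonglongrightarrow> a"
proof (rule tendstoI)
  fix \<epsilon> :: real assume "0 < \<epsilon>"
  then obtain b d b' d' where *: "\<forall>n. \<bar>u n - b n\<bar> \<le> d n" "b \<longlonglongrightarrow> b'" "d \<longlonglongrightarrow> d'" "d' < \<epsilon> / 3" "\<bar>b' - a\<bar> < \<epsilon> / 3"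
    using assms[of "\<epsilon> / 3"] by auto
  have "\<forall>\<^sub>F n in sequentially. d n < \<epsilon> / 3" using *(3,4) by (rule order_tendstoD)
  moreover have "\<forall>\<^sub>F n in sequentially. dist (b n) b' < \<epsilon> / 3"
    using \<open>0 < \<epsilon>\<close> by (intro tendstoD[OF *(2)]) simp
  ultimately show "\<forall>\<^sub>F n in sequentially. dist (u n) a < \<epsilon>"
  proof eventually_elim
    case (elim n)
    have "\<bar>u n - b n\<bar> \<le> d n" using *(1) by blast
    then show ?case using elim *(5) unfolding dist_real_def by linarith
  qed
qed

text \<open>The error \<open>d k\<close> is uniform in \<open>n\<close>, so \<open>n\<close> tends
  to infinity before \<open>k\<close>. Working with lower and upper limits avoids subtraction and
  allows an infinite limit.\<close>

lemma tendsto_ennreal_sandwich: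
  fixes u c :: "nat \<Rightarrow> ennreal"
  assumes lo: "\<And>k n. a k n \<le> u n" and up: "\<And>k n. u n \<le> a k n + d k"
    and a: "\<And>k. a k \<longlonglongrightarrow> b k" and b: "b \<longlonglongrightarrow> x" and d: "d \<longlonglongrightarrow> 0"
  shows "u \<longlonglongrightarrow> x"
proof -
  have "b k \<le> liminf u" for k
    using lim_imp_Liminf[OF _ a[of k]] Liminf_mono[of "a k" u sequentially] lo by simp
  then have 1: "x \<le> liminf u" by (intro LIMSEQ_le_const2[OF b]) auto
  have "limsup u \<le> b k + d k" for k
  proof -
    have "(\<lambda>n. a k n + d k) \<longlonglongrightarrow> b k + d k" by (intro tendsto_add a tendsto_const)
    then have "limsup (\<lambda>n. a k n + d k) = b k + d k" by (intro lim_imp_Limsup) auto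
    then show ?thesis using Limsup_mono[of u "\<lambda>n. a k n + d k" sequentially] up by simp
  qed
  moreover have "(\<lambda>k. b k + d k) \<longlonglongrightarrow> x + 0" by (intro tendsto_add b d)
  ultimately have 2: "limsup u \<le> x" by (intro LIMSEQ_le_const[of "\<lambda>k. b k + d k"]) auto
  show ?thesis
  proof (rule Liminf_eq_Limsup)
    have "liminf u \<le> limsup u" by (rule Liminf_le_Limsup) simp
    then show "liminf u = x" "limsup u = x" using 1 2 by simp_all
  qed simp
qed

section \<open>Passing to the local limit\<close>

text \<open>Keeps the labelled graph, in which the matching is computed, whereas
  \<open>uniform_rooting\<close> retains only the class of the component of the root.\<close>

definition random_root :: "nat graph pmf \<Rightarrow> (nat graph \<times> nat) pmf" where
  "random_root P = bind_pmf P (\<lambda>G. map_pmf (Pair G) (pmf_of_set (verts G)))"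

lemma uniform_rooting_random_root:
  "uniform_rooting P = map_pmf (\<lambda>(G, v). rooted_class G v) (random_root P)"
  by (simp add: uniform_rooting_def random_root_def map_bind_pmf pmf.map_comp comp_def)

locale local_limit = weight_law F for F :: "real measure" +
  fixes P :: "nat \<Rightarrow> nat graph pmf"
    and \<mu> :: "rgraph measure"
    and H :: "nat graph \<Rightarrow> nat \<Rightarrow> nat graph"
  assumes finite_graphs:
      "\<And>n G. G \<in> set_pmf (P n) \<Longrightarrow> wf_graph G \<and> finite (verts G) \<and> verts G \<noteq> {}"
    and law: "prob_space \<mu>" "sets \<mu> = sets borel"
    and convergence: "local_weak_conv P \<mu>"
    and decay: "AE g in \<mu>. correlation_decay F (graph_of g)"
    and exhaust: "\<And>G. wf_graph G \<Longrightarrow> locally_finite G \<Longrightarrow> graph_connected G \<Longrightarrow> infinite (verts G) \<Longrightarrow>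
      exhaustion (H G) G"
begin

sublocale limit: prob_space \<mu> by (rule law(1))

abbreviation "degree_of g \<equiv> root_degree (graph_of g) (root_of g)"
abbreviation "value_of f r g \<equiv> root_value F f r (graph_of g) (root_of g)"
abbreviation "corr_of r g \<equiv> root_corr F r (graph_of g) (root_of g)"

text \<open>Local weak convergence only tests bounded functions, hence the cut-off of the root degree at \<open>K\<close>.\<close>

definition cut_value :: "(real \<Rightarrow> real) \<Rightarrow> nat \<Rightarrow> nat \<Rightarrow> rgraph \<Rightarrow> real" where
  "cut_value f K r g = of_bool (degree_of g \<le> K) * value_of f r g"

text \<open>Bounds the distance from \<open>matched_value\<close> to \<open>cut_value\<close>. Up to
  degree \<open>K\<close> it is the correlation estimate; above \<open>K\<close> the cut value is 0,
  while the matched value lies between 0 and \<open>L\<close>.\<close>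

definition cut_error :: "real \<Rightarrow> nat \<Rightarrow> nat \<Rightarrow> rgraph \<Rightarrow> real" where
  "cut_error L K r g = L * (of_bool (degree_of g \<le> K) * corr_of r g + of_bool (\<not> degree_of g \<le> K))"

lemma set_random_rootD:
  assumes "(G, v) \<in> set_pmf (random_root (P n))"
  shows "wf_graph G" "finite (verts G)" "v \<in> verts G"
  using assms finite_graphs[of _ n] by (auto simp: random_root_def)

lemma exhaust_graph_of: "infinite (verts (graph_of g)) \<Longrightarrow> exhaustion (H (graph_of g)) (graph_of g)"
  by (intro exhaust wf_graph_of locally_finite_graph_of graph_connected_graph_of)

lemma finite_neighbours_root: "finite (neighbours (graph_of g) (root_of g))"
  using locally_finite_graph_of[of g] root_of_verts[of g] by (simp add: locally_finite_def)

lemma borel_of_same_ball: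
  fixes h :: "rgraph \<Rightarrow> real"
  assumes "\<And>g g'. same_ball g g' R \<Longrightarrow> h g = h g'"
  shows "h \<in> borel_measurable \<mu>"
proof -
  have "continuous_on UNIV h" by (rule continuous_on_same_ball) (rule assms)
  then show ?thesis
    unfolding measurable_cong_sets[OF law(2) refl] by (rule borel_measurable_continuous_onI)
qed

lemma convergence_of_same_ball:
  fixes h :: "rgraph \<Rightarrow> real"
  assumes ball: "\<And>g g'. same_ball g g' R \<Longrightarrow> h g = h g'" and bound: "\<And>g. \<bar>h g\<bar> \<le> B"
  shows "(\<lambda>n. \<integral>x. h (rooted_class (fst x) (snd x)) \<partial>measure_pmf (random_root (P n)))
    \<longlonglongrightarrow> (\<integral>g. h g \<partial>\<mu>)"
proof -
  have c: "continuous_on UNIV h" by (rule continuous_on_same_ball) (rule ball)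
  have "bounded (range h)" using bound by (intro boundedI[of _ B]) auto
  then have "(\<lambda>n. \<integral>g. h g \<partial>measure_pmf (uniform_rooting (P n))) \<longlonglongrightarrow> (\<integral>g. h g \<partial>\<mu>)"
    using convergence c unfolding local_weak_conv_def by blast
  then show ?thesis by (simp add: uniform_rooting_random_root case_prod_unfold)
qed

lemma measurable_degree_of: "(\<lambda>g. of_bool (R (degree_of g)) :: real) \<in> borel_measurable \<mu>"
proof (rule borel_of_same_ball)
  fix g g' assume "same_ball g g' (Suc (Suc 0))"
  \<comment> \<open>The degree depends neither on the radius parameter nor on the function, so 0 and
    the zero function serve as dummies.\<close>
  then show "(of_bool (R (degree_of g)) :: real) = of_bool (R (degree_of g'))"
    using same_ball_root(1)[of g g' 0 "\<lambda>_. 0"] by simp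
qed

context
  fixes f :: "real \<Rightarrow> real" and L :: real
  assumes f: "f \<in> borel_measurable borel" "\<And>x. 0 \<le> f x" "\<And>x. f x \<le> L"
begin

lemma L_nonneg: "0 \<le> L"
  using order_trans[OF f(2) f(3)] by blast

lemma cut_value_same_ball: "same_ball g g' (Suc (Suc r)) \<Longrightarrow> cut_value f K r g = cut_value f K r g'"
  using same_ball_root[of g g' r f, OF _ f(1)] by (simp add: cut_value_def)

lemma cut_error_same_ball: "same_ball g g' (Suc (Suc r)) \<Longrightarrow> cut_error L K r g = cut_error L K r g'"
  using same_ball_root[of g g' r f, OF _ f(1)] by (simp add: cut_error_def)

lemma cut_value_bound: "\<bar>cut_value f K r g\<bar> \<le> real K * L"
proof -
  have "0 \<le> value_of f r g" "value_of f r g \<le> real (degree_of g) * L"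
    by (intro root_value_bounds[OF wf_graph_of locally_finite_graph_of f])+
  moreover have "real (degree_of g) * L \<le> real K * L" if "degree_of g \<le> K"
    using that L_nonneg by (intro mult_right_mono) auto
  ultimately show ?thesis using L_nonneg by (auto simp: cut_value_def)
qed

lemma corr_of_bounds: "0 \<le> corr_of r g" "corr_of r g \<le> real (degree_of g)"
  by (intro root_corr_bounds[OF wf_graph_of locally_finite_graph_of])+

lemma cut_error_bound: "\<bar>cut_error L K r g\<bar> \<le> L * (real K + 1)"
proof -
  have "\<bar>of_bool (degree_of g \<le> K) * corr_of r g + of_bool (\<not> degree_of g \<le> K)\<bar> \<le> real K + 1"
    using corr_of_bounds[of r g] by auto
  then show ?thesis using L_nonneg by (simp add: cut_error_def abs_mult mult_left_mono)
qed

lemma matched_value_cut: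
  assumes G: "wf_graph G" "finite (verts G)" "v \<in> verts G"
  shows "\<bar>matched_value F f (H G) G v - cut_value f K r (rooted_class G v)\<bar> \<le> cut_error L K r (rooted_class G v)"
proof -
  have lf: "locally_finite G" using G by (intro locally_finite_finite)
  have fin: "finite (neighbours G v)" using lf G(3) by (simp add: locally_finite_def)
  have H: "infinite (verts G) \<Longrightarrow> exhaustion (H G) G" using G(2) by simp
  note c = rooted_class_eq[OF G(1) lf G(3) f(1)]
  show ?thesis
  proof (cases "root_degree G v \<le> K")
    case True
    then show ?thesis
      using matched_value_approx[OF G(1) lf H f, of v r] by (simp add: cut_value_def cut_error_def c)
  next
    case False
    then show ?thesis
      using matched_value_bounds[OF G(1) lf H f fin] by (simp add: cut_value_def cut_error_def c)
  qed
qed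

text \<open>A limit of functions of finite balls is measurable and makes no reference to
  \<open>H\<close>. Under correlation decay it coincides with the matched value of the
  representative, for every choice of exhaustions.\<close>

definition limit_value :: "rgraph \<Rightarrow> real" where
  "limit_value g = lim (\<lambda>r. value_of f r g)"

lemma measurable_value_of: "value_of f r \<in> borel_measurable \<mu>"
  using same_ball_root(3)[of _ _ r f, OF _ f(1)] by (intro borel_of_same_ball[of "Suc (Suc r)"]) simp

lemma measurable_limit_value: "limit_value \<in> borel_measurable \<mu>"
  unfolding limit_value_def by (intro borel_measurable_lim_metric measurable_value_of)

lemma decay_limits:
  assumes "correlation_decay F (graph_of g)"
  shows "(\<lambda>r. corr_of r g) \<longlonglongrightarrow> 0" "(\<lambda>r. value_of f r g) \<longlonglongrightarrow> limit_value g"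
    "limit_value g = matched_value F f (H (graph_of g)) (graph_of g) (root_of g)"
proof -
  let ?m = "matched_value F f (H (graph_of g)) (graph_of g) (root_of g)"
  have "(\<lambda>r. \<Sum>u\<in>neighbours (graph_of g) (root_of g). corr F (graph_of g) {root_of g, u} r)
      \<longlonglongrightarrow> (\<Sum>u\<in>neighbours (graph_of g) (root_of g). 0)"
    using assms by (intro tendsto_sum) (simp add: correlation_decay_def neighbours_def adj_def)
  then show corr0: "(\<lambda>r. corr_of r g) \<longlonglongrightarrow> 0" by (simp add: root_corr_def)
  have "(\<lambda>r. ?m - value_of f r g) \<longlonglongrightarrow> 0"
  proof (rule Lim_null_comparison)
    show "\<forall>\<^sub>F r in sequentially. norm (?m - value_of f r g) \<le> L * corr_of r g"
      using matched_value_approx[OF wf_graph_of locally_finite_graph_of exhaust_graph_of f, of g "root_of g"]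
      by simp
    show "(\<lambda>r. L * corr_of r g) \<longlonglongrightarrow> 0" using tendsto_mult_right_zero[OF corr0, of L] .
  qed
  then have "(\<lambda>r. ?m - (?m - value_of f r g)) \<longlonglongrightarrow> ?m - 0" by (intro tendsto_diff tendsto_const)
  then have m: "(\<lambda>r. value_of f r g) \<longlonglongrightarrow> ?m" by simp
  show eq: "limit_value g = ?m" unfolding limit_value_def by (rule limI[OF m])
  show "(\<lambda>r. value_of f r g) \<longlonglongrightarrow> limit_value g" using m by (simp add: eq)
qed

lemma AE_limit_value:
  "AE g in \<mu>. (\<lambda>r. corr_of r g) \<longlonglongrightarrow> 0 \<and> (\<lambda>r. value_of f r g) \<longlonglongrightarrow> limit_value g \<and>
    limit_value g = matched_value F f (H (graph_of g)) (graph_of g) (root_of g) \<and>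
    0 \<le> limit_value g \<and> limit_value g \<le> L"
  using decay
proof eventually_elim
  case (elim g)
  note matched_value_bounds[OF wf_graph_of locally_finite_graph_of exhaust_graph_of f finite_neighbours_root]
  with decay_limits[OF elim] show ?case by simp
qed

lemma expectation_tendsto:
  "(\<lambda>n. \<integral>x. matched_value F f (H (fst x)) (fst x) (snd x) \<partial>measure_pmf (random_root (P n)))
    \<longlonglongrightarrow> (\<integral>g. limit_value g \<partial>\<mu>)"
proof (rule tendsto_by_approx)
  fix \<epsilon> :: real assume \<epsilon>: "\<epsilon> > 0"
  note meas = measurable_limit_value borel_measurable_times borel_measurable_const measurable_degree_of
  \<comment> \<open>For fixed \<open>K\<close>, these are the limits of the expected cut value and
    cut error as the radius grows: the correlation term vanishes and the degree tail
    remains.\<close>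
  let ?A = "\<lambda>K. \<integral>g. of_bool (degree_of g \<le> K) * limit_value g \<partial>\<mu>"
  let ?D = "\<lambda>K. \<integral>g. L * of_bool (\<not> degree_of g \<le> K) \<partial>\<mu>"
  have evK: "(\<lambda>K. of_bool (degree_of g \<le> K) :: real) \<longlonglongrightarrow> 1" for g
    using eventually_ge_at_top[of "degree_of g"] by (intro tendsto_eventually) (auto elim: eventually_mono)
  have evK': "(\<lambda>K. of_bool (\<not> degree_of g \<le> K) :: real) \<longlonglongrightarrow> 0" for g
    using eventually_ge_at_top[of "degree_of g"] by (intro tendsto_eventually) (auto elim: eventually_mono)
  have A: "?A \<longlonglongrightarrow> (\<integral>g. limit_value g \<partial>\<mu>)"
  proof (rule integral_dominated_convergence[where w = "\<lambda>_. L"])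
    show "AE g in \<mu>. (\<lambda>K. of_bool (degree_of g \<le> K) * limit_value g) \<longlonglongrightarrow> limit_value g"
      using tendsto_mult[OF evK tendsto_const] by (intro AE_I2) simp
    show "AE g in \<mu>. norm (of_bool (degree_of g \<le> K) * limit_value g) \<le> L" for K
      using AE_limit_value by eventually_elim (use L_nonneg in auto)
  qed (intro meas limit.integrable_const)+
  have D: "?D \<longlonglongrightarrow> (\<integral>g. 0 \<partial>\<mu>)"
  proof (rule integral_dominated_convergence[where w = "\<lambda>_. L"])
    show "AE g in \<mu>. (\<lambda>K. L * of_bool (\<not> degree_of g \<le> K)) \<longlonglongrightarrow> 0"
      using tendsto_mult_right_zero[OF evK'] by (intro AE_I2) simp
    show "AE g in \<mu>. norm (L * of_bool (\<not> degree_of g \<le> K)) \<le> L" for K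
      using L_nonneg by (intro AE_I2) auto
  qed (intro meas limit.integrable_const)+
  have "\<forall>\<^sub>F K in sequentially. dist (?A K) (\<integral>g. limit_value g \<partial>\<mu>) < \<epsilon> / 2 \<and> ?D K < \<epsilon> / 2"
    using \<epsilon> D by (intro eventually_conj tendstoD[OF A] order_tendstoD(2)[OF D]) simp_all
  then obtain K where K: "\<bar>?A K - (\<integral>g. limit_value g \<partial>\<mu>)\<bar> < \<epsilon> / 2" "?D K < \<epsilon> / 2"
    unfolding dist_real_def using eventually_happens'[OF sequentially_bot] by blast
  \<comment> \<open>With \<open>K\<close> fixed, the cut-off supplies the dominating constants
    \<open>real K * L\<close> here and \<open>L * (real K + 1)\<close> below, independently of the
    radius.\<close>
  have Ar: "(\<lambda>r. \<integral>g. cut_value f K r g \<partial>\<mu>) \<longlonglongrightarrow> ?A K"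
  proof (rule integral_dominated_convergence[where w = "\<lambda>_. real K * L"])
    show "AE g in \<mu>. (\<lambda>r. cut_value f K r g) \<longlonglongrightarrow> of_bool (degree_of g \<le> K) * limit_value g"
      using AE_limit_value unfolding cut_value_def
      by eventually_elim (intro tendsto_mult tendsto_const, blast)
    show "AE g in \<mu>. norm (cut_value f K r g) \<le> real K * L" for r
      using cut_value_bound by (intro AE_I2) simp
    show "cut_value f K r \<in> borel_measurable \<mu>" for r
      by (rule borel_of_same_ball, rule cut_value_same_ball)
  qed (intro meas limit.integrable_const)+
  have Dr: "(\<lambda>r. \<integral>g. cut_error L K r g \<partial>\<mu>) \<longlonglongrightarrow> ?D K"
  proof (rule integral_dominated_convergence[where w = "\<lambda>_. L * (real K + 1)"])
    show "AE g in \<mu>. (\<lambda>r. cut_error L K r g) \<longlonglongrightarrow> L * of_bool (\<not> degree_of g \<le> K)"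
      using AE_limit_value
    proof eventually_elim
      case (elim g)
      then have "(\<lambda>r. cut_error L K r g) \<longlonglongrightarrow>
          L * (of_bool (degree_of g \<le> K) * 0 + of_bool (\<not> degree_of g \<le> K))"
        unfolding cut_error_def by (intro tendsto_mult tendsto_add tendsto_const) simp
      then show ?case by simp
    qed
    show "AE g in \<mu>. norm (cut_error L K r g) \<le> L * (real K + 1)" for r
      using cut_error_bound by (intro AE_I2) simp
    show "cut_error L K r \<in> borel_measurable \<mu>" for r
      by (rule borel_of_same_ball, rule cut_error_same_ball)
  qed (intro meas limit.integrable_const)+
  have "\<forall>\<^sub>F r in sequentially. dist (\<integral>g. cut_value f K r g \<partial>\<mu>) (?A K) < \<epsilon> / 2 \<and>
      dist (\<integral>g. cut_error L K r g \<partial>\<mu>) (?D K) < \<epsilon> / 2"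
    using \<epsilon> by (intro eventually_conj tendstoD[OF Ar] tendstoD[OF Dr]) simp_all
  then obtain r where r: "\<bar>(\<integral>g. cut_value f K r g \<partial>\<mu>) - ?A K\<bar> < \<epsilon> / 2"
    "\<bar>(\<integral>g. cut_error L K r g \<partial>\<mu>) - ?D K\<bar> < \<epsilon> / 2"
    unfolding dist_real_def using eventually_happens'[OF sequentially_bot] by blast
  let ?Q = "\<lambda>n. measure_pmf (random_root (P n))"
  have approx: "\<bar>(\<integral>x. matched_value F f (H (fst x)) (fst x) (snd x) \<partial>?Q n)
      - (\<integral>x. cut_value f K r (rooted_class (fst x) (snd x)) \<partial>?Q n)\<bar>
      \<le> (\<integral>x. cut_error L K r (rooted_class (fst x) (snd x)) \<partial>?Q n)" for n
  proof -
    have wf: "wf_graph (fst x)" "finite (verts (fst x))" "snd x \<in> verts (fst x)"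
      if "x \<in> set_pmf (random_root (P n))" for x
      using set_random_rootD[of "fst x" "snd x" n] that by simp_all
    have fin: "finite (neighbours (fst x) (snd x))" if "x \<in> set_pmf (random_root (P n))" for x
      using neighbours_verts[OF wf(1)[OF that]] wf(2)[OF that] by (rule finite_subset)
    have i1: "integrable (?Q n) (\<lambda>x. matched_value F f (H (fst x)) (fst x) (snd x))"
    proof (rule measure_pmf.integrable_const_bound[where B = L])
      show "AE x in ?Q n. norm (matched_value F f (H (fst x)) (fst x) (snd x)) \<le> L"
      proof (rule AE_pmfI)
        fix x assume x: "x \<in> set_pmf (random_root (P n))"
        have "0 \<le> matched_value F f (H (fst x)) (fst x) (snd x)"
          "matched_value F f (H (fst x)) (fst x) (snd x) \<le> L"
          by (rule matched_value_bounds[OF wf(1)[OF x] locally_finite_finite[OF wf(1,2)[OF x]] _ f fin[OF x]],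
              use wf(2)[OF x] in simp)+
        then show "norm (matched_value F f (H (fst x)) (fst x) (snd x)) \<le> L" by simp
      qed
    qed simp
    have i2: "integrable (?Q n) (\<lambda>x. cut_value f K r (rooted_class (fst x) (snd x)))"
      using cut_value_bound by (intro measure_pmf.integrable_const_bound[where B = "real K * L"]) auto
    have i3: "integrable (?Q n) (\<lambda>x. cut_error L K r (rooted_class (fst x) (snd x)))"
      using cut_error_bound by (intro measure_pmf.integrable_const_bound[where B = "L * (real K + 1)"]) auto
    have "\<bar>\<integral>x. matched_value F f (H (fst x)) (fst x) (snd x)
        - cut_value f K r (rooted_class (fst x) (snd x)) \<partial>?Q n\<bar>
      \<le> (\<integral>x. \<bar>matched_value F f (H (fst x)) (fst x) (snd x)
        - cut_value f K r (rooted_class (fst x) (snd x))\<bar> \<partial>?Q n)"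
      by (rule integral_abs_bound)
    also have "\<dots> \<le> (\<integral>x. cut_error L K r (rooted_class (fst x) (snd x)) \<partial>?Q n)"
      using matched_value_cut[OF wf]
      by (intro integral_mono_AE integrable_abs Bochner_Integration.integrable_diff i1 i2 i3 AE_pmfI)
    finally show ?thesis using i1 i2 by simp
  qed
  \<comment> \<open>With \<open>K\<close> and \<open>r\<close> fixed, \<open>b\<close> and
    \<open>d\<close> are expectations of bounded functions of the ball of radius
    \<open>r + 2\<close>. Each of the two bounds below \<open>\<epsilon>\<close> spends one half on
    \<open>K\<close> and one half on \<open>r\<close>.\<close>
  show "\<exists>b d b' d'. (\<forall>n. \<bar>(\<integral>x. matched_value F f (H (fst x)) (fst x) (snd x) \<partial>?Q n) - b n\<bar> \<le> d n) \<and>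
    b \<longlonglongrightarrow> b' \<and> d \<longlonglongrightarrow> d' \<and> d' < \<epsilon> \<and> \<bar>b' - (\<integral>g. limit_value g \<partial>\<mu>)\<bar> < \<epsilon>"
  proof (intro exI conjI allI)
    show "(\<lambda>n. \<integral>x. cut_value f K r (rooted_class (fst x) (snd x)) \<partial>?Q n) \<longlonglongrightarrow> (\<integral>g. cut_value f K r g \<partial>\<mu>)"
      by (rule convergence_of_same_ball[OF _ cut_value_bound]) (rule cut_value_same_ball)
    show "(\<lambda>n. \<integral>x. cut_error L K r (rooted_class (fst x) (snd x)) \<partial>?Q n) \<longlonglongrightarrow> (\<integral>g. cut_error L K r g \<partial>\<mu>)"
      by (rule convergence_of_same_ball[OF _ cut_error_bound]) (rule cut_error_same_ball)
    show "(\<integral>g. cut_error L K r g \<partial>\<mu>) < \<epsilon>" using r(2) K(2) by linarith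
    show "\<bar>(\<integral>g. cut_value f K r g \<partial>\<mu>) - (\<integral>g. limit_value g \<partial>\<mu>)\<bar> < \<epsilon>" using r(1) K(1) by linarith
  qed (rule approx)
qed

end

end

section \<open>Expectations as extended nonnegative integrals, for bounded functions of the
  weights\<close>

lemma ennreal_half_less_top: "(1 / 2 :: ennreal) < top"
  using ennreal_less_top[of "1 / 2"] by (simp add: divide_ennreal_def)

definition half_edge_sum :: "(real \<Rightarrow> real) \<Rightarrow> (nat \<Rightarrow> 'a graph) \<Rightarrow> 'a graph \<Rightarrow> 'a \<Rightarrow> ('a set \<Rightarrow> real) \<Rightarrow> real" where
  "half_edge_sum f H G v w = (\<Sum>u\<in>neighbours G v. f (w {v, u}) * of_bool ({v, u} \<in> mwm_along H G w))"

context local_limit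
begin

text \<open>The prelimit expectation for a general function of the weights: 1 gives the number of
  edges, the identity the weight, \<open>clip k\<close> the bounded approximation. The matching
  itself is always that of the original weights.\<close>

definition mean_weight :: "(real \<Rightarrow> real) \<Rightarrow> nat \<Rightarrow> ennreal" where
  "mean_weight f n = (\<integral>\<^sup>+G. (\<integral>\<^sup>+w. ennreal ((\<Sum>e\<in>mwm G w. f (w e)) / real (card (verts G)))
     \<partial>edge_weights F G) \<partial>measure_pmf (P n))"

definition root_weight :: "(real \<Rightarrow> real) \<Rightarrow> rgraph \<Rightarrow> ennreal" where
  "root_weight f g = (\<integral>\<^sup>+w. ennreal (half_edge_sum f (H (graph_of g)) (graph_of g) (root_of g) w)
     \<partial>edge_weights F (graph_of g))"

context
  fixes f :: "real \<Rightarrow> real" and L :: real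
  assumes f: "f \<in> borel_measurable borel" "\<And>x. 0 \<le> f x" "\<And>x. f x \<le> L"
begin

lemma AE_root_weight:
  "AE g in \<mu>. root_weight f g = ennreal (limit_value f g)"
  using AE_limit_value[OF f]
proof eventually_elim
  case (elim g)
  then show ?case
    unfolding root_weight_def half_edge_sum_def
    using nn_integral_matched_sum[OF wf_graph_of locally_finite_graph_of exhaust_graph_of f finite_neighbours_root, of g]
    by simp
qed

text \<open>The integrand \<open>root_weight f\<close> is not shown to be measurable; its integral
  is evaluated through the measurable function \<open>limit_value f\<close>, which agrees with it
  almost surely.\<close>

lemma nn_integral_root_weight: "(\<integral>\<^sup>+g. root_weight f g \<partial>\<mu>) = ennreal (\<integral>g. limit_value f g \<partial>\<mu>)"
proof -
  have "(\<integral>\<^sup>+g. root_weight f g \<partial>\<mu>) = (\<integral>\<^sup>+g. ennreal (limit_value f g) \<partial>\<mu>)"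
    by (rule nn_integral_cong_AE[OF AE_root_weight])
  also have "\<dots> = ennreal (\<integral>g. limit_value f g \<partial>\<mu>)"
  proof (rule nn_integral_eq_integral)
    show "AE g in \<mu>. 0 \<le> limit_value f g" using AE_limit_value[OF f] by eventually_elim simp
    have "AE g in \<mu>. norm (limit_value f g) \<le> L" using AE_limit_value[OF f] by eventually_elim simp
    then show "integrable \<mu> (limit_value f)"
      by (rule limit.integrable_const_bound) (rule measurable_limit_value[OF f])
  qed
  finally show ?thesis .
qed

lemma mean_weight_eq:
  "mean_weight f n = 1 / 2 *
    ennreal (\<integral>x. matched_value F f (H (fst x)) (fst x) (snd x) \<partial>measure_pmf (random_root (P n)))"
proof -
  let ?m = "\<lambda>G v. matched_value F f (H G) G v"
  have b: "0 \<le> ?m G v" "?m G v \<le> L" if "wf_graph G" "finite (verts G)" for G v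
  proof -
    have fin: "finite (neighbours G v)"
      using neighbours_verts[OF that(1)] that(2) by (rule finite_subset)
    have "infinite (verts G) \<Longrightarrow> exhaustion (H G) G" using that(2) by simp
    from matched_value_bounds[OF that(1) locally_finite_finite[OF that] this f fin]
    show "0 \<le> ?m G v" "?m G v \<le> L" by simp_all
  qed
  have G: "wf_graph G" "finite (verts G)" "verts G \<noteq> {}" if "G \<in> set_pmf (P n)" for G
    using finite_graphs[OF that] by simp_all
  have "mean_weight f n = (\<integral>\<^sup>+G. 1 / 2 * (\<integral>\<^sup>+v. ennreal (?m G v) \<partial>measure_pmf (pmf_of_set (verts G))) \<partial>measure_pmf (P n))"
    unfolding mean_weight_def
  proof (intro nn_integral_cong_AE AE_pmfI)
    fix G assume "G \<in> set_pmf (P n)"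
    note G = G[OF this]
    have "(\<integral>\<^sup>+w. ennreal ((\<Sum>e\<in>mwm G w. f (w e)) / real (card (verts G))) \<partial>edge_weights F G)
        = 1 / 2 * ennreal ((\<Sum>v\<in>verts G. ?m G v) / real (card (verts G)))"
      by (rule nn_integral_mwm_sum[OF G(1) locally_finite_finite[OF G(1,2)] _ f G(2)]) (simp add: G(2))
    also have "ennreal ((\<Sum>v\<in>verts G. ?m G v) / real (card (verts G)))
        = (\<integral>\<^sup>+v. ennreal (?m G v) \<partial>measure_pmf (pmf_of_set (verts G)))"
    proof -
      have "card (verts G) > 0" using G(2,3) by (simp add: card_gt_0_iff)
      then show ?thesis
        using b[OF G(1,2)]
        by (simp add: nn_integral_pmf_of_set G sum_ennreal sum_nonneg divide_ennreal
            ennreal_of_nat_eq_real_of_nat flip: divide_ennreal)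
    qed
    finally show "(\<integral>\<^sup>+w. ennreal ((\<Sum>e\<in>mwm G w. f (w e)) / real (card (verts G))) \<partial>edge_weights F G)
      = 1 / 2 * (\<integral>\<^sup>+v. ennreal (?m G v) \<partial>measure_pmf (pmf_of_set (verts G)))" .
  qed
  also have "\<dots> = 1 / 2 * (\<integral>\<^sup>+x. ennreal (?m (fst x) (snd x)) \<partial>measure_pmf (random_root (P n)))"
    by (simp add: random_root_def nn_integral_cmult)
  also have "(\<integral>\<^sup>+x. ennreal (?m (fst x) (snd x)) \<partial>measure_pmf (random_root (P n)))
      = ennreal (\<integral>x. ?m (fst x) (snd x) \<partial>measure_pmf (random_root (P n)))"
  proof (rule nn_integral_eq_integral)
    have m: "0 \<le> ?m (fst x) (snd x) \<and> ?m (fst x) (snd x) \<le> L" if "x \<in> set_pmf (random_root (P n))" for x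
      using b[of "fst x" "snd x"] set_random_rootD[of "fst x" "snd x" n] that by simp
    show "AE x in measure_pmf (random_root (P n)). 0 \<le> ?m (fst x) (snd x)"
      using m by (intro AE_pmfI) blast
    show "integrable (measure_pmf (random_root (P n))) (\<lambda>x. ?m (fst x) (snd x))"
      using m by (intro measure_pmf.integrable_const_bound[where B = L] AE_pmfI) auto
  qed
  finally show ?thesis .
qed

lemma mean_weight_tendsto: "mean_weight f \<longlonglongrightarrow> 1 / 2 * (\<integral>\<^sup>+g. root_weight f g \<partial>\<mu>)"
  unfolding mean_weight_eq[abs_def] nn_integral_root_weight
  by (intro ennreal_tendsto_cmult tendsto_ennrealI expectation_tendsto[OF f])
    (rule ennreal_half_less_top)

end

section \<open>Unbounded weights\<close>

lemma AE_nonneg_weights: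
  fixes G :: "nat graph"
  assumes nonneg: "AE x in F. 0 \<le> x" and G: "wf_graph G"
  shows "AE w in edge_weights F G. \<forall>e\<in>edges G. 0 \<le> w e"
  unfolding edge_weights_def AE_ball_countable[OF countable_edges[OF G]]
  using AE_PiM_component[of "edges G" "\<lambda>_. F" _ "\<lambda>x. 0 \<le> x"] nonneg prob_space_axioms by blast

lemma nn_integral_weight:
  assumes "e \<in> E" "h \<in> borel_measurable borel"
  shows "(\<integral>\<^sup>+w. h (w e) \<partial>iid E) = (\<integral>\<^sup>+x. h x \<partial>F)"
proof -
  have "(\<integral>\<^sup>+x. h x \<partial>distr (iid E) F (\<lambda>w. w e)) = (\<integral>\<^sup>+w. h (w e) \<partial>iid E)"
    using assms by (intro nn_integral_distr measurable_component_singleton)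
      (simp_all add: measurable_cong_sets[OF sets_F refl])
  then show ?thesis
    using distr_PiM_component[of E "\<lambda>_. F" e] assms(1) prob_space_axioms by simp
qed

text \<open>Truncation from below at 0 makes the function nonnegative everywhere, as the bounded
  case demands, although the weights are nonnegative only almost surely. Only the summed weights are
  clipped, so the matching does not change with \<open>k\<close>.\<close>

definition clip :: "nat \<Rightarrow> real \<Rightarrow> real" where
  "clip k x = max 0 (min x (real k))"

lemma clip: "clip k \<in> borel_measurable borel" "0 \<le> clip k x" "clip k x \<le> real k"
  by (auto simp: clip_def[abs_def])

lemma clip_mono: "k \<le> l \<Longrightarrow> clip k x \<le> clip l x"
  by (auto simp: clip_def)

lemma clip_tendsto: "(\<lambda>k. clip k x) \<longlonglongrightarrow> max 0 x"
proof -
  obtain n where n: "x \<le> real n" using real_arch_simple by blast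
  have "\<forall>\<^sub>F k in sequentially. clip k x = max 0 x"
    using eventually_ge_at_top[of n]
  proof eventually_elim
    case (elim k)
    then have "x \<le> real k" using n by (meson of_nat_mono order_trans)
    then show ?case by (simp add: clip_def)
  qed
  then show ?thesis by (rule tendsto_eventually)
qed

lemma measurable_half_edge_sum:
  assumes f: "f \<in> borel_measurable borel"
  shows "half_edge_sum f (H (graph_of g)) (graph_of g) (root_of g) \<in> borel_measurable (edge_weights F (graph_of g))"
  unfolding half_edge_sum_def[abs_def] edge_weights_def
  by (intro borel_measurable_sum measurable_weight_of_bool f measurable_mwm_along wf_graph_of exhaust_graph_of)
    (simp add: neighbours_def adj_def)

lemma half_edge_sum_mono:
  "(\<And>x. f x \<le> f' x) \<Longrightarrow> half_edge_sum f Hs G v w \<le> half_edge_sum f' Hs G v w"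
  unfolding half_edge_sum_def by (intro sum_mono mult_right_mono) auto

text \<open>Monotone convergence leads to the positive part \<open>max 0\<close>, the pointwise
  limit of \<open>clip k\<close>; almost sure nonnegativity then replaces it by the
  identity.\<close>

lemma root_weight_clip_tendsto:
  assumes nonneg: "AE x in F. 0 \<le> x"
  shows "(\<lambda>k. root_weight (clip k) g) \<longlonglongrightarrow> root_weight (\<lambda>x. x) g"
proof -
  let ?S = "\<lambda>f. half_edge_sum f (H (graph_of g)) (graph_of g) (root_of g)"
  have "(\<lambda>k. root_weight (clip k) g) \<longlonglongrightarrow> root_weight (max 0) g"
    unfolding root_weight_def
  proof (rule nn_integral_LIMSEQ)
    show "incseq (\<lambda>k w. ennreal (?S (clip k) w))"
      by (intro incseq_SucI le_funI ennreal_leI half_edge_sum_mono clip_mono) simp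
    show "(\<lambda>w. ennreal (?S (clip k) w)) \<in> borel_measurable (edge_weights F (graph_of g))" for k
      by (intro measurable_ennreal[THEN measurable_compose[rotated]] measurable_half_edge_sum clip)
    show "(\<lambda>k. ennreal (?S (clip k) w)) \<longlonglongrightarrow> ennreal (?S (max 0) w)" for w
      unfolding half_edge_sum_def
      by (intro tendsto_ennrealI tendsto_sum tendsto_mult clip_tendsto tendsto_const)
  qed
  also have "root_weight (max 0) g = root_weight (\<lambda>x. x) g"
    unfolding root_weight_def
  proof (rule nn_integral_cong_AE, use AE_nonneg_weights[OF nonneg wf_graph_of] in eventually_elim)
    case (elim w)
    then have "?S (max 0) w = ?S (\<lambda>x. x) w"
      unfolding half_edge_sum_def by (intro sum.cong refl) (simp add: neighbours_def adj_def max_def)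
    then show ?case by simp
  qed
  finally show ?thesis .
qed

text \<open>Monotone convergence is applied to the measurable versions
  \<open>limit_value (clip k)\<close>. They are increasing in \<open>k\<close> only almost surely,
  hence the almost everywhere form of the theorem.\<close>

lemma nn_integral_root_weight_clip_tendsto:
  assumes nonneg: "AE x in F. 0 \<le> x"
  shows "(\<lambda>k. \<integral>\<^sup>+g. root_weight (clip k) g \<partial>\<mu>) \<longlonglongrightarrow> (\<integral>\<^sup>+g. root_weight (\<lambda>x. x) g \<partial>\<mu>)"
proof -
  let ?J = "\<lambda>k g. ennreal (limit_value (clip k) g)"
  have mono: "root_weight (clip k) g \<le> root_weight (clip l) g" if "k \<le> l" for k l g
    unfolding root_weight_def using that by (intro nn_integral_mono ennreal_leI half_edge_sum_mono clip_mono)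
  have AE: "AE g in \<mu>. \<forall>k. root_weight (clip k) g = ?J k g"
    unfolding AE_all_countable using AE_root_weight[OF clip] by blast
  have eq: "(\<integral>\<^sup>+g. root_weight (clip k) g \<partial>\<mu>) = (\<integral>\<^sup>+g. ?J k g \<partial>\<mu>)" for k
    by (rule nn_integral_cong_AE[OF AE_root_weight[OF clip]])
  have "(\<lambda>k. \<integral>\<^sup>+g. root_weight (clip k) g \<partial>\<mu>) \<longlonglongrightarrow> (SUP k. \<integral>\<^sup>+g. root_weight (clip k) g \<partial>\<mu>)"
    by (intro LIMSEQ_SUP incseq_SucI nn_integral_mono mono) simp
  also have "(SUP k. \<integral>\<^sup>+g. root_weight (clip k) g \<partial>\<mu>) = (\<integral>\<^sup>+g. (SUP k. ?J k g) \<partial>\<mu>)"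
    unfolding eq
  proof (rule nn_integral_monotone_convergence_SUP_AE[symmetric])
    show "AE g in \<mu>. ?J k g \<le> ?J (Suc k) g" for k
      using AE by eventually_elim (metis mono le_SucI order_refl)
    show "?J k \<in> borel_measurable \<mu>" for k
      by (intro measurable_ennreal[THEN measurable_compose[rotated]] measurable_limit_value[OF clip])
  qed
  also have "(\<integral>\<^sup>+g. (SUP k. ?J k g) \<partial>\<mu>) = (\<integral>\<^sup>+g. root_weight (\<lambda>x. x) g \<partial>\<mu>)"
  proof (rule nn_integral_cong_AE, use AE in eventually_elim)
    case (elim g)
    have "(\<lambda>k. root_weight (clip k) g) \<longlonglongrightarrow> (SUP k. root_weight (clip k) g)"
      by (intro LIMSEQ_SUP incseq_SucI mono) simp
    then have "(SUP k. root_weight (clip k) g) = root_weight (\<lambda>x. x) g"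
      using root_weight_clip_tendsto[OF nonneg] by (rule LIMSEQ_unique)
    then show ?case using elim by simp
  qed
  finally show ?thesis .
qed

lemma mean_weight_clip_le:
  assumes nonneg: "AE x in F. 0 \<le> x"
  shows "mean_weight (clip k) n \<le> mean_weight (\<lambda>x. x) n"
  unfolding mean_weight_def
proof (intro nn_integral_mono_AE AE_pmfI)
  fix G assume "G \<in> set_pmf (P n)"
  then have G: "wf_graph G" "finite (verts G)" using finite_graphs by auto
  show "AE w in edge_weights F G. ennreal ((\<Sum>e\<in>mwm G w. clip k (w e)) / real (card (verts G)))
      \<le> ennreal ((\<Sum>e\<in>mwm G w. w e) / real (card (verts G)))"
    using AE_nonneg_weights[OF nonneg G(1)]
  proof eventually_elim
    case (elim w)
    have "(\<Sum>e\<in>mwm G w. clip k (w e)) \<le> (\<Sum>e\<in>mwm G w. w e)"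
      using elim mwm_subset[OF finite_edges[OF G], of w] by (intro sum_mono) (auto simp: clip_def)
    then show ?case by (intro ennreal_leI divide_right_mono) auto
  qed
qed

text \<open>Every real \<open>x\<close> is at most \<open>clip k x\<close> plus the excess of
  \<open>x\<close> over \<open>k\<close>. The excess is summed over all edges instead of the matched
  ones: then each edge contributes the same expectation, independent of the matching, and the edge
  density appears.\<close>

lemma mean_weight_le_clip:
  "mean_weight (\<lambda>x. x) n \<le> mean_weight (clip k) n +
    (\<integral>\<^sup>+G. ennreal (real (card (edges G)) / real (card (verts G))) \<partial>measure_pmf (P n)) *
      (\<integral>\<^sup>+x. ennreal (max 0 (x - real k)) \<partial>F)"
proof -
  let ?t = "\<integral>\<^sup>+x. ennreal (max 0 (x - real k)) \<partial>F"
  let ?c = "\<lambda>G. real (card (verts G))"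
  have "(\<integral>\<^sup>+w. ennreal ((\<Sum>e\<in>mwm G w. w e) / ?c G) \<partial>edge_weights F G)
    \<le> (\<integral>\<^sup>+w. ennreal ((\<Sum>e\<in>mwm G w. clip k (w e)) / ?c G) \<partial>edge_weights F G)
      + ennreal (real (card (edges G)) / ?c G) * ?t" if "G \<in> set_pmf (P n)" for G
  proof -
    have G: "wf_graph G" "finite (verts G)" using finite_graphs[OF that] by auto
    note E = finite_edges[OF G]
    have meas: "(\<lambda>w. \<Sum>e\<in>edges G. max 0 (w e - real k)) \<in> borel_measurable (iid (edges G))"
      by (intro borel_measurable_sum borel_measurable_max borel_measurable_diff borel_measurable_const measurable_weight)
    have "(\<integral>\<^sup>+w. ennreal ((\<Sum>e\<in>mwm G w. w e) / ?c G) \<partial>iid (edges G))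
      \<le> (\<integral>\<^sup>+w. ennreal ((\<Sum>e\<in>mwm G w. clip k (w e)) / ?c G) +
          ennreal ((\<Sum>e\<in>edges G. max 0 (w e - real k)) / ?c G) \<partial>iid (edges G))"
    proof (intro nn_integral_mono)
      fix w
      have sub: "mwm G w \<subseteq> edges G" by (rule mwm_subset[OF E])
      have "(\<Sum>e\<in>mwm G w. w e) \<le> (\<Sum>e\<in>mwm G w. clip k (w e) + max 0 (w e - real k))"
        by (intro sum_mono) (auto simp: clip_def)
      also have "\<dots> \<le> (\<Sum>e\<in>mwm G w. clip k (w e)) + (\<Sum>e\<in>edges G. max 0 (w e - real k))"
        unfolding sum.distrib using sub E by (intro add_left_mono sum_mono2) auto
      finally have "(\<Sum>e\<in>mwm G w. w e) / ?c G \<le>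
          (\<Sum>e\<in>mwm G w. clip k (w e)) / ?c G + (\<Sum>e\<in>edges G. max 0 (w e - real k)) / ?c G"
        unfolding add_divide_distrib[symmetric] by (intro divide_right_mono) auto
      then have "ennreal ((\<Sum>e\<in>mwm G w. w e) / ?c G) \<le>
          ennreal ((\<Sum>e\<in>mwm G w. clip k (w e)) / ?c G + (\<Sum>e\<in>edges G. max 0 (w e - real k)) / ?c G)"
        by (rule ennreal_leI)
      also have "\<dots> = ennreal ((\<Sum>e\<in>mwm G w. clip k (w e)) / ?c G) +
          ennreal ((\<Sum>e\<in>edges G. max 0 (w e - real k)) / ?c G)"
        by (intro ennreal_plus divide_nonneg_nonneg sum_nonneg clip) auto
      finally show "ennreal ((\<Sum>e\<in>mwm G w. w e) / ?c G) \<le>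
          ennreal ((\<Sum>e\<in>mwm G w. clip k (w e)) / ?c G) +
          ennreal ((\<Sum>e\<in>edges G. max 0 (w e - real k)) / ?c G)" .
    qed
    also have "\<dots> = (\<integral>\<^sup>+w. ennreal ((\<Sum>e\<in>mwm G w. clip k (w e)) / ?c G) \<partial>iid (edges G))
        + (\<integral>\<^sup>+w. ennreal ((\<Sum>e\<in>edges G. max 0 (w e - real k)) / ?c G) \<partial>iid (edges G))"
    proof (rule nn_integral_add)
      \<comment> \<open>The index set of the sum is random; indicators turn it into a sum over a
        fixed set, whose terms are measurable.\<close>
      have "(\<lambda>w. \<Sum>e\<in>mwm G w. clip k (w e)) = (\<lambda>w. \<Sum>e\<in>edges G. clip k (w e) * of_bool (e \<in> mwm G w))"
        using mwm_subset[OF E] E by (intro ext sum.mono_neutral_cong_left) auto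
      then have "(\<lambda>w. \<Sum>e\<in>mwm G w. clip k (w e)) \<in> borel_measurable (iid (edges G))"
        by (simp only:) (intro borel_measurable_sum measurable_weight_of_bool clip measurable_mwm[OF E order_refl])
      then show "(\<lambda>w. ennreal ((\<Sum>e\<in>mwm G w. clip k (w e)) / ?c G)) \<in> borel_measurable (iid (edges G))"
        by measurable
      show "(\<lambda>w. ennreal ((\<Sum>e\<in>edges G. max 0 (w e - real k)) / ?c G)) \<in> borel_measurable (iid (edges G))"
        using meas by measurable
    qed
    also have "(\<integral>\<^sup>+w. ennreal ((\<Sum>e\<in>edges G. max 0 (w e - real k)) / ?c G) \<partial>iid (edges G))
        = (\<integral>\<^sup>+w. ennreal (1 / ?c G) * (\<Sum>e\<in>edges G. ennreal (max 0 (w e - real k))) \<partial>iid (edges G))"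
      by (intro nn_integral_cong, subst sum_ennreal, simp, subst ennreal_mult[symmetric])
        (auto intro!: sum_nonneg)
    also have "\<dots> = ennreal (1 / ?c G) * (\<Sum>e\<in>edges G. \<integral>\<^sup>+w. ennreal (max 0 (w e - real k)) \<partial>iid (edges G))"
    proof -
      have m: "(\<lambda>w. ennreal (max 0 (w e - real k))) \<in> borel_measurable (iid (edges G))" if "e \<in> edges G" for e
        using measurable_weight[OF that] by measurable
      then have "(\<lambda>w. \<Sum>e\<in>edges G. ennreal (max 0 (w e - real k))) \<in> borel_measurable (iid (edges G))"
        by (rule borel_measurable_sum)
      then show ?thesis using m by (simp add: nn_integral_cmult nn_integral_sum)
    qed
    also have "(\<Sum>e\<in>edges G. \<integral>\<^sup>+w. ennreal (max 0 (w e - real k)) \<partial>iid (edges G)) = (\<Sum>e\<in>edges G. ?t)"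
      by (intro sum.cong refl nn_integral_weight) auto
    also have "ennreal (1 / ?c G) * (\<Sum>e\<in>edges G. ?t) = ennreal (real (card (edges G)) / ?c G) * ?t"
      by (simp add: ennreal_of_nat_eq_real_of_nat mult.assoc[symmetric] flip: ennreal_mult)
    finally show ?thesis by (simp add: edge_weights_def)
  qed
  then have "mean_weight (\<lambda>x. x) n \<le> (\<integral>\<^sup>+G. (\<integral>\<^sup>+w. ennreal ((\<Sum>e\<in>mwm G w. clip k (w e)) / ?c G) \<partial>edge_weights F G)
      + ennreal (real (card (edges G)) / ?c G) * ?t \<partial>measure_pmf (P n))"
    unfolding mean_weight_def by (intro nn_integral_mono_AE AE_pmfI)
  also have "\<dots> = mean_weight (clip k) n + (\<integral>\<^sup>+G. ennreal (real (card (edges G)) / ?c G) \<partial>measure_pmf (P n)) * ?t"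
    unfolding mean_weight_def by (simp add: nn_integral_add nn_integral_multc)
  finally show ?thesis .
qed

lemma tail_tendsto_0:
  assumes "integrable F (\<lambda>x. x)"
  shows "(\<lambda>k. \<integral>\<^sup>+x. ennreal (max 0 (x - real k)) \<partial>F) \<longlonglongrightarrow> 0"
proof -
  note F = measurable_cong_sets[OF sets_F refl]
  have meas: "(\<lambda>x. max 0 (x - real k)) \<in> borel_measurable F" for k unfolding F by measurable
  have int: "integrable F (\<lambda>x. max 0 (x - real k))" for k
    by (rule Bochner_Integration.integrable_bound[OF assms meas]) (auto intro!: AE_I2)
  have "(\<lambda>k. \<integral>x. max 0 (x - real k) \<partial>F) \<longlonglongrightarrow> (\<integral>x. 0 \<partial>F)"
  proof (rule integral_dominated_convergence[where w = "\<lambda>x. \<bar>x\<bar>"])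
    show "AE x in F. (\<lambda>k. max 0 (x - real k)) \<longlonglongrightarrow> 0"
    proof (intro AE_I2)
      fix x :: real
      obtain m where m: "x \<le> real m" using real_arch_simple by blast
      have "\<forall>\<^sub>F k in sequentially. max 0 (x - real k) = 0"
        using eventually_ge_at_top[of m]
      proof eventually_elim
        case (elim k)
        then have "x \<le> real k" using m by (meson of_nat_mono order_trans)
        then show ?case by simp
      qed
      then show "(\<lambda>k. max 0 (x - real k)) \<longlonglongrightarrow> 0" by (rule tendsto_eventually)
    qed
    show "AE x in F. norm (max 0 (x - real k)) \<le> \<bar>x\<bar>" for k by (intro AE_I2) auto
    show "integrable F (\<lambda>x. \<bar>x\<bar>)" using assms by (rule integrable_abs)
  qed (simp, rule meas)
  then have "(\<lambda>k. ennreal (\<integral>x. max 0 (x - real k) \<partial>F)) \<longlonglongrightarrow> ennreal 0"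
    by (intro tendsto_ennrealI) simp
  moreover have "(\<integral>\<^sup>+x. ennreal (max 0 (x - real k)) \<partial>F) = ennreal (\<integral>x. max 0 (x - real k) \<partial>F)" for k
    by (rule nn_integral_eq_integral[OF int]) simp
  ultimately show ?thesis by (simp only: ennreal_0)
qed

lemma mean_weight_id_tendsto:
  assumes nonneg: "AE x in F. 0 \<le> x" and int: "integrable F (\<lambda>x. x)"
    and density: "(SUP n. \<integral>\<^sup>+G. ennreal (real (card (edges G)) / real (card (verts G))) \<partial>measure_pmf (P n)) < \<infinity>"
  shows "mean_weight (\<lambda>x. x) \<longlonglongrightarrow> 1 / 2 * (\<integral>\<^sup>+g. root_weight (\<lambda>x. x) g \<partial>\<mu>)"
proof (rule tendsto_ennreal_sandwich)
  let ?C = "SUP n. \<integral>\<^sup>+G. ennreal (real (card (edges G)) / real (card (verts G))) \<partial>measure_pmf (P n)"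
  let ?t = "\<lambda>k. \<integral>\<^sup>+x. ennreal (max 0 (x - real k)) \<partial>F"
  show "mean_weight (clip k) n \<le> mean_weight (\<lambda>x. x) n" for k n
    by (rule mean_weight_clip_le[OF nonneg])
  show "mean_weight (\<lambda>x. x) n \<le> mean_weight (clip k) n + ?C * ?t k" for k n
  proof (rule order_trans[OF mean_weight_le_clip[of n k]], intro add_left_mono mult_right_mono)
    show "(\<integral>\<^sup>+G. ennreal (real (card (edges G)) / real (card (verts G))) \<partial>measure_pmf (P n)) \<le> ?C"
      by (rule SUP_upper) simp
  qed simp
  show "mean_weight (clip k) \<longlonglongrightarrow> 1 / 2 * (\<integral>\<^sup>+g. root_weight (clip k) g \<partial>\<mu>)" for k
    by (rule mean_weight_tendsto[OF clip])
  show "(\<lambda>k. 1 / 2 * (\<integral>\<^sup>+g. root_weight (clip k) g \<partial>\<mu>)) \<longlonglongrightarrow> 1 / 2 * (\<integral>\<^sup>+g. root_weight (\<lambda>x. x) g \<partial>\<mu>)"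
    by (intro ennreal_tendsto_cmult nn_integral_root_weight_clip_tendsto nonneg)
    (rule ennreal_half_less_top)
  \<comment> \<open>The density bound enters here: multiplication by a finite constant preserves
    convergence to 0.\<close>
  show "(\<lambda>k. ?C * ?t k) \<longlonglongrightarrow> 0"
    using ennreal_tendsto_cmult[OF _ tail_tendsto_0[OF int], of ?C] density by simp
qed

end

theorem corollary1p8:
  fixes P :: "nat \<Rightarrow> nat graph pmf"
    and \<mu> :: "rgraph measure"
    and F :: "real measure"
    and p :: real
    and H :: "nat graph \<Rightarrow> nat \<Rightarrow> nat graph"
  assumes finite_graphs:
      "\<And>n G. G \<in> set_pmf (P n) \<Longrightarrow> wf_graph G \<and> finite (verts G) \<and> verts G \<noteq> {}"
    and law: "prob_space \<mu>" "sets \<mu> = sets borel"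
    and convergence: "local_weak_conv P \<mu>"
    and weights: "prob_space F" "sets F = sets borel"
      "AE x in F. 0 \<le> x" "\<And>x. emeasure F {x} = 0"
    and density:
      "(SUP n. \<integral>\<^sup>+G. ennreal (real (card (edges G)) / real (card (verts G))) \<partial>measure_pmf (P n)) < \<infinity>"
    and moment: "p > 1" "integrable F (\<lambda>x. \<bar>x\<bar> powr p)"
    and decay: "AE g in \<mu>. correlation_decay F (graph_of g)"
    and exhaust: "\<And>G. wf_graph G \<Longrightarrow> locally_finite G \<Longrightarrow> graph_connected G \<Longrightarrow> infinite (verts G) \<Longrightarrow>
      exhaustion (H G) G"
  shows "((\<lambda>n. \<integral>\<^sup>+G. (\<integral>\<^sup>+w. ennreal (mwm_weight G w / real (card (verts G)))
                     \<partial>edge_weights F G) \<partial>measure_pmf (P n))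
          \<longlonglongrightarrow>
          1 / 2 * (\<integral>\<^sup>+g. (\<integral>\<^sup>+w. ennreal (\<Sum>v\<in>neighbours (graph_of g) (root_of g).
                      w {root_of g, v} *
                      of_bool ({root_of g, v} \<in> mwm_along (H (graph_of g)) (graph_of g) w))
                    \<partial>edge_weights F (graph_of g)) \<partial>\<mu>)) \<and>
         ((\<lambda>n. \<integral>\<^sup>+G. (\<integral>\<^sup>+w. ennreal (real (card (mwm G w)) / real (card (verts G)))
                     \<partial>edge_weights F G) \<partial>measure_pmf (P n))
          \<longlonglongrightarrow>
          1 / 2 * (\<integral>\<^sup>+g. (\<integral>\<^sup>+w. ennreal (\<Sum>v\<in>neighbours (graph_of g) (root_of g).
                      of_bool ({root_of g, v} \<in> mwm_along (H (graph_of g)) (graph_of g) w))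
                    \<partial>edge_weights F (graph_of g)) \<partial>\<mu>))"
proof -
  interpret local_limit F P \<mu> H
    by (intro local_limit.intro weight_law.intro weight_law_axioms.intro local_limit_axioms.intro)
      (fact weights law finite_graphs convergence decay exhaust)+
  have int: "integrable F (\<lambda>x. x)"
  proof (rule Bochner_Integration.integrable_bound)
    show "integrable F (\<lambda>x. 1 + \<bar>x\<bar> powr p)" using moment(2) by simp
    show "(\<lambda>x. x) \<in> borel_measurable F" unfolding measurable_cong_sets[OF weights(2) refl] by simp
    \<comment> \<open>Since \<open>p > 1\<close>, the power dominates where the absolute value
      exceeds 1, and the constant 1 covers the rest; so the moment assumption gives integrability of
      the weights.\<close>
    have "\<bar>x\<bar> \<le> 1 + \<bar>x\<bar> powr p" for x :: real
    proof (cases "\<bar>x\<bar> \<le> 1")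
      case False
      then have "\<bar>x\<bar> powr 1 \<le> \<bar>x\<bar> powr p" using moment(1) by (intro powr_mono) auto
      then show ?thesis using False by simp
    qed (simp add: add_increasing2)
    then show "AE x in F. norm x \<le> norm (1 + \<bar>x\<bar> powr p)" by (intro AE_I2) simp
  qed
  \<comment> \<open>The constant function 1 with bound \<open>L = 1\<close> counts matching edges,
    which gives the second limit without clipping.\<close>
  have one: "(\<lambda>_. 1) \<in> borel_measurable borel" "0 \<le> (1 :: real)" "(1 :: real) \<le> 1" by simp_all
  show ?thesis
    using mean_weight_id_tendsto[OF weights(3) int density] mean_weight_tendsto[OF one]
    unfolding mean_weight_def[abs_def] root_weight_def half_edge_sum_def mwm_weight_def by simp
qed

end
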